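(* Fix an integer $n \geq 1$. Let $F(Y,X_{1},\ldots,X_{n})\in\mathbb{Z}[Y,X_{1},\ldots,X_{n}]$ be irreducible in $\mathbb{Q}[Y,X_{1},\ldots,X_{n}]$, of total degree $D$, with $\deg_{Y}(F)\geq 2$, and assume that the leading coefficient of $F$ as a polynomial in $Y$ is a nonzero constant. Then there is a constant $e(n)>0$ depending only on $n$ such that \[ N(F,B)\leq C(n,D)\, (\log (\|F\|+2))^{e(n)} B^{n-\frac{1}{2}}(\log (B+2))^{e(n)}\qquad \text{for all } B \geq 1, \] where $C(n,D)$ depends only on $n$ and $D$.
   Context: $N(F,B)$ is the number of $\mathbf{x} \in \mathbb{Z}^n \cap [-B,B]^n$ such that $F(y,\mathbf{x})=0$ for some $y\in\mathbb{Z}$; $\|F\|$ is the maximum absolute value of the coefficients of $F$. *)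

theory Defs
  imports Complex_Main "HOL-Computational_Algebra.Factorial_Ring"
    "HOL-Library.Poly_Mapping" "HOL-Library.FuncSet"
begin

text \<open>A monomial is a finitely supported exponent function on variable indices in
  \<^typ>\<open>nat\<close>; a polynomial is a finitely supported coefficient function on monomials, with the
  convolution product of \<^theory>\<open>HOL-Library.Poly_Mapping\<close>. Index \<open>0\<close> stands for \<open>Y\<close> and
  indices \<open>1, \<dots>, n\<close> stand for \<open>X\<^sub>1, \<dots>, X\<^sub>n\<close>.\<close>

type_synonym monomial = "nat \<Rightarrow>\<^sub>0 nat"
type_synonym 'a mpoly = "monomial \<Rightarrow>\<^sub>0 'a"

definition mpoly_vars :: "'a::zero mpoly \<Rightarrow> nat set" where
  "mpoly_vars p = (\<Union>m\<in>Poly_Mapping.keys p. Poly_Mapping.keys m)"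

text \<open>The underlying set of the polynomial ring \<open>R[Y, X\<^sub>1, \<dots>, X\<^sub>n]\<close>.\<close>

definition mpoly_ring :: "nat \<Rightarrow> 'a::zero mpoly set" where
  "mpoly_ring n = {p. mpoly_vars p \<subseteq> {0..n}}"

text \<open>The library's \<^const>\<open>irreducible\<close> refers to a whole type, here polynomials in infinitely
  many variables; this is the same definition relative to a subring \<open>R\<close>.\<close>

definition irreducible_in :: "'a::comm_semiring_1 set \<Rightarrow> 'a \<Rightarrow> bool" where
  "irreducible_in R p \<longleftrightarrow>
     p \<in> R \<and> p \<noteq> 0 \<and> \<not> (\<exists>q\<in>R. p * q = 1) \<and>
     (\<forall>a\<in>R. \<forall>b\<in>R. p = a * b \<longrightarrow> (\<exists>q\<in>R. a * q = 1) \<or> (\<exists>q\<in>R. b * q = 1))"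

definition rat_mpoly :: "int mpoly \<Rightarrow> rat mpoly" where
  "rat_mpoly p = Poly_Mapping.map of_int p"

definition monomial_degree :: "monomial \<Rightarrow> nat" where
  "monomial_degree m = (\<Sum>v\<in>Poly_Mapping.keys m. Poly_Mapping.lookup m v)"

text \<open>In the next three definitions the extra element \<open>0\<close> matters only for the zero
  polynomial.\<close>

definition total_degree :: "'a::zero mpoly \<Rightarrow> nat" where
  "total_degree p = Max (insert 0 (monomial_degree ` Poly_Mapping.keys p))"

definition degree_in :: "nat \<Rightarrow> 'a::zero mpoly \<Rightarrow> nat" where
  "degree_in v p = Max (insert 0 ((\<lambda>m. Poly_Mapping.lookup m v) ` Poly_Mapping.keys p))"

definition mpoly_height :: "int mpoly \<Rightarrow> int" where
  "mpoly_height p = Max (insert 0 ((\<lambda>m. \<bar>Poly_Mapping.lookup p m\<bar>) ` Poly_Mapping.keys p))"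

text \<open>The coefficient of the \<open>k\<close>-th power of variable \<open>v\<close>, as a polynomial in the other
  variables: the terms of \<open>p\<close> with exponent \<open>k\<close> at \<open>v\<close>, divided by that power.\<close>

definition coeff_in :: "nat \<Rightarrow> 'a::comm_monoid_add mpoly \<Rightarrow> nat \<Rightarrow> 'a mpoly" where
  "coeff_in v p k =
     (\<Sum>m\<in>{m \<in> Poly_Mapping.keys p. Poly_Mapping.lookup m v = k}.
        Poly_Mapping.single (m - Poly_Mapping.single v k) (Poly_Mapping.lookup p m))"

definition lead_coeff_in :: "nat \<Rightarrow> 'a::comm_monoid_add mpoly \<Rightarrow> 'a mpoly" where
  "lead_coeff_in v p = coeff_in v p (degree_in v p)"

definition const_mpoly :: "'a::zero \<Rightarrow> 'a mpoly" where
  "const_mpoly c = Poly_Mapping.single 0 c"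

definition eval_mpoly :: "'a::comm_semiring_1 mpoly \<Rightarrow> (nat \<Rightarrow> 'a) \<Rightarrow> 'a" where
  "eval_mpoly p f =
     (\<Sum>m\<in>Poly_Mapping.keys p. Poly_Mapping.lookup p m *
        (\<Prod>v\<in>Poly_Mapping.keys m. f v ^ Poly_Mapping.lookup m v))"

text \<open>Integer points of \<open>[-B, B]\<^sup>n\<close> are functions on \<open>{1..n}\<close>, extensional so that each point
  is represented, and hence counted, exactly once.\<close>

definition int_box :: "nat \<Rightarrow> real \<Rightarrow> (nat \<Rightarrow> int) set" where
  "int_box n B = {1..n} \<rightarrow>\<^sub>E {a. \<bar>real_of_int a\<bar> \<le> B}"

definition root_count :: "nat \<Rightarrow> int mpoly \<Rightarrow> real \<Rightarrow> nat" where
  "root_count n F B = card {x \<in> int_box n B. \<exists>y. eval_mpoly F (x(0 := y)) = 0}"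

end

theory Submission
  imports Defs "Berlekamp_Zassenhaus.Factor_Bound" "Subresultants.Subresultant_Gcd"
    "HOL-Real_Asymp.Real_Asymp"
begin

text \<open>Everything follows from the case of one variable \<open>X\<close>. Let \<open>f\<close> be monic in \<open>Y\<close> and
  irreducible of degree \<open>m \<ge> 2\<close>, and let \<open>p\<close> be a prime of size about \<open>\<surd>B\<close> up to logarithms
  which does not divide the discriminant polynomial of \<open>f\<close>. Fix a residue class \<open>(x\<^sub>0, y\<^sub>0)\<close>
  modulo \<open>p\<close> with \<open>f\<^sub>Y(x\<^sub>0, y\<^sub>0)\<close> nonzero modulo \<open>p\<close>. On the integral points of \<open>f = 0\<close> in this
  class, \<open>y\<close> is congruent to a fixed polynomial in \<open>x\<close> modulo any power of \<open>p\<close>, so the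
  pigeonhole principle (in place of the determinant method) produces a polynomial \<open>G\<close> of
  \<open>Y\<close>-degree below \<open>m\<close> and logarithmic \<open>X\<close>-degree which vanishes at all of them; by elimination
  the class contains only logarithmically many points. The remaining classes lie over the few
  zeros of the discriminant modulo \<open>p\<close>, where the trivial bound suffices.

  For more variables the statement proved by induction on \<open>n\<close> only assumes that \<open>F\<close> has no root
  \<open>Y = g(X)\<close> with \<open>g\<close> a rational polynomial. On lines parallel to the last axis on which \<open>F\<close>
  still has no polynomial root the one-variable case applies. If every slice \<open>X\<^sub>n = v\<close> with \<open>v\<close>
  up to a power of the logarithm of the height had a polynomial root, then by the one-variable
  case on finitely many lines, pigeonhole and interpolation so would \<open>F\<close>; hence some such slice
  has none. Lines carrying a polynomial root give solutions on that slice, and the induction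
  hypothesis bounds their number.\<close>

section \<open>Primes not dividing a given integer\<close>

text \<open>The obstacle to induction is that a slice of an irreducible polynomial may become
  reducible. Having no polynomial root is weaker, can be kept on a suitable slice, and is enough:
  over a line, a monic factorisation separates linear factors Y - q, which are exactly the
  polynomial roots, from irreducible factors of degree at least 2, which satisfy the square-root
  bound.

  One parameter M bounds the coefficients and B together. The prime has to exceed 8 sqrt B and to
  avoid the divisors of one nonzero discriminant value, so a Chebyshev bound gives p at most of
  order sqrt B (ln M)^2. A good residue class costs one further factor ln M, whence (ln M)^3. To
  find a rootless slice among H values, H must exceed a multiple of sqrt H (ln M)^3, whence H of
  order (ln M)^6. As such a slice still has height at most a constant times a fixed power of M, each
  induction step changes ln M by a constant factor only, and the exponent 3 is the same for all
  n.\<close>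

definition maxpow :: "nat \<Rightarrow> nat \<Rightarrow> nat" where
  "maxpow N p = (GREATEST e. p ^ e \<le> N)"

lemma maxpow:
  assumes "p \<ge> 2" "N \<ge> 1"
  shows "p ^ maxpow N p \<le> N" and "p ^ e \<le> N \<Longrightarrow> e \<le> maxpow N p"
proof -
  have b: "\<forall>e. p ^ e \<le> N \<longrightarrow> e \<le> N"
  proof (intro allI impI)
    fix e assume "p ^ e \<le> N"
    moreover have "e < 2 ^ e" by (rule less_exp)
    moreover have "(2::nat) ^ e \<le> p ^ e" using assms(1) by (intro power_mono) auto
    ultimately show "e \<le> N" by linarith
  qed
  have "p ^ 0 \<le> N" using assms by simp
  from GreatestI_nat[of "\<lambda>e. p ^ e \<le> N", OF this] b
  show "p ^ maxpow N p \<le> N" unfolding maxpow_def by blast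
  show "p ^ e \<le> N \<Longrightarrow> e \<le> maxpow N p"
    unfolding maxpow_def using Greatest_le_nat[of "\<lambda>e. p ^ e \<le> N" e N] b by blast
qed

text \<open>This is the least common multiple of 1, ..., N, written so that the bound N^\<pi>(N) can
  be read off factor by factor.\<close>

definition prime_power_prod :: "nat \<Rightarrow> nat" where
  "prime_power_prod N = (\<Prod>p\<in>{p. prime p \<and> p \<le> N}. p ^ maxpow N p)"

lemma dvd_prime_power_prod:
  assumes "1 \<le> r" "r \<le> N"
  shows "r dvd prime_power_prod N"
proof -
  have "r = (\<Prod>p\<in>prime_factors r. p ^ multiplicity p r)"
    using assms by (intro prime_factorization_nat) auto
  also have "\<dots> dvd prime_power_prod N"
    unfolding prime_power_prod_def
  proof (rule prod_dvd_prod_subset2)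
    show "prime_factors r \<subseteq> {p. prime p \<and> p \<le> N}"
      using assms by (auto simp: prime_factors_dvd dest!: dvd_imp_le)
    show "p ^ multiplicity p r dvd p ^ maxpow N p" if p: "p \<in> prime_factors r" for p
    proof -
      have "p ^ multiplicity p r \<le> r"
        using assms by (intro dvd_imp_le multiplicity_dvd) auto
      then have "multiplicity p r \<le> maxpow N p"
        using p assms by (intro maxpow(2) prime_ge_2_nat) auto
      then show ?thesis by (rule le_imp_power_dvd)
    qed
  qed simp
  finally show ?thesis .
qed

lemma prime_power_prod_le:
  assumes "N \<ge> 1"
  shows "prime_power_prod N \<le> N ^ card {p. prime p \<and> p \<le> N}"
proof -
  have "prime_power_prod N \<le> (\<Prod>p\<in>{p. prime p \<and> p \<le> N}. N)"
    unfolding prime_power_prod_def using assms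
    by (intro prod_mono) (auto dest: prime_ge_2_nat intro: maxpow)
  then show ?thesis by simp
qed

text \<open>Along the Leibniz harmonic triangle
  \<open>1 / (c C(r, c)) = 1 / ((c - 1) C(r - 1, c - 1)) - 1 / ((c - 1) C(r, c - 1))\<close>
  integrality after multiplication by a common multiple of \<open>1, \<dots>, N\<close> propagates.\<close>

lemma mult_binomial_dvd:
  assumes W: "\<And>r. 1 \<le> r \<Longrightarrow> r \<le> N \<Longrightarrow> r dvd W" and "1 \<le> c" "c \<le> r" "r \<le> N"
  shows "c * (r choose c) dvd W"
proof -
  have "real W / real (c * (r choose c)) \<in> \<int>" using assms(2-4)
  proof (induction c arbitrary: r rule: nat_induct_at_least[of 1])
    case base
    with W[of r] obtain k where "W = r * k" by (auto elim: dvdE)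
    with base show ?case by simp
  next
    case (Suc c)
    then obtain q where r: "r = Suc q" by (cases r) auto
    have c: "c \<ge> 1" "c \<le> q" using Suc r by auto
    have 1: "real W / real (c * (q choose c)) \<in> \<int>" by (rule Suc.IH) (use c r Suc.prems in auto)
    have 2: "real W / real (c * (r choose c)) \<in> \<int>" by (rule Suc.IH) (use c r Suc.prems in auto)
    define a where "a = real (q choose c)"
    have a: "a > 0" using c by (simp add: a_def)
    have e1: "real (Suc c) * real (r choose Suc c) = real r * a"
      using Suc_times_binomial_eq[of q c] unfolding r a_def
      by (metis of_nat_mult mult.commute)
    have "Suc q * (q choose c) = (Suc q choose c) * (Suc q - c)"
      using binomial_absorb_comp[of "Suc q" c] by (simp add: mult.commute)
    then have e2: "real (r choose c) * (real r - real c) = real r * a"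
      unfolding r a_def using c
      by (metis Suc_leD le_SucI mult.commute of_nat_diff of_nat_mult)
    have rc: "real r - real c > 0" using c r by simp
    have e3: "real (r choose c) = real r * a / (real r - real c)"
      using e2 rc by (simp add: field_simps)
    \<comment> \<open>With x = c, y = r and a = C(q, c) this is the recurrence of the triangle;
      \<open>e1\<close> and \<open>e3\<close> rewrite the denominators formed from C(r, c + 1) and
      C(r, c).\<close>
    have "w / (y * a) = w / (x * a) - w / (x * (y * a / (y - x)))"
      if "x > 0" "y - x > 0" for w x y :: real
    proof -
      have "w / (x * (y * a / (y - x))) = w / (x * a) * ((y - x) / y)" by simp
      then have "w / (x * a) - w / (x * (y * a / (y - x))) = w / (x * a) * (1 - (y - x) / y)"
        by (simp only: right_diff_distrib mult_1_right)
      also have "1 - (y - x) / y = x / y" using that by (simp add: diff_divide_distrib)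
      also have "w / (x * a) * (x / y) = w / (y * a)" using that by simp
      finally show ?thesis ..
    qed
    from this[of "real c" "real r" "real W"] c rc
    have "real W / real (Suc c * (r choose Suc c)) =
      real W / real (c * (q choose c)) - real W / real (c * (r choose c))"
      unfolding of_nat_mult e1 e3 a_def[symmetric] by simp
    with 1 2 show ?case by simp
  qed
  then obtain k :: int where k: "real W / real (c * (r choose c)) = of_int k"
    by (auto elim: Ints_cases)
  have "c * (r choose c) > 0" using assms by simp
  with k have "real W = of_int k * real (c * (r choose c))"
    by (simp add: field_simps)
  then have "int W = k * int (c * (r choose c))"
    by (metis of_int_eq_iff of_int_mult of_int_of_nat_eq)
  then have "int (c * (r choose c)) dvd int W" by simp
  then show ?thesis by (simp only: int_dvd_int_iff)
qed

text \<open>Nair's argument: \<open>n * (2 * n choose n)\<close> is at least 4^n / 2 >= 2^n, and it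
  divides the least common multiple of 1, ..., 2n, which is a product of \<pi>(2n) prime powers,
  each at most 2n.\<close>

lemma prime_count_lower_bound:
  assumes "n \<ge> 1"
  shows "real n * ln 2 \<le> real (card {p. prime p \<and> p \<le> 2 * n}) * ln (2 * real n)"
proof -
  let ?\<pi> = "card {p::nat. prime p \<and> p \<le> 2 * n}"
  have "n * (2 * n choose n) dvd prime_power_prod (2 * n)"
    by (rule mult_binomial_dvd[where N = "2 * n"]) (use assms dvd_prime_power_prod in auto)
  moreover have "prime_power_prod (2 * n) > 0"
    unfolding prime_power_prod_def by (intro prod_pos) (auto dest: prime_gt_0_nat)
  ultimately have "n * (2 * n choose n) \<le> prime_power_prod (2 * n)" by (rule dvd_imp_le)
  also have "\<dots> \<le> (2 * n) ^ ?\<pi>" using assms by (intro prime_power_prod_le) auto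
  finally have "real (n * (2 * n choose n)) \<le> real ((2 * n) ^ ?\<pi>)"
    by (simp only: of_nat_le_iff)
  then have 1: "real n * real (2 * n choose n) \<le> (2 * real n) ^ ?\<pi>" by simp
  have "2 ^ n \<le> (4::real) ^ n / 2"
  proof -
    have "(4::real) ^ n = 2 ^ n * 2 ^ n" by (simp flip: power_mult_distrib)
    moreover have "(2::real) ^ n \<ge> 2 ^ 1" using assms by (intro power_increasing) auto
    ultimately show ?thesis by simp
  qed
  also have "\<dots> = real n * (4 ^ n / (2 * real n))" using assms by simp
  also have "\<dots> \<le> real n * real (2 * n choose n)"
    using central_binomial_lower_bound[of n] assms by (intro mult_left_mono) auto
  finally have "2 ^ n \<le> (2 * real n) ^ ?\<pi>" using 1 by linarith
  then have "ln ((2::real) ^ n) \<le> ln ((2 * real n) ^ ?\<pi>)" using assms by simp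
  then show ?thesis
    using assms ln_realpow[of 2 n] ln_realpow[of "2 * real n" ?\<pi>] by (simp del: power_mult_distrib)
qed

lemma two_power_card_prime_divisors_le:
  assumes "R \<noteq> 0"
  shows "finite {p. prime p \<and> int p dvd R}" and "2 ^ card {p. prime p \<and> int p dvd R} \<le> \<bar>R\<bar>"
proof -
  define r where "r = nat \<bar>R\<bar>"
  have r: "r > 0" "\<bar>R\<bar> = int r" using assms by (auto simp: r_def)
  have eq: "{p. prime p \<and> int p dvd R} = prime_factors r"
  proof -
    have "int p dvd R \<longleftrightarrow> p dvd r" for p
      by (metis dvd_abs_iff int_dvd_int_iff r(2))
    then show ?thesis using r by (auto simp: prime_factors_dvd)
  qed
  show "finite {p. prime p \<and> int p dvd R}" unfolding eq by simp
  have "2 ^ card (prime_factors r) = (\<Prod>p\<in>prime_factors r. 2::nat)" by simp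
  also have "\<dots> \<le> (\<Prod>p\<in>prime_factors r. p ^ multiplicity p r)"
  proof (intro prod_mono conjI)
    fix p assume p: "p \<in> prime_factors r"
    then have "multiplicity p r \<ge> 1" using r by (simp add: prime_factors_multiplicity)
    moreover have "p \<ge> 2" using p by (intro prime_ge_2_nat) auto
    ultimately have "p ^ 1 \<le> p ^ multiplicity p r" by (intro power_increasing) auto
    with \<open>p \<ge> 2\<close> show "2 \<le> p ^ multiplicity p r" by simp
  qed simp
  also have "\<dots> = r" using r by (intro prime_factorization_nat[symmetric]) auto
  finally show "2 ^ card {p. prime p \<and> int p dvd R} \<le> \<bar>R\<bar>" unfolding eq r
    by (simp flip: of_nat_power)
qed

lemma ln_2_ge_half: "ln (2::real) \<ge> 1/2"
proof -
  have "(1::real) = ln (exp 1)" by simp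
  also have "\<dots> \<le> ln 4" using exp_le by (subst ln_le_cancel_iff) auto
  also have "(4::real) = 2 ^ 2" by simp
  also have "ln (2 ^ 2::real) = 2 * ln 2" by (subst ln_realpow) auto
  finally show ?thesis by simp
qed

text \<open>For n about 16 Q ln Q there are more than Q primes up to 2n. At most P of them are <= P,
  and at most log_2 |R| divide R, since a product of distinct primes is at least a power of 2; the
  last hypothesis leaves one over.\<close>

lemma exists_prime_not_dvd:
  assumes "R \<noteq> 0" "Q \<ge> 2" "real P + log 2 (real_of_int \<bar>R\<bar>) \<le> Q"
  shows "\<exists>p. prime p \<and> P < p \<and> real p \<le> 40 * Q * ln Q \<and> \<not> int p dvd R"
proof -
  \<comment> \<open>The factor 16 wins because n ln 2 >= 8 Q ln Q while ln (2n) <= 7 ln Q; the 7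
    comes from 2n <= 32 Q^2 <= Q^7.\<close>
  define n where "n = nat \<lceil>16 * Q * ln Q\<rceil>"
  note ln2 = ln_2_ge_half
  have lnQ: "ln Q \<ge> ln 2" "ln Q \<ge> 1/2" using assms ln2 by (auto intro: order.trans)
  have QlnQ: "Q * ln Q \<ge> 1" using mult_mono[of 2 Q "1/2" "ln Q"] assms lnQ by simp
  have n1: "16 * Q * ln Q \<le> real n" "real n < 16 * Q * ln Q + 1"
    using QlnQ unfolding n_def by linarith+
  then have n: "n \<ge> 1" using QlnQ by (cases n) auto
  have "2 * real n \<le> 32 * (Q * ln Q) + 2" using n1 by simp
  also have "\<dots> \<le> 32 * (Q * (Q - 1)) + 2"
    using ln_le_minus_one[of Q] assms by (intro add_mono mult_left_mono) auto
  also have "\<dots> \<le> 32 * Q ^ 2" using assms by (simp add: power2_eq_square algebra_simps)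
  also have "\<dots> \<le> Q ^ 5 * Q ^ 2"
    using power_mono[of 2 Q 5] assms by (intro mult_right_mono) auto
  finally have "2 * real n \<le> Q ^ 7" by (simp flip: power_add)
  then have "ln (2 * real n) \<le> ln (Q ^ 7)" using n assms by simp
  also have "\<dots> = 7 * ln Q" using assms by (simp add: ln_realpow)
  finally have l: "ln (2 * real n) \<le> 7 * ln Q" .
  let ?A = "{p::nat. prime p \<and> p \<le> 2 * n}"
  have "7 * (Q * ln Q) < 16 * (1/2) * (Q * ln Q)" using QlnQ by simp
  also have "\<dots> \<le> 16 * ln 2 * (Q * ln Q)"
    using QlnQ ln2 by (intro mult_right_mono) auto
  finally have "7 * ln Q * Q < 16 * Q * ln Q * ln 2" by (simp add: mult_ac)
  also have "\<dots> \<le> real n * ln 2" using n1 ln2 by (intro mult_right_mono) auto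
  also have "\<dots> \<le> real (card ?A) * ln (2 * real n)" by (rule prime_count_lower_bound[OF n])
  also have "\<dots> \<le> real (card ?A) * (7 * ln Q)" using l by (intro mult_left_mono) auto
  finally have "(7 * ln Q) * Q < (7 * ln Q) * real (card ?A)" by (simp add: mult_ac)
  then have A: "Q < real (card ?A)" using lnQ by (subst (asm) mult_less_cancel_left_pos) auto
  let ?D = "{p. prime p \<and> int p dvd R}"
  note D = two_power_card_prime_divisors_le[OF assms(1)]
  have "(2::real) ^ card ?D \<le> real_of_int \<bar>R\<bar>"
    using D(2) by (metis of_int_le_iff of_int_numeral of_int_power)
  then have "real (card ?D) \<le> log 2 (real_of_int \<bar>R\<bar>)"
    using assms(1) by (subst le_log_iff) (auto simp: powr_realpow)
  then have "real (card ({1..P} \<union> ?D)) \<le> Q"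
    using card_Un_le[of "{1..P}" ?D] assms(3) by simp
  then have lt: "card ({1..P} \<union> ?D) < card ?A" using A by linarith
  have "\<not> ?A \<subseteq> {1..P} \<union> ?D"
  proof
    assume "?A \<subseteq> {1..P} \<union> ?D"
    then have "card ?A \<le> card ({1..P} \<union> ?D)" using D(1) by (intro card_mono) auto
    with lt show False by simp
  qed
  then obtain p where p: "prime p" "p \<le> 2 * n" "p \<notin> {1..P}" "\<not> int p dvd R"
    by blast
  have "real p \<le> 2 * real n" using p by linarith
  also have "\<dots> \<le> 40 * Q * ln Q" using n1 QlnQ by simp
  finally show ?thesis using p prime_ge_1_nat[of p] by (intro exI[of _ p]) auto
qed

section \<open>Bivariate integer polynomials and resultants\<close>

text \<open>An \<open>int poly poly\<close> is read as an element of Z[X][Y]: the outer variable is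
  Y, so \<open>degree\<close> and \<open>lead_coeff\<close> refer to Y and the coefficients are
  polynomials in X.\<close>

definition eval2 :: "int poly poly \<Rightarrow> int \<Rightarrow> int \<Rightarrow> int" where
  "eval2 f x y = poly (poly f [:y:]) x"

definition fix_x :: "int \<Rightarrow> int poly poly \<Rightarrow> int poly" where
  "fix_x x = map_poly (\<lambda>c. poly c x)"

interpretation fix_x: map_poly_comm_ring_hom "\<lambda>c. poly c (x::int)" ..

lemma eval2_simps [simp]:
  "eval2 (f + g) x y = eval2 f x y + eval2 g x y"
  "eval2 (f - g) x y = eval2 f x y - eval2 g x y"
  "eval2 (f * g) x y = eval2 f x y * eval2 g x y"
  "eval2 (f ^ k) x y = eval2 f x y ^ k"
  "eval2 [:c:] x y = poly c x"
  "eval2 0 x y = 0"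
  "eval2 1 x y = 1"
  "eval2 (monom c j) x y = poly c x * y ^ j"
  by (simp_all add: eval2_def poly_monom)

lemma poly_altdef_le: "degree p \<le> n \<Longrightarrow> poly p x = (\<Sum>i\<le>n. coeff p i * x ^ i)"
  for x :: "'a::comm_semiring_1"
  unfolding poly_altdef by (intro sum.mono_neutral_left) (auto simp: coeff_eq_0)

lemma eval2_sum: "eval2 (sum f A) x y = (\<Sum>i\<in>A. eval2 (f i) x y)"
  by (induction A rule: infinite_finite_induct) auto

lemma eval2_altdef: "eval2 f x y = (\<Sum>j\<le>degree f. poly (coeff f j) x * y ^ j)"
  by (subst poly_as_sum_of_monoms[of f, symmetric]) (simp add: eval2_sum)

lemma poly_fix_x: "poly (fix_x x f) y = eval2 f x y"
proof -
  have "poly (fix_x x f) y = (\<Sum>j\<le>degree f. coeff (fix_x x f) j * y ^ j)"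
    by (intro poly_altdef_le) (auto simp: fix_x_def intro: degree_map_poly_le)
  then show ?thesis by (simp add: fix_x_def coeff_map_poly eval2_altdef)
qed

lemma coeff_fix_x: "coeff (fix_x x f) j = poly (coeff f j) x"
  by (simp add: fix_x_def coeff_map_poly)

lemma degree_fix_x: "lead_coeff f = 1 \<Longrightarrow> degree (fix_x x f) = degree f"
  unfolding fix_x_def by (rule degree_map_poly) auto

lemma fix_x_dvd: "g dvd f \<Longrightarrow> fix_x x g dvd fix_x x f"
  unfolding fix_x_def by (rule fix_x.hom_dvd)

section \<open>Resultants and elimination\<close>

text \<open>Each row of the Sylvester matrix S lists the coefficients of a power of the variable
  times p or q. The identity adj S * S = det S * I, read in its last row, combines these rows to det
  S in the column of constant terms and to 0 in all other columns.\<close>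

lemma resultant_bezout:
  fixes p q :: "'a::comm_ring_1 poly"
  assumes "degree p + degree q > 0"
  shows "\<exists>u v. u * p + v * q = [:resultant p q:]"
proof -
  define m where "m = degree p"
  define k where "k = degree q"
  define n where "n = m + k"
  have n: "n > 0" using assms by (simp add: n_def m_def k_def)
  define S where "S = sylvester_mat p q"
  have S: "S \<in> carrier_mat n n" unfolding S_def n_def m_def k_def by (rule sylvester_carrier_mat)
  note A = adj_mat[OF S]
  define row where "row i = (\<Sum>j<n. monom (S $$ (i, j)) (n - 1 - j))" for i
  have row1: "row i = monom 1 (k - 1 - i) * p" if i: "i < k" for i
  proof -
    have "row i = (\<Sum>j<n. if i \<le> j \<and> j - i \<le> m then monom (coeff p (m + i - j)) (n - 1 - j) else 0)"
      unfolding row_def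
    proof (rule sum.cong)
      fix j assume "j \<in> {..<n}"
      then show "monom (S $$ (i, j)) (n - 1 - j) = (if i \<le> j \<and>
        j - i \<le> m then monom (coeff p (m + i - j)) (n - 1 - j) else 0)"
        using i unfolding S_def by (subst sylvester_index_mat) (auto simp: n_def m_def k_def)
    qed simp
    also have "\<dots> = (\<Sum>j\<in>{i..i+m}. monom (coeff p (m + i - j)) (n - 1 - j))"
      using i by (intro sum.mono_neutral_cong_right) (auto simp: n_def)
    also have "\<dots> = (\<Sum>l\<le>m. monom 1 (k - 1 - i) * monom (coeff p l) l)"
      using i by (intro sum.reindex_bij_witness[of _ "\<lambda>l. m + i - l" "\<lambda>j. m + i - j"])
        (auto simp: n_def mult_monom add.commute)
    also have "\<dots> = monom 1 (k - 1 - i) * p"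
      by (simp only: sum_distrib_left[symmetric] m_def poly_as_sum_of_monoms)
    finally show ?thesis .
  qed
  have row2: "row i = monom 1 (n - 1 - i) * q" if i: "k \<le> i" "i < n" for i
  proof -
    have "row i = (\<Sum>j<n. if i - k \<le> j \<and> j \<le> i then monom (coeff q (i - j)) (n - 1 - j) else 0)"
      unfolding row_def
    proof (rule sum.cong)
      fix j assume "j \<in> {..<n}"
      then show "monom (S $$ (i, j)) (n - 1 - j) = (if i - k \<le> j \<and>
        j \<le> i then monom (coeff q (i - j)) (n - 1 - j) else 0)"
        using i unfolding S_def by (subst sylvester_index_mat) (auto simp: n_def m_def k_def)
    qed simp
    also have "\<dots> = (\<Sum>j\<in>{i-k..i}. monom (coeff q (i - j)) (n - 1 - j))"
      using i by (intro sum.mono_neutral_cong_right) (auto simp: n_def)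
    also have "\<dots> = (\<Sum>l\<le>k. monom 1 (n - 1 - i) * monom (coeff q l) l)"
      using i by (intro sum.reindex_bij_witness[of _ "\<lambda>l. i - l" "\<lambda>j. i - j"])
        (auto simp: n_def mult_monom add.commute)
    also have "\<dots> = monom 1 (n - 1 - i) * q"
      by (simp only: sum_distrib_left[symmetric] k_def poly_as_sum_of_monoms)
    finally show ?thesis .
  qed
  let ?a = "\<lambda>i. adj_mat S $$ (n - 1, i)"
  have "(\<Sum>i<n. smult (?a i) (row i)) = (\<Sum>j<n. monom (\<Sum>i<n. ?a i * S $$ (i, j)) (n - 1 - j))"
    unfolding row_def smult_sum2
    by (subst sum.swap) (simp add: smult_monom monom_sum)
  also have "\<dots> = (\<Sum>j<n. monom (if j = n - 1 then det S else 0) (n - 1 - j))"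
  proof (intro sum.cong refl arg_cong2[of _ _ _ _ monom])
    fix j assume j: "j \<in> {..<n}"
    have "(\<Sum>i<n. ?a i * S $$ (i, j)) = (adj_mat S * S) $$ (n - 1, j)"
      using A(1) S n j by (auto simp: scalar_prod_def lessThan_atLeast0)
    also have "\<dots> = (if j = n - 1 then det S else 0)"
      unfolding A(3) using n j by auto
    finally show "(\<Sum>i<n. ?a i * S $$ (i, j)) = (if j = n - 1 then det S else 0)" .
  qed
  also have "\<dots> = (\<Sum>j\<in>{n - 1}. monom (det S) (n - 1 - j))"
    using n by (intro sum.mono_neutral_cong_right) auto
  also have "\<dots> = [:resultant p q:]" by (simp add: resultant_def S_def monom_0)
  finally have main: "(\<Sum>i<n. smult (?a i) (row i)) = [:resultant p q:]" .
  have "(\<Sum>i<n. smult (?a i) (row i)) = (\<Sum>i\<in>{..<k} \<union> {k..<n}. smult (?a i) (row i))"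
    by (intro sum.cong) (auto simp: n_def)
  also have "\<dots> = (\<Sum>i<k. smult (?a i) (row i)) + (\<Sum>i=k..<n. smult (?a i) (row i))"
    by (intro sum.union_disjoint) auto
  also have "(\<Sum>i<k. smult (?a i) (row i)) = (\<Sum>i<k. smult (?a i) (monom 1 (k - 1 - i))) * p"
    unfolding sum_distrib_right by (intro sum.cong) (auto simp: row1)
  also have "(\<Sum>i=k..<n. smult (?a i) (row i)) = (\<Sum>i=k..<n. smult (?a i) (monom 1 (n - 1 - i))) * q"
    unfolding sum_distrib_right by (intro sum.cong) (auto simp: row2)
  finally have "[:resultant p q:] = (\<Sum>i<k. smult (?a i) (monom 1 (k - 1 - i))) * p
      + (\<Sum>i=k..<n. smult (?a i) (monom 1 (n - 1 - i))) * q"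
    unfolding main .
  then show ?thesis by (intro exI) (rule sym)
qed

text \<open>With g the derivative of f and c a prime, this detects the residues x over which f has a
  multiple root. For c = 0 divisibility means vanishing, and the resultant is an elimination
  polynomial for the common zeros of f and g.\<close>

lemma resultant_dvd_at:
  fixes f g :: "int poly poly"
  assumes "degree f > 0" "c dvd eval2 f x y" "c dvd eval2 g x y"
  shows "c dvd poly (resultant f g) x"
proof -
  obtain u v where uv: "u * f + v * g = [:resultant f g:]"
    using resultant_bezout[of f g] assms(1) by auto
  have "poly (resultant f g) x = eval2 (u * f + v * g) x y" unfolding uv by simp
  also have "c dvd \<dots>" using assms by simp
  finally show ?thesis .
qed

lemma degree_resultant_le:
  fixes f g :: "'a::comm_ring_1 poly poly"
  assumes "\<And>j. degree (coeff f j) \<le> K" "\<And>j. degree (coeff g j) \<le> K"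
  shows "degree (resultant f g) \<le> (degree f + degree g) * K"
proof -
  have "degree (det (sylvester_mat f g)) \<le> K * (degree f + degree g)"
    by (rule degree_det_le[OF _ sylvester_carrier_mat])
      (use assms in \<open>auto simp: sylvester_index_mat\<close>)
  then show ?thesis by (simp add: resultant_def mult.commute)
qed

lemma abs_det_le:
  fixes A :: "int mat"
  assumes "A \<in> carrier_mat n n" "\<And>i j. i < n \<Longrightarrow> j < n \<Longrightarrow> \<bar>A $$ (i, j)\<bar> \<le> K"
  shows "\<bar>det A\<bar> \<le> fact n * K ^ n"
proof -
  have "\<bar>det A\<bar> = \<bar>\<Sum>p | p permutes {0..<n}. of_int (sign p) * (\<Prod>i = 0..<n. A $$ (i, p i))\<bar>"
    using assms(1) by (subst det_def') auto
  also have "\<dots> \<le> (\<Sum>p | p permutes {0..<n}. \<bar>of_int (sign p) * (\<Prod>i = 0..<n. A $$ (i, p i))\<bar>)"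
    by (rule sum_abs)
  also have "\<dots> \<le> (\<Sum>p | p permutes {0..<n}. K ^ n)"
  proof (rule sum_mono)
    fix p assume "p \<in> {p. p permutes {0..<n}}"
    then have p: "p i < n" if "i < n" for i using that permutes_in_image[of p "{0..<n}" i] by auto
    have "\<bar>of_int (sign p) * (\<Prod>i = 0..<n. A $$ (i, p i))\<bar> = (\<Prod>i = 0..<n. \<bar>A $$ (i, p i)\<bar>)"
      by (simp add: abs_mult abs_prod sign_def)
    also have "\<dots> \<le> (\<Prod>i = 0..<n. K)" using assms(2) p by (intro prod_mono) auto
    finally show "\<bar>of_int (sign p) * (\<Prod>i = 0..<n. A $$ (i, p i))\<bar> \<le> K ^ n" by simp
  qed
  also have "\<dots> = fact n * K ^ n" by (simp add: card_permutations)
  finally show ?thesis .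
qed

lemma abs_poly_resultant_le:
  fixes f g :: "int poly poly"
  assumes "\<And>j. \<bar>poly (coeff f j) x\<bar> \<le> K" "\<And>j. \<bar>poly (coeff g j) x\<bar> \<le> K"
  shows "\<bar>poly (resultant f g) x\<bar> \<le> fact (degree f + degree g) * K ^ (degree f + degree g)"
proof -
  have K: "0 \<le> K" using assms(1)[of 0] by (rule order.trans[rotated]) simp
  have "poly (resultant f g) x = det (map_mat (\<lambda>c. poly c x) (sylvester_mat f g))"
    by (simp only: resultant_def comm_ring_hom.hom_det[OF poly_hom.comm_ring_hom_axioms])
  moreover have "\<bar>det (map_mat (\<lambda>c. poly c x) (sylvester_mat f g))\<bar>
      \<le> fact (degree f + degree g) * K ^ (degree f + degree g)"
    by (rule abs_det_le) (use assms K in \<open>auto simp: sylvester_index_mat sylvester_carrier_mat\<close>)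
  ultimately show ?thesis by simp
qed

text \<open>A zero resultant yields a common divisor of positive degree in Y. By irreducibility it
  is associated to f, whose degree is too large to divide g.\<close>

lemma resultant_nonzero:
  fixes f g :: "int poly poly"
  assumes "irreducible f" "g \<noteq> 0" "degree g < degree f"
  shows "resultant f g \<noteq> 0"
proof
  assume "resultant f g = 0"
  then have d: "degree (gcd f g) \<noteq> 0" by (simp add: resultant_0_gcd)
  have "gcd f g dvd f" by simp
  then obtain h where h: "f = gcd f g * h" by (elim dvdE)
  have "\<not> gcd f g dvd 1" using d poly_dvd_1[of "gcd f g"] by auto
  with irreducibleD[OF assms(1) h] have "h dvd 1" by auto
  then have "f dvd gcd f g" using h by (metis dvd_mult_unit_iff dvd_refl)
  then have "f dvd g" by (rule dvd_trans) simp
  with assms(2,3) show False using dvd_imp_degree_le[of f g] by auto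
qed

section \<open>Sizes of factors and of roots\<close>

lemma coeff_mult_at_bounds:
  assumes "degree p \<le> a" "degree q \<le> b"
  shows "coeff (p * q) (a + b) = coeff p a * coeff q b"
proof (cases "degree p = a \<and> degree q = b")
  case True
  then show ?thesis using coeff_mult_degree_sum[of p q] by auto
next
  case False
  then have "degree p < a \<or> degree q < b" using assms by auto
  moreover from this have "degree (p * q) < a + b"
    using degree_mult_le[of p q] assms by linarith
  ultimately show ?thesis by (auto simp: coeff_eq_0)
qed

text \<open>Degrees in X add in a product over a domain: if a and b are the X-degrees of g and h,
  the coefficient of X^(a+b) in g * h is the product of the nonzero polynomials \<open>L g a\<close>
  and \<open>L h b\<close> in Y.\<close>

lemma degree_coeff_factor_le:
  fixes f g :: "'a::idom poly poly"
  assumes "g dvd f" "f \<noteq> 0" "\<And>j. degree (coeff f j) \<le> d"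
  shows "degree (coeff g j) \<le> d"
proof -
  have max: "\<exists>a. (\<forall>j. degree (coeff p j) \<le> a) \<and> (\<exists>j. coeff (coeff p j) a \<noteq> 0)"
    if "p \<noteq> 0" for p :: "'a poly poly"
  proof -
    define a where "a = Max ((\<lambda>j. degree (coeff p j)) ` {..degree p})"
    have le: "degree (coeff p j) \<le> a" for j
      by (cases "j \<le> degree p") (auto simp: a_def coeff_eq_0)
    have "a \<in> (\<lambda>j. degree (coeff p j)) ` {..degree p}" unfolding a_def by (intro Max_in) auto
    then obtain j where j: "a = degree (coeff p j)" by auto
    show ?thesis
    proof (cases "coeff p j = 0")
      case False
      then have "coeff (coeff p j) a \<noteq> 0" using j by simp
      with le show ?thesis by blast
    next
      \<comment> \<open>Degree 0 is also the degree of a zero coefficient, so the maximum may be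
        attained there; the leading coefficient is then a nonzero witness.\<close>
      case True
      with j have "a = 0" by simp
      with le have c: "coeff (coeff p (degree p)) a \<noteq> 0"
        using that le[of "degree p"] by (metis \<open>a = 0\<close> leading_coeff_0_iff le_zero_eq)
      with le show ?thesis by blast
    qed
  qed
  obtain h where h: "f = g * h" using assms(1) by (elim dvdE)
  then have "g \<noteq> 0" "h \<noteq> 0" using assms(2) by auto
  from max[OF this(1)] obtain a ja where a: "\<And>j. degree (coeff g j) \<le> a" "coeff (coeff g ja) a \<noteq>
    0" by auto
  from max[OF \<open>h \<noteq> 0\<close>] obtain b jb where b: "\<And>j. degree (coeff h j) \<le> b" "coeff (coeff h jb) b \<noteq>
    0" by auto
  define L where "L p c = map_poly (\<lambda>q. coeff q c) p" for p :: "'a poly poly" and c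
  have L: "coeff (L p c) j = coeff (coeff p j) c" for p c j by (simp add: L_def coeff_map_poly)
  have "L f (a + b) = L g a * L h b"
  proof (rule poly_eqI)
    fix j
    show "coeff (L f (a + b)) j = coeff (L g a * L h b) j"
      unfolding L h coeff_mult[of g h] coeff_mult[of "L g a"] Polynomial.coeff_sum
      by (intro sum.cong refl) (use a(1) b(1) in \<open>auto intro: coeff_mult_at_bounds\<close>)
  qed
  moreover have "L g a \<noteq> 0" "L h b \<noteq> 0"
    using a(2) b(2) L by (metis coeff_0)+
  ultimately have "L f (a + b) \<noteq> 0" by simp
  then obtain j where "coeff (L f (a + b)) j \<noteq> 0" by (metis coeff_0 poly_eqI)
  then have "a + b \<le> degree (coeff f j)" unfolding L by (rule le_degree)
  with assms(3)[of j] a(1)[of j] show ?thesis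
    by (metis a(1) add_leD1 order.trans)
qed

text \<open>Lagrange's bound for a polynomial that is not zero modulo p. Linear factors are split
  off over the integers: at a root modulo p the remainder of synthetic division is divisible by p,
  so some coefficient of the quotient is again not.\<close>

lemma card_roots_mod_prime_le:
  fixes f :: "int poly" and p :: int
  assumes "prime p" "\<not> p dvd coeff f k"
  shows "card {x \<in> {0..<p}. p dvd poly f x} \<le> degree f"
  using assms(2)
proof (induction "degree f" arbitrary: f k rule: less_induct)
  case less
  show ?case
  proof (cases "\<exists>a \<in> {0..<p}. p dvd poly f a")
    case False
    then have "{x \<in> {0..<p}. p dvd poly f x} = {}" by auto
    then show ?thesis by (metis card.empty le0)
  next
    case True
    then obtain a where a: "a \<in> {0..<p}" "p dvd poly f a" by auto
    define q where "q = synthetic_div f a"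
    have f: "f = [:-a, 1:] * q + [:poly f a:]"
      using synthetic_div_correct'[of a f] by (simp add: q_def)
    have deg: "degree q = degree f - 1" by (simp add: q_def degree_synthetic_div)
    have "\<not> (\<forall>i. p dvd coeff q i)"
    proof
      assume q: "\<forall>i. p dvd coeff q i"
      have "coeff f k = coeff ([:-a, 1:] * q) k + coeff [:poly f a:] k"
        by (subst f) simp
      moreover have "p dvd coeff ([:-a, 1:] * q) k"
        using q by (auto simp: coeff_pCons split: nat.splits)
      moreover have "p dvd coeff [:poly f a:] k" using a
        by (auto simp: coeff_pCons split: nat.splits)
      ultimately show False using less.prems by simp
    qed
    then obtain i where i: "\<not> p dvd coeff q i" by auto
    have pos: "degree f > 0"
    proof (rule ccontr)
      assume "\<not> degree f > 0"
      then have "q = 0" by (simp add: q_def synthetic_div_eq_0_iff)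
      with i show False by simp
    qed
    have "{x \<in> {0..<p}. p dvd poly f x} \<subseteq> insert a {x \<in> {0..<p}. p dvd poly q x}"
    proof
      fix x assume x: "x \<in> {x \<in> {0..<p}. p dvd poly f x}"
      have "poly f x = (x - a) * poly q x + poly f a" by (subst f) (simp add: algebra_simps)
      with x a have "p dvd (x - a) * poly q x"
        by (metis (mono_tags, lifting) dvd_add_left_iff mem_Collect_eq)
      then have "p dvd x - a \<or> p dvd poly q x" using assms(1) by (simp add: prime_dvd_mult_iff)
      moreover have "x = a" if "p dvd x - a"
        using that x a by (metis (mono_tags, lifting) atLeastLessThan_iff mem_Collect_eq
            mod_eq_dvd_iff mod_pos_pos_trivial)
      ultimately show "x \<in> insert a {x \<in> {0..<p}. p dvd poly q x}" using x by auto
    qed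
    moreover have fin: "finite {x \<in> {0..<p}. p dvd poly q x}"
      by (rule finite_subset[of _ "{0..<p}"]) auto
    ultimately have "card {x \<in> {0..<p}. p dvd poly f x} \<le> card (insert a {x \<in> {0..<p}. p dvd poly
      q x})"
      by (intro card_mono) auto
    also have "\<dots> \<le> Suc (card {x \<in> {0..<p}. p dvd poly q x})" using fin by (simp add: card_insert_if)
    also have "\<dots> \<le> Suc (degree q)" using less.hyps[OF _ i] deg pos by simp
    finally show ?thesis using deg pos by simp
  qed
qed

text \<open>Solving the equation for y^m, the remaining terms are at most m K |y|^(m-1) once |y| >=
  1.\<close>

lemma eval2_root_bound:
  assumes "lead_coeff f = 1" "degree f \<ge> 1" "eval2 f x y = 0" "\<And>j. \<bar>poly (coeff f j) x\<bar> \<le> K"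
  shows "\<bar>y\<bar> \<le> int (degree f) * K"
proof (cases "y = 0")
  case True
  have "0 \<le> K" using assms(4)[of 0] by (rule order.trans[rotated]) simp
  with True show ?thesis by simp
next
  case False
  define m where "m = degree f"
  have "{..m} = insert m {..<m}" by auto
  then have "y ^ m = - (\<Sum>j<m. poly (coeff f j) x * y ^ j)"
    using assms(1,3) by (simp add: eval2_altdef m_def)
  then have "\<bar>y\<bar> ^ m = \<bar>\<Sum>j<m. poly (coeff f j) x * y ^ j\<bar>" by (simp flip: power_abs)
  also have "\<dots> \<le> (\<Sum>j<m. \<bar>poly (coeff f j) x * y ^ j\<bar>)" by (rule sum_abs)
  also have "\<dots> \<le> (\<Sum>j<m. K * \<bar>y\<bar> ^ (m - 1))"
    unfolding abs_mult power_abs using assms(4) False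
    by (intro sum_mono mult_mono power_increasing) (auto intro: order.trans[OF abs_ge_zero])
  also have "\<dots> = (int m * K) * \<bar>y\<bar> ^ (m - 1)" by simp
  finally have "\<bar>y\<bar> * \<bar>y\<bar> ^ (m - 1) \<le> (int m * K) * \<bar>y\<bar> ^ (m - 1)"
    using assms(2) by (simp add: m_def flip: power_Suc)
  then show ?thesis using False by (simp add: m_def)
qed

lemma abs_poly_le:
  fixes q :: "int poly"
  assumes "degree q \<le> d" "\<And>i. \<bar>coeff q i\<bar> \<le> A" "\<bar>x\<bar> \<le> X" "1 \<le> X"
  shows "\<bar>poly q x\<bar> \<le> int (d + 1) * A * X ^ d"
proof -
  have "\<bar>poly q x\<bar> = \<bar>\<Sum>i\<le>d. coeff q i * x ^ i\<bar>" using assms(1) by (simp add: poly_altdef_le)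
  also have "\<dots> \<le> (\<Sum>i\<le>d. \<bar>coeff q i * x ^ i\<bar>)" by (rule sum_abs)
  also have "\<dots> \<le> (\<Sum>i\<le>d. A * X ^ d)"
  proof (rule sum_mono)
    fix i assume "i \<in> {..d}"
    then have "\<bar>x\<bar> ^ i \<le> X ^ d"
      using power_mono[of "\<bar>x\<bar>" X i] power_increasing[of i d X] assms(3,4) by auto
    then show "\<bar>coeff q i * x ^ i\<bar> \<le> A * X ^ d"
      unfolding abs_mult power_abs using assms(2)[of i] by (intro mult_mono) auto
  qed
  also have "\<dots> = int (d + 1) * A * X ^ d" by simp
  finally show ?thesis .
qed

text \<open>Mignotte's bound expresses the coefficients of g by its Mahler measure, which for
  integer polynomials does not exceed that of the multiple f; Landau's inequality bounds the latter
  by the Euclidean norm of f.\<close>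

lemma abs_coeff_factor_le:
  fixes f g :: "int poly"
  assumes "f \<noteq> 0" "g dvd f" "\<And>j. \<bar>coeff f j\<bar> \<le> K"
  shows "\<bar>coeff g j\<bar> \<le> 2 ^ degree f * int (degree f + 1) * K"
proof -
  have K: "0 \<le> K" using assms(3)[of 0] by (rule order.trans[rotated]) simp
  have deg: "degree g \<le> degree f" using assms dvd_imp_degree_le by auto
  have "(\<Sum>a\<leftarrow>coeffs f. a * a) \<le> (\<Sum>a\<leftarrow>coeffs f. K * K)"
  proof (rule sum_list_mono)
    fix a assume "a \<in> set (coeffs f)"
    then obtain i where "a = coeff f i" by (auto simp: coeffs_def split: if_splits)
    then have "\<bar>a\<bar> * \<bar>a\<bar> \<le> K * K" using assms(3)[of i] by (intro mult_mono) auto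
    then show "a * a \<le> K * K" by simp
  qed
  also have "\<dots> = int (degree f + 1) * K\<^sup>2"
    using assms(1) by (simp add: sum_list_triv length_coeffs_degree power2_eq_square)
  also have "\<dots> \<le> (int (degree f + 1))\<^sup>2 * K\<^sup>2"
    by (intro mult_right_mono) (auto simp: power2_eq_square)
  finally have "(\<Sum>a\<leftarrow>coeffs f. a * a) \<le> (int (degree f + 1) * K)\<^sup>2"
    by (simp only: power_mult_distrib)
  then have "real_of_int (\<Sum>a\<leftarrow>coeffs f. a * a) \<le> real_of_int ((int (degree f + 1) * K)\<^sup>2)"
    by (simp only: of_int_le_iff)
  then have s: "real_of_int (\<Sum>a\<leftarrow>coeffs f. a * a) \<le> (real (degree f + 1) * real_of_int K)\<^sup>2"
    by (simp only: of_int_power of_int_mult of_int_of_nat_eq)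
  have "mahler_measure g \<le> mahler_measure f" by (rule mahler_measure_dvd) (use assms in auto)
  also have "\<dots> \<le> sqrt (real_of_int (\<Sum>a\<leftarrow>coeffs f. a * a))" by (rule Landau_inequality_mahler_measure)
  also have "\<dots> \<le> real (degree f + 1) * real_of_int K"
    using s K by (intro real_le_lsqrt) auto
  finally have m: "mahler_measure g \<le> real (degree f + 1) * real_of_int K" .
  have "real (degree g choose j) \<le> 2 ^ degree g"
    using binomial_le_pow2[of "degree g" j] by (simp flip: of_nat_power)
  also have "\<dots> \<le> 2 ^ degree f" using deg by (intro power_increasing) auto
  finally have "real (degree g choose j) * mahler_measure g \<le> 2 ^ degree f * (real (degree f +
    1) * real_of_int K)"
    using m mahler_measure_ge_0[of g] by (intro mult_mono) auto
  with Mignotte_bound[of g j]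
  have "real_of_int \<bar>coeff g j\<bar> \<le> 2 ^ degree f * (real (degree f + 1) * real_of_int K)" by linarith
  also have "\<dots> = real_of_int (2 ^ degree f * int (degree f + 1) * K)" by simp
  finally show ?thesis by (simp only: of_int_le_iff)
qed

section \<open>The auxiliary polynomial of a residue class\<close>

lemma poly_taylor1:
  fixes q :: "'a::idom poly"
  shows "\<exists>k. poly q z - poly q y = (z - y) * (poly (pderiv q) y + (z - y) * k)"
proof (induction q)
  case 0
  then show ?case by (intro exI[of _ 0]) simp
next
  case (pCons a q)
  then obtain k where k: "poly q z - poly q y = (z - y) * (poly (pderiv q) y + (z - y) * k)"
    by blast
  then have k': "poly q z = poly q y + (z - y) * (poly (pderiv q) y + (z - y) * k)"
    by (simp add: algebra_simps)
  show ?case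
    by (rule exI[of _ "poly (pderiv q) y + z * k"]) (simp add: pderiv_pCons k' algebra_simps)
qed

lemma diff_dvd_poly_diff:
  fixes q :: "'a::idom poly"
  shows "z - y dvd poly q z - poly q y"
  using poly_taylor1[of q z y] by auto

lemma dvd_eval2_diff:
  assumes "p dvd x - x'" "p dvd y - y'"
  shows "p dvd eval2 g x y - eval2 g x' y'"
proof -
  have "p dvd poly (fix_x x g) y - poly (fix_x x g) y'"
    using assms(2) diff_dvd_poly_diff by (rule dvd_trans)
  moreover have "p dvd poly (poly g [:y':]) x - poly (poly g [:y':]) x'"
    using assms(1) diff_dvd_poly_diff by (rule dvd_trans)
  ultimately have "p dvd (poly (fix_x x g) y - poly (fix_x x g) y') + (poly (poly g [:y':]) x -
    poly (poly g [:y':]) x')"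
    by (rule dvd_add)
  then show ?thesis by (simp add: poly_fix_x eval2_def)
qed

lemma fix_x_pderiv: "fix_x x (pderiv f) = pderiv (fix_x x f)"
  by (rule poly_eqI) (simp add: coeff_fix_x coeff_pderiv)

text \<open>Newton iteration with a fixed inverse e of f_Y(x0, y0) modulo p. It gains one factor p
  per step and acts on the polynomial \<phi> rather than on a single y, so one \<phi> serves all
  integral points of the class at once.\<close>

lemma hensel_poly:
  fixes f :: "int poly poly" and p :: int
  assumes "prime p" "\<not> p dvd eval2 (pderiv f) x0 y0"
  shows "\<exists>\<phi>. \<forall>x y. eval2 f x y = 0 \<longrightarrow> p dvd x - x0 \<longrightarrow> p dvd y - y0 \<longrightarrow> p ^ N dvd y - poly \<phi> (x - x0)"
proof (induction N)
  case 0
  show ?case by simp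
next
  case (Suc N)
  show ?case
  \<comment> \<open>The Newton step needs p | z - y, which the induction hypothesis gives only for N
    >= 1; exponent 1 is supplied by the constant y0.\<close>
  proof (cases "N = 0")
    case True
    then show ?thesis by (intro exI[of _ "[:y0:]"]) auto
  next
    case False
    from Suc obtain \<phi> where \<phi>: "\<And>x y. eval2 f x y = 0 \<Longrightarrow> p dvd x - x0 \<Longrightarrow> p dvd y - y0 \<Longrightarrow>
      p ^ N dvd y - poly \<phi> (x - x0)"
      by blast
    have "algebraic_semidom_class.coprime (eval2 (pderiv f) x0 y0) p"
      using prime_imp_coprime[OF assms] by (simp add: algebraic_semidom_class.coprime_commute)
    then obtain e where e: "[eval2 (pderiv f) x0 y0 * e = 1] (mod p)"
      using cong_solve_coprime_int by blast
    \<comment> \<open>\<open>h\<close> is f(x0 + t, \<phi>(t)) as a polynomial in t, the quantity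
      that Newton's correction multiplies by e.\<close>
    define h where "h = (\<Sum>j\<le>degree f. pcompose (coeff f j) [:x0, 1:] * \<phi> ^ j)"
    have h: "poly h t = eval2 f (x0 + t) (poly \<phi> t)" for t
      by (simp add: h_def eval2_altdef poly_sum poly_pcompose)
    show ?thesis
    proof (intro exI[of _ "\<phi> - [:e:] * h"] allI impI)
      fix x y assume xy: "eval2 f x y = 0" "p dvd x - x0" "p dvd y - y0"
      define z where "z = poly \<phi> (x - x0)"
      have pN: "p ^ N dvd y - z" unfolding z_def by (rule \<phi>[OF xy])
      then have pz: "p dvd z - y" using False
        by (metis dvd_minus_iff dvd_power dvd_trans minus_diff_eq neq0_conv)
      obtain k where k: "poly (fix_x x f) z - poly (fix_x x f) y =
          (z - y) * (poly (pderiv (fix_x x f)) y + (z - y) * k)"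
        using poly_taylor1 by blast
      define d where "d = eval2 (pderiv f) x y"
      have k: "eval2 f x z = (z - y) * (d + (z - y) * k)"
        using k xy(1) by (simp add: poly_fix_x d_def flip: fix_x_pderiv)
      have "p dvd d - eval2 (pderiv f) x0 y0" unfolding d_def by (rule dvd_eval2_diff[OF xy(2,3)])
      moreover have "p dvd eval2 (pderiv f) x0 y0 * e - 1" using e by (simp add: cong_iff_dvd_diff)
      ultimately have "p dvd (d - eval2 (pderiv f) x0 y0) * e + (eval2 (pderiv f) x0 y0 * e - 1) +
        e * (z - y) * k"
        using pz by (intro dvd_add dvd_mult2 dvd_mult) auto
      also have "\<dots> = - (1 - e * (d + (z - y) * k))" by (simp add: algebra_simps)
      finally have pd: "p dvd 1 - e * (d + (z - y) * k)" by (simp only: dvd_minus_iff)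
      \<comment> \<open>The new error is the old one times 1 - e (d + ...), where d is congruent to
        f_Y(x0, y0) modulo p, so the second factor supplies the additional p.\<close>
      have "y - poly (\<phi> - [:e:] * h) (x - x0) = (y - z) * (1 - e * (d + (z - y) * k))"
        by (simp add: h z_def[symmetric] k algebra_simps)
      moreover have "p ^ N * p dvd (y - z) * (1 - e * (d + (z - y) * k))"
        using pN pd by (rule mult_dvd_mono)
      ultimately show "p ^ Suc N dvd y - poly (\<phi> - [:e:] * h) (x - x0)" by (simp add: mult.commute)
    qed
  qed
qed

text \<open>The j-th coefficient matters only modulo p^(s-j), because t^j contributes p^j. This
  lowers the number of residue data in the pigeonhole argument from p^(s^2) to p^(s(s+1)/2).\<close>

lemma power_dvd_poly:
  fixes q :: "int poly" and p t :: int
  assumes "\<And>j. j < s \<Longrightarrow> p ^ (s - j) dvd coeff q j" "p dvd t"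
  shows "p ^ s dvd poly q t"
  unfolding poly_altdef
proof (rule dvd_sum)
  fix j assume "j \<in> {..degree q}"
  show "p ^ s dvd coeff q j * t ^ j"
  proof (cases "j < s")
    case True
    then have "p ^ s = p ^ (s - j) * p ^ j" by (simp flip: power_add)
    then show ?thesis using assms(1)[OF True] dvd_power_same[OF assms(2), of j]
      by (simp add: mult_dvd_mono)
  next
    case False
    then have "p ^ s dvd p ^ j" by (intro le_imp_power_dvd) auto
    also have "\<dots> dvd t ^ j" by (rule dvd_power_same[OF assms(2)])
    finally show ?thesis by simp
  qed
qed

lemma double_sum_lessThan: "2 * (\<Sum>i<k. i) = k * (k - 1)" for k :: nat
proof (induction k)
  case (Suc k)
  then show ?case by (cases k) auto
qed simp

lemma double_sum_diff: "2 * (\<Sum>j < s. s - j) = s * (s + 1)" for s :: nat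
proof -
  have "(\<Sum>j < s. s - j) = (\<Sum>j < s. Suc j)"
    by (intro sum.reindex_bij_witness[of _ "\<lambda>j. s - Suc j" "\<lambda>j. s - Suc j"]) auto
  also have "2 * \<dots> = s * (s + 1)" by (induction s) auto
  finally show ?thesis .
qed

text \<open>The count behind the pigeonhole argument: with \<open>s = m k\<close> the coefficients \<open>c\<^sub>a\<^sub>b\<close> of
  \<open>X\<^sup>a Y\<^sup>b\<close> with weighted size \<open>c\<^sub>a\<^sub>b B\<^sup>a T\<^sup>b < p\<^sup>s / s\<close> outnumber the
  \<open>p\<^sup>s\<^sup>(\<^sup>s\<^sup>+\<^sup>1\<^sup>)\<^sup>/\<^sup>2\<close> residue data. The hypothesis \<open>64 B \<le> p\<^sup>2\<close> is where the exponent
  \<open>1/2\<close> comes from.\<close>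

lemma weighted_box_card:
  fixes p m k B T :: nat
  assumes "m \<ge> 2" "k \<ge> 1" "B \<ge> 1" "T \<ge> 1" "T < 2 ^ k" "64 * B \<le> p\<^sup>2"
  defines "s \<equiv> m * k"
  defines "M0 \<equiv> (p ^ s - 1) div s"
  shows "(\<Prod>j < s. p ^ (s - j)) < (\<Prod>(a,b)\<in>{..<k} \<times> {..<m}. M0 div (B ^ a * T ^ b) + 1)"
proof -
  define C where "C = (\<Prod>(a,b)\<in>{..<k} \<times> {..<m}. M0 div (B ^ a * T ^ b) + 1)"
  \<comment> \<open>W is chosen so that the square of the product of all weights B^a T^b s equals
    W^s. The estimate W < p^(s-1) then turns p^(2 s^2) <= C^2 W^s into p^(s(s+1)) < C^2.\<close>
  define W where "W = s ^ 2 * B ^ (k - 1) * T ^ (m - 1)"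
  have s: "s \<ge> 1" "s \<ge> 2 * k" using assms by (auto simp: s_def)
  have p: "p > 0" using assms by (cases p) auto
  have s_pow: "s \<le> 2 ^ (s - 1)"
    using s(1) less_exp[of "s - 1"] by linarith
  have T_pow: "T ^ (m - 1) < 2 ^ (s - 1)"
  proof -
    have "T ^ (m - 1) < (2 ^ k) ^ (m - 1)" using assms by (intro power_strict_mono) auto
    also have "\<dots> = 2 ^ (k * (m - 1))" by (simp flip: power_mult)
    also have "k * (m - 1) = s - k" by (simp add: s_def diff_mult_distrib2 mult.commute)
    also have "(2::nat) ^ (s - k) \<le> 2 ^ (s - 1)" using assms by (intro power_increasing) auto
    finally show ?thesis .
  qed
  \<comment> \<open>The factor s^4 T^(2(m-1)) stays below 2^(6(s-1)), which is the origin of 64. The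
    condition m >= 2 enters through s >= 2k, which gives B^(2(k-1)) <= B^(s-1).\<close>
  have "W\<^sup>2 = s ^ 4 * (T ^ (m - 1))\<^sup>2 * B ^ (2 * (k - 1))"
    unfolding W_def by (simp add: power_mult_distrib mult_ac flip: power_mult)
  also have "\<dots> < (2 ^ (s - 1)) ^ 4 * (2 ^ (s - 1))\<^sup>2 * B ^ (s - 1)"
  proof (rule mult_less_le_imp_less)
    show "s ^ 4 * (T ^ (m - 1))\<^sup>2 < (2 ^ (s - 1)) ^ 4 * (2 ^ (s - 1))\<^sup>2"
      using s_pow T_pow s(1) by (intro mult_le_less_imp_less power_mono power_strict_mono) auto
    show "B ^ (2 * (k - 1)) \<le> B ^ (s - 1)" using assms(2,3) s(2)
      by (intro power_increasing) linarith+
  qed (use assms(3) in auto)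
  also have "\<dots> = (64 * B) ^ (s - 1)"
  proof -
    have "(2 ^ (s - 1)) ^ 4 * (2 ^ (s - 1))\<^sup>2 = ((2::nat) ^ 6) ^ (s - 1)"
      by (simp only: power_add[symmetric]) (simp only: power_mult[symmetric] mult.commute, simp)
    then show ?thesis by (simp add: power_mult_distrib)
  qed
  also have "\<dots> \<le> (p\<^sup>2) ^ (s - 1)" using assms by (intro power_mono) auto
  also have "\<dots> = (p ^ (s - 1))\<^sup>2" by (simp flip: power_mult add: mult.commute)
  finally have W: "W < p ^ (s - 1)" using power_less_imp_less_base[of W 2] by blast
  have M0: "p ^ s \<le> (M0 + 1) * s"
  proof -
    have "p ^ s - 1 < (M0 + 1) * s"
      unfolding M0_def using s(1) by (simp add: dividend_less_div_times add.commute)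
    then show ?thesis by linarith
  qed
  have "p ^ (s * s) = (\<Prod>(a,b)\<in>{..<k} \<times> {..<m}. p ^ s)"
    by (simp add: card_cartesian_product s_def case_prod_unfold flip: power_mult) (simp add:
      mult_ac)
  also have "\<dots> \<le> (\<Prod>(a,b)\<in>{..<k} \<times> {..<m}. (M0 div (B ^ a * T ^ b) + 1) * (B ^ a * T ^ b * s))"
  proof (intro prod_mono, safe)
    fix a b
    have "M0 + 1 \<le> (M0 div (B ^ a * T ^ b) + 1) * (B ^ a * T ^ b)"
      using assms dividend_less_div_times[of "B ^ a * T ^ b" M0] by (simp add: add.commute)
    then have "(M0 + 1) * s \<le> (M0 div (B ^ a * T ^ b) + 1) * (B ^ a * T ^ b) * s"
      by (rule mult_right_mono) simp
    with M0 show "p ^ s \<le> (M0 div (B ^ a * T ^ b) + 1) * (B ^ a * T ^ b * s)"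
      by (simp only: mult.assoc)
  qed
  also have "\<dots> = C * (\<Prod>(a,b)\<in>{..<k} \<times> {..<m}. B ^ a * T ^ b * s)"
    unfolding C_def case_prod_unfold by (rule prod.distrib)
  also have "(\<Prod>(a,b)\<in>{..<k} \<times> {..<m}. B ^ a * T ^ b * s) =
      B ^ (m * (\<Sum>a<k. a)) * T ^ (k * (\<Sum>b<m. b)) * s ^ s"
  proof -
    have "(\<Prod>(a,b)\<in>{..<k} \<times> {..<m}. B ^ a * T ^ b * s) =
      B ^ (\<Sum>(a,b)\<in>{..<k} \<times> {..<m}. a) * T ^ (\<Sum>(a,b)\<in>{..<k} \<times> {..<m}. b) * s ^ s"
      by (simp add: prod.distrib case_prod_unfold power_sum card_cartesian_product s_def
        mult.commute)
    then show ?thesis by (simp flip: sum.cartesian_product add: sum_distrib_left)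
  qed
  finally have "p ^ (s * s) \<le> C * (B ^ (m * (\<Sum>a<k. a)) * T ^ (k * (\<Sum>b<m. b)) * s ^ s)" .
  then have "(p ^ (s * s))\<^sup>2 \<le> (C * (B ^ (m * (\<Sum>a<k. a)) * T ^ (k * (\<Sum>b<m. b)) * s ^ s))\<^sup>2"
    by (rule power_mono) simp
  also have "\<dots> = C\<^sup>2 * (B ^ (m * (2 * (\<Sum>a<k. a))) * T ^ (k * (2 * (\<Sum>b<m. b))) * s ^ (2 * s))"
    by (simp add: power_mult_distrib mult_ac flip: power_mult)
  also have "\<dots> = C\<^sup>2 * W ^ s"
    unfolding double_sum_lessThan W_def
    by (simp add: power_mult_distrib s_def mult_ac flip: power_mult)
  finally have le: "(p ^ (s * s))\<^sup>2 \<le> C\<^sup>2 * W ^ s" .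
  have "C > 0" unfolding C_def by (intro prod_pos) auto
  have "C\<^sup>2 * W ^ s < C\<^sup>2 * (p ^ (s - 1)) ^ s"
    using W s(1) \<open>C > 0\<close> by (intro mult_strict_left_mono power_strict_mono) auto
  with le have "(p ^ (s * s))\<^sup>2 < C\<^sup>2 * (p ^ (s - 1)) ^ s" by (rule le_less_trans)
  then have "(p ^ (s * s))\<^sup>2 < C\<^sup>2 * p ^ ((s - 1) * s)" by (simp only: power_mult)
  moreover have "(p ^ (s * s))\<^sup>2 = p ^ (s * (s + 1)) * p ^ ((s - 1) * s)"
  proof -
    have "s * s * 2 = s * (s + 1) + (s - 1) * s" using s(1) by (cases s) (auto simp: algebra_simps)
    then show ?thesis by (simp only: power_mult[symmetric] power_add[symmetric])
  qed
  ultimately have "p ^ (s * (s + 1)) < C\<^sup>2" by simp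
  moreover have "p ^ (s * (s + 1)) = (\<Prod>j < s. p ^ (s - j))\<^sup>2"
    by (simp only: double_sum_diff[symmetric] power_sum[symmetric] power_mult[symmetric]
      mult.commute)
  ultimately have "(\<Prod>j < s. p ^ (s - j)) < C" using power_less_imp_less_base[of _ 2 C] by simp
  then show ?thesis unfolding C_def .
qed

text \<open>Two coefficient families with equal residue data differ by the coefficients of G. At a
  point of the class, G(x, y) is divisible by p^s because y may be replaced by \<phi>(x - x0), while
  the weights keep |G(x, y)| below p^s; hence it vanishes.\<close>

lemma auxiliary_polynomial:
  fixes f :: "int poly poly" and p m k B T :: nat
  assumes "m \<ge> 2" "k \<ge> 1" "B \<ge> 1" "T \<ge> 1" "T < 2 ^ k" "64 * B \<le> p\<^sup>2"
    and p: "prime p" and nd: "\<not> int p dvd eval2 (pderiv f) x0 y0"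
  shows "\<exists>G. G \<noteq> 0 \<and> degree G < m \<and> (\<forall>j. degree (coeff G j) < k) \<and>
    (\<forall>x y. \<bar>x\<bar> \<le> int B \<longrightarrow> \<bar>y\<bar> \<le> int T \<longrightarrow> eval2 f x y = 0 \<longrightarrow>
      int p dvd x - x0 \<longrightarrow> int p dvd y - y0 \<longrightarrow> eval2 G x y = 0)"
proof -
  define s where "s = m * k"
  define M0 where "M0 = (p ^ s - 1) div s"
  have s: "s \<ge> 1" using assms by (simp add: s_def)
  define I where "I = {..<k} \<times> {..<m}"
  have I: "finite I" "card I = s" by (simp_all add: I_def s_def mult.commute)
  \<comment> \<open>With these ranges each term of G is at most M0 in absolute value where |x| <= B
    and |y| <= T, so the s terms sum to less than p^s.\<close>
  define N where "N = (\<lambda>(a,b). M0 div (B ^ a * T ^ b))"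
  define E where "E = (\<Pi>\<^sub>E i\<in>I. {0..N i})"
  have "prime (int p)" using p by simp
  from hensel_poly[OF this nd, of s] obtain \<phi> where
    \<phi>: "\<And>x y. eval2 f x y = 0 \<Longrightarrow> int p dvd x - x0 \<Longrightarrow> int p dvd y - y0 \<Longrightarrow>
      int p ^ s dvd y - poly \<phi> (x - x0)"
    by blast
  \<comment> \<open>\<open>\<Gamma> c\<close> is the polynomial with coefficients c after the
    substitution X = x0 + t, Y = \<phi>(t).\<close>
  define \<Gamma> where "\<Gamma> c = (\<Sum>(a,b)\<in>I. smult (int (c (a,b))) ([:x0, 1:] ^ a * \<phi> ^ b))"
    for c :: "nat \<times> nat \<Rightarrow> nat"
  define \<Phi> where "\<Phi> c = (\<lambda>j\<in>{..<s}. nat (coeff (\<Gamma> c) j mod int p ^ (s - j)))" for c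
  have p0: "p > 0" using p by (rule prime_gt_0_nat)
  have \<Phi>: "\<Phi> ` E \<subseteq> (\<Pi>\<^sub>E j\<in>{..<s}. {0..<p ^ (s - j)})"
    using p0 by (auto simp: \<Phi>_def nat_less_iff split: if_splits)
  have "card (\<Pi>\<^sub>E j\<in>{..<s}. {0..<p ^ (s - j)}) < card E"
  proof -
    have "card E = (\<Prod>(a,b)\<in>I. M0 div (B ^ a * T ^ b) + 1)"
      unfolding E_def by (subst card_PiE) (auto simp: I N_def intro!: prod.cong)
    with weighted_box_card[OF assms(1-6)] show ?thesis
      by (simp add: card_PiE I_def M0_def s_def)
  qed
  then have "\<not> inj_on \<Phi> E"
    using card_inj_on_le[OF _ \<Phi>] by (auto simp: finite_PiE)
  then obtain c c' where c: "c \<in> E" "c' \<in> E" "\<Phi> c = \<Phi> c'" "c \<noteq> c'" unfolding inj_on_def by auto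
  define \<delta> where "\<delta> i = int (c i) - int (c' i)" for i
  define G where "G = (\<Sum>(a,b)\<in>I. monom (monom (\<delta> (a,b)) a) b)"
  have coeffG: "coeff (coeff G j) i = (if (i, j) \<in> I then \<delta> (i, j) else 0)" for i j
  proof -
    have "coeff (coeff G j) i = (\<Sum>q\<in>I. if q = (i, j) then \<delta> q else 0)"
      unfolding G_def Polynomial.coeff_sum
      by (intro sum.cong) (auto simp: coeff_monom split: if_splits)
    then show ?thesis using I by simp
  qed
  have "G \<noteq> 0"
  proof
    assume "G = 0"
    then have "\<delta> i = 0" if "i \<in> I" for i using coeffG[of "snd i" "fst i"] that by simp
    then have "c i = c' i" if "i \<in> I" for i using that by (auto simp: \<delta>_def)
    with c(1,2) have "c = c'" unfolding E_def by (intro PiE_ext) auto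
    with c(4) show False by simp
  qed
  moreover have "degree G < m"
  proof -
    have "coeff G j = 0" if "j > m - 1" for j
      by (rule poly_eqI) (use coeffG that in \<open>auto simp: I_def\<close>)
    then have "degree G \<le> m - 1" by (intro degree_le) auto
    then show ?thesis using assms(1) by linarith
  qed
  moreover have "degree (coeff G j) < k" for j
  proof -
    have "coeff (coeff G j) i = 0" if "i > k - 1" for i using coeffG that by (auto simp: I_def)
    then have "degree (coeff G j) \<le> k - 1" by (intro degree_le) auto
    then show ?thesis using assms(2) by linarith
  qed
  moreover have "eval2 G x y = 0"
    if xy: "\<bar>x\<bar> \<le> int B" "\<bar>y\<bar> \<le> int T" "eval2 f x y = 0" "int p dvd x - x0" "int p dvd y - y0"
      for x y
  proof -
    have ev: "eval2 G x y = (\<Sum>(a,b)\<in>I. \<delta> (a,b) * x ^ a * y ^ b)"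
      unfolding G_def by (simp add: eval2_sum case_prod_unfold poly_monom)
    define z where "z = poly \<phi> (x - x0)"
    have z: "int p ^ s dvd y - z" unfolding z_def by (rule \<phi>[OF xy(3-5)])
    have "int p ^ s dvd poly (\<Gamma> c - \<Gamma> c') (x - x0)"
    proof (rule power_dvd_poly[OF _ xy(4)])
      fix j assume j: "j < s"
      have "\<Phi> c j = \<Phi> c' j" using c(3) by simp
      then have "coeff (\<Gamma> c) j mod int p ^ (s - j) = coeff (\<Gamma> c') j mod int p ^ (s - j)"
        using j p0 by (simp add: \<Phi>_def nat_eq_iff)
      then show "int p ^ (s - j) dvd coeff (\<Gamma> c - \<Gamma> c') j" by (simp add: mod_eq_dvd_iff)
    qed
    also have "poly (\<Gamma> c - \<Gamma> c') (x - x0) = (\<Sum>(a,b)\<in>I. \<delta> (a,b) * x ^ a * z ^ b)"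
      unfolding \<Gamma>_def \<delta>_def z_def
      by (simp add: poly_sum case_prod_unfold sum_subtractf[symmetric] algebra_simps)
    finally have 1: "int p ^ s dvd (\<Sum>(a,b)\<in>I. \<delta> (a,b) * x ^ a * z ^ b)" .
    have "int p ^ s dvd (\<Sum>(a,b)\<in>I. \<delta> (a,b) * x ^ a * (y ^ b - z ^ b))"
    proof (rule dvd_sum, safe)
      fix a b
      have "y - z dvd y ^ b - z ^ b"
        using diff_dvd_poly_diff[of y z "monom 1 b"] by (simp add: poly_monom)
      with z show "int p ^ s dvd \<delta> (a,b) * x ^ a * (y ^ b - z ^ b)"
        by (intro dvd_mult) (rule dvd_trans)
    qed
    with 1 have "int p ^ s dvd (\<Sum>(a,b)\<in>I. \<delta> (a,b) * x ^ a * z ^ b) + (\<Sum>(a,b)\<in>I. \<delta> (a,b) * x ^ a *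
      (y ^ b - z ^ b))"
      by (rule dvd_add)
    also have "\<dots> = eval2 G x y"
      unfolding ev sum.distrib[symmetric] by (intro sum.cong) (auto simp: algebra_simps)
    finally have dvd: "int p ^ s dvd eval2 G x y" .
    have "\<bar>eval2 G x y\<bar> \<le> (\<Sum>(a,b)\<in>I. \<bar>\<delta> (a,b) * x ^ a * y ^ b\<bar>)"
      unfolding ev case_prod_unfold by (rule sum_abs)
    also have "\<dots> \<le> (\<Sum>(a,b)\<in>I. int M0)"
    proof (rule sum_mono, safe)
      fix a b assume ab: "(a, b) \<in> I"
      have "c (a,b) \<le> N (a,b)" "c' (a,b) \<le> N (a,b)" using c(1,2) ab by (auto simp: E_def)
      then have "\<bar>\<delta> (a,b)\<bar> \<le> int (N (a,b))" by (auto simp: \<delta>_def)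
      then have "\<bar>\<delta> (a,b) * x ^ a * y ^ b\<bar> \<le> int (N (a,b)) * int B ^ a * int T ^ b"
        unfolding abs_mult power_abs using xy(1,2) by (intro mult_mono power_mono) auto
      also have "\<dots> = int (M0 div (B ^ a * T ^ b) * (B ^ a * T ^ b))" by (simp add: N_def mult.assoc)
      also have "\<dots> \<le> int M0" by (simp only: of_nat_le_iff div_times_less_eq_dividend)
      finally show "\<bar>\<delta> (a,b) * x ^ a * y ^ b\<bar> \<le> int M0" .
    qed
    also have "\<dots> = int (s * M0)" using I by (simp add: case_prod_unfold)
    also have "\<dots> < int (p ^ s)"
    proof -
      have "s * M0 \<le> p ^ s - 1" unfolding M0_def by (rule times_div_less_eq_dividend)
      then show ?thesis using p0 by (metis Suc_diff_1 le_imp_less_Suc of_nat_less_iff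
        zero_less_power)
    qed
    finally have "\<bar>eval2 G x y\<bar> < \<bar>int p ^ s\<bar>" by simp
    with dvd show ?thesis by (metis dvd_imp_le_int not_le)
  qed
  ultimately show ?thesis by blast
qed

section \<open>Integral points on plane curves\<close>

lemma card_residue_class_interval:
  fixes p x0 :: int
  assumes "p > 0"
  shows "real (card {x \<in> {- int B..int B}. p dvd x - x0}) \<le> 2 * real B / of_int p + 2"
proof -
  define lo hi where "lo = (- int B - x0) div p" and "hi = (int B - x0) div p"
  have "card {x \<in> {- int B..int B}. p dvd x - x0} \<le> card {lo..hi}"
  proof (rule card_inj_on_le)
    show "inj_on (\<lambda>x. (x - x0) div p) {x \<in> {- int B..int B}. p dvd x - x0}"
    proof (rule inj_onI)
      fix x y assume xy: "x \<in> {x \<in> {- int B..int B}. p dvd x - x0}" "y \<in> {x \<in> {- int B..int B}. p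
        dvd x - x0}"
        "(x - x0) div p = (y - x0) div p"
      then have "x - x0 = y - x0" by (metis (mono_tags, lifting) dvd_mult_div_cancel mem_Collect_eq)
      then show "x = y" by simp
    qed
    show "(\<lambda>x. (x - x0) div p) ` {x \<in> {- int B..int B}. p dvd x - x0} \<subseteq> {lo..hi}"
      using assms by (auto simp: lo_def hi_def intro!: zdiv_mono1)
  qed simp
  moreover have "lo \<le> hi" using assms by (auto simp: lo_def hi_def intro!: zdiv_mono1)
  ultimately have "real (card {x \<in> {- int B..int B}. p dvd x - x0}) \<le> of_int hi - of_int lo + 1"
    by (simp add: le_nat_iff)
  moreover have "real_of_int hi \<le> (real B - of_int x0) / of_int p"
    using real_of_int_div4[of "int B - x0" p] by (simp add: hi_def)
  moreover have "real_of_int lo \<ge> (- real B - of_int x0) / of_int p - 1"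
    using real_of_int_div3[of "- int B - x0" p] by (simp add: lo_def)
  ultimately show ?thesis by (simp add: diff_divide_distrib)
qed

lemma exists_small_nonroot:
  fixes r :: "int poly"
  assumes "r \<noteq> 0" "degree r \<le> N"
  shows "\<exists>x\<in>{0..int N}. poly r x \<noteq> 0"
proof (rule ccontr)
  assume "\<not> ?thesis"
  then have "{0..int N} \<subseteq> {x. poly r x = 0}" by auto
  then have "card {0..int N} \<le> card {x. poly r x = 0}"
    using poly_roots_finite[OF assms(1)] by (intro card_mono) auto
  also have "\<dots> \<le> degree r" by (rule card_poly_roots_bound[OF assms(1)])
  finally show False using assms(2) by simp
qed

lemma abs_coeff_pderiv_le:
  assumes "degree g \<le> m" "\<And>j. \<bar>poly (coeff g j) x\<bar> \<le> K"
  shows "\<bar>poly (coeff (pderiv g) j) x\<bar> \<le> int m * K"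
proof (cases "Suc j \<le> degree g")
  case True
  have "K \<ge> 0" using assms(2)[of 0] by (rule order.trans[rotated]) simp
  have "\<bar>poly (coeff (pderiv g) j) x\<bar> = int (Suc j) * \<bar>poly (coeff g (Suc j)) x\<bar>"
    by (simp add: coeff_pderiv abs_mult)
  also have "\<dots> \<le> int m * K" using True assms \<open>K \<ge> 0\<close> by (intro mult_mono) auto
  finally show ?thesis .
next
  case False
  have "0 \<le> K" using assms(2)[of 0] by (rule order.trans[rotated]) simp
  with False show ?thesis by (simp add: coeff_pderiv coeff_eq_0)
qed

definition bounded_monic :: "nat \<Rightarrow> nat \<Rightarrow> real \<Rightarrow> int poly poly \<Rightarrow> bool" where
  "bounded_monic m d M f \<longleftrightarrow> lead_coeff f = 1 \<and> degree f = m \<and>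
     (\<forall>j. degree (coeff f j) \<le> d) \<and> (\<forall>j i. real_of_int \<bar>coeff (coeff f j) i\<bar> \<le> M)"

lemma bounded_monic_abs_coeff_le:
  assumes "bounded_monic m d M f" "\<bar>x\<bar> \<le> X" "1 \<le> X"
  shows "\<bar>poly (coeff f j) x\<bar> \<le> int (d + 1) * \<lfloor>M\<rfloor> * X ^ d"
proof (rule abs_poly_le)
  show "\<bar>coeff (coeff f j) i\<bar> \<le> \<lfloor>M\<rfloor>" for i
    using assms(1) by (auto simp: bounded_monic_def le_floor_iff)
qed (use assms in \<open>auto simp: bounded_monic_def\<close>)

abbreviation root_xs :: "int poly poly \<Rightarrow> nat \<Rightarrow> int set" where
  "root_xs f B \<equiv> {x \<in> {- int B..int B}. \<exists>y. eval2 f x y = 0}"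

text \<open>A linear factor Y - q of f gives a solution for every integer x, so only solutions off
  the graphs of such q can be rare.\<close>

abbreviation proper_root_xs :: "nat \<Rightarrow> int poly poly \<Rightarrow> nat \<Rightarrow> int set" where
  "proper_root_xs d f B \<equiv> {x \<in> {- int B..int B}. \<exists>y. eval2 f x y = 0 \<and>
     (\<forall>q. degree q \<le> d \<longrightarrow> poly f q = 0 \<longrightarrow> y \<noteq> poly q x)}"

text \<open>The first summand bounds the points over the at most 2 m d zeros of the discriminant
  modulo p. The second runs over at most p m residue classes with g_Y nonzero modulo p; the
  x-coordinates in each are zeros of the resultant of g and its auxiliary polynomial, of degree at
  most 2 m (d + k).\<close>

lemma irreducible_factor_count:
  fixes f g :: "int poly poly" and m d B :: nat and M :: real
  assumes f: "bounded_monic m d M f" and M: "3 \<le> M" "real B \<le> M" and B: "1 \<le> B"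
    and g: "g dvd f" "irreducible g" "lead_coeff g = 1" "degree g \<ge> 2"
    and p: "prime p" "64 * B \<le> p\<^sup>2"
    and nd: "\<not> int p dvd poly (resultant g (pderiv g)) z"
    and k: "k \<ge> 1" "m * (d + 1) * nat \<lfloor>M\<rfloor> * B ^ d < 2 ^ k"
  shows "real (card (root_xs g B))
    \<le> 2 * m * d * (2 * real B / real p + 2) + real p * m * (2 * m * (d + k))"
proof -
  \<comment> \<open>Roots of g are roots of f, so the bound T on |y| is taken from the coefficients
    of f.\<close>
  define T where "T = m * (d + 1) * nat \<lfloor>M\<rfloor> * B ^ d"
  define r where "r = resultant g (pderiv g)"
  have f0: "f \<noteq> 0" and g0: "g \<noteq> 0" using f g by (auto simp: bounded_monic_def)
  have gm: "degree g \<le> m" using dvd_imp_degree_le[OF g(1) f0] f by (simp add: bounded_monic_def)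
  have m: "m \<ge> 2" using gm g by simp
  have M1: "\<lfloor>M\<rfloor> \<ge> 3" using M by (simp add: le_floor_iff)
  have T1: "T \<ge> 1" using m M1 B by (simp add: T_def Suc_le_eq)
  have gd: "degree (coeff g j) \<le> d" for j
    by (rule degree_coeff_factor_le[OF g(1) f0]) (use f in \<open>auto simp: bounded_monic_def\<close>)
  have g'd: "degree (coeff (pderiv g) j) \<le> d" for j
    using gd[of "Suc j"] by (simp add: coeff_pderiv of_nat_poly degree_mult_le order.trans[OF
      degree_mult_le])
  have g'deg: "degree (pderiv g) < degree g" using g by (simp add: degree_pderiv)
  have deg_r: "degree r \<le> 2 * m * d"
  proof -
    have "degree r \<le> (degree g + degree (pderiv g)) * d"
      unfolding r_def by (rule degree_resultant_le[OF gd g'd])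
    also have "\<dots> \<le> (2 * m) * d" using g'deg gm by (intro mult_right_mono) auto
    finally show ?thesis .
  qed
  have y_bound: "\<bar>y\<bar> \<le> int T" if "eval2 g x y = 0" "\<bar>x\<bar> \<le> int B" for x y
  proof -
    obtain h where h: "f = g * h" using g(1) by (elim dvdE)
    have "\<bar>y\<bar> \<le> int (degree f) * (int (d + 1) * \<lfloor>M\<rfloor> * int B ^ d)"
      by (rule eval2_root_bound[of f x])
        (use f that m B bounded_monic_abs_coeff_le[OF f that(2)] in \<open>auto simp: bounded_monic_def
          h\<close>)
    also have "\<dots> = int T" using f M1 by (simp add: T_def bounded_monic_def algebra_simps)
    finally show ?thesis .
  qed
  have p0: "p > 0" using p(1) by (rule prime_gt_0_nat)
  have prime_p: "prime (int p)" using p(1) by simp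
  define Z where "Z = {x \<in> {0..<int p}. int p dvd poly r x}"
  have Z: "finite Z" "card Z \<le> 2 * m * d"
  proof -
    show "finite Z" unfolding Z_def by (rule finite_subset[of _ "{0..<int p}"]) auto
    \<comment> \<open>One value of the discriminant that p does not divide shows that it is not
      identically zero modulo p.\<close>
    have "\<exists>k. \<not> int p dvd coeff r k"
    proof (rule ccontr)
      assume "\<not> ?thesis"
      then have "int p dvd poly r z" unfolding poly_altdef by (intro dvd_sum) auto
      with nd show False by (simp add: r_def)
    qed
    then obtain k where "\<not> int p dvd coeff r k" ..
    from card_roots_mod_prime_le[OF prime_p this] deg_r show "card Z \<le> 2 * m * d"
      unfolding Z_def by linarith
  qed
  define Cl where "Cl = (SIGMA x0:{0..<int p} - Z. {y0 \<in> {0..<int p}. int p dvd eval2 g x0 y0})"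
  have Cl: "finite Cl" "card Cl \<le> p * m"
  proof -
    have fin: "finite {y0 \<in> {0..<int p}. int p dvd eval2 g x0 y0}" for x0
      by (rule finite_subset[of _ "{0..<int p}"]) auto
    show "finite Cl" unfolding Cl_def using fin by (intro finite_SigmaI) auto
    have "card {y0 \<in> {0..<int p}. int p dvd eval2 g x0 y0} \<le> m" for x0
    proof -
      have "coeff (fix_x x0 g) (degree g) = 1" using g by (simp add: coeff_fix_x)
      then have "\<not> int p dvd coeff (fix_x x0 g) (degree g)" using p(1) prime_gt_1_nat[OF p(1)]
        by auto
      from card_roots_mod_prime_le[OF prime_p this] show ?thesis
        using gm g by (simp add: poly_fix_x degree_fix_x)
    qed
    then have "(\<Sum>x0\<in>{0..<int p} - Z. card {y0 \<in> {0..<int p}. int p dvd eval2 g x0 y0}) \<le>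
      (\<Sum>x0\<in>{0..<int p} - Z. m)"
      by (intro sum_mono)
    moreover have "card Cl = (\<Sum>x0\<in>{0..<int p} - Z. card {y0 \<in> {0..<int p}. int p dvd eval2 g x0
      y0})"
      unfolding Cl_def using fin by (intro card_SigmaI) auto
    ultimately have "card Cl \<le> (\<Sum>x0\<in>{0..<int p} - Z. m)" by simp
    also have "\<dots> = card ({0..<int p} - Z) * m" by simp
    also have "\<dots> \<le> card {0..<int p} * m" by (intro mult_right_mono card_mono) auto
    finally show "card Cl \<le> p * m" by simp
  qed
  define Sb where "Sb x0 = {x \<in> {- int B..int B}. int p dvd x - x0}" for x0
  define Sc where "Sc = (\<lambda>(x0, y0). {x \<in> {- int B..int B}. \<exists>y. eval2 g x y = 0 \<and>
    int p dvd x - x0 \<and> int p dvd y - y0})"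
  have fin_S: "finite (Sb x0)" "finite (Sc c)" for x0 c
    unfolding Sb_def Sc_def by (cases c; auto intro: finite_subset[of _ "{- int B..int B}"])+
  have sub: "(root_xs g B) \<subseteq> (\<Union>x0\<in>Z. Sb x0) \<union> (\<Union>c\<in>Cl. Sc c)"
  proof safe
    fix x y assume x: "x \<in> {- int B..int B}" "eval2 g x y = 0" "x \<notin> (\<Union>c\<in>Cl. Sc c)"
    define x0 where "x0 = x mod int p"
    define y0 where "y0 = y mod int p"
    have xy0: "x0 \<in> {0..<int p}" "y0 \<in> {0..<int p}" "int p dvd x - x0" "int p dvd y - y0"
      using p0 by (auto simp: x0_def y0_def)
    have "int p dvd eval2 g x y - eval2 g x0 y0" by (rule dvd_eval2_diff[OF xy0(3,4)])
    then have "int p dvd eval2 g x0 y0" using x(2) by simp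
    moreover have "x \<in> Sc (x0, y0)" using x xy0 by (auto simp: Sc_def)
    ultimately have "x0 \<in> Z" using x(3) xy0 by (auto simp: Cl_def)
    moreover have "x \<in> Sb x0" using x xy0 by (auto simp: Sb_def)
    ultimately show "x \<in> (\<Union>x0\<in>Z. Sb x0)" by blast
  qed
  have Sb: "real (card (Sb x0)) \<le> 2 * real B / real p + 2" for x0
    using card_residue_class_interval[of "int p" B x0] p0 by (simp add: Sb_def)
  have Sc: "card (Sc c) \<le> 2 * m * (d + k)" if "c \<in> Cl" for c
  proof -
    obtain x0 y0 where c: "c = (x0, y0)" by (cases c)
    have xy0: "\<not> int p dvd poly r x0" "int p dvd eval2 g x0 y0"
      using that by (auto simp: c Cl_def Z_def)
    have "\<not> int p dvd eval2 (pderiv g) x0 y0"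
      using resultant_dvd_at[of g "int p" x0 y0 "pderiv g"] xy0 g by (auto simp: r_def)
    from auxiliary_polynomial[OF g(4) k(1) B T1 _ p(2,1) this] k(2)
    obtain G where G: "G \<noteq> 0" "degree G < degree g" "\<And>j. degree (coeff G j) < k"
      and van: "\<And>x y. \<bar>x\<bar> \<le> int B \<Longrightarrow> \<bar>y\<bar> \<le> int T \<Longrightarrow> eval2 g x y = 0 \<Longrightarrow>
          int p dvd x - x0 \<Longrightarrow> int p dvd y - y0 \<Longrightarrow> eval2 G x y = 0"
      unfolding T_def by blast
    define \<rho> where "\<rho> = resultant g G"
    have \<rho>0: "\<rho> \<noteq> 0" unfolding \<rho>_def by (rule resultant_nonzero[OF g(2) G(1,2)])
    have "degree \<rho> \<le> (degree g + degree G) * (d + k)"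
      unfolding \<rho>_def
    proof (rule degree_resultant_le)
      show "degree (coeff g j) \<le> d + k" "degree (coeff G j) \<le> d + k" for j
        using gd[of j] G(3)[of j] by auto
    qed
    also have "\<dots> \<le> (2 * m) * (d + k)" using G(2) gm by (intro mult_right_mono) auto
    finally have deg: "degree \<rho> \<le> 2 * m * (d + k)" .
    have "Sc c \<subseteq> {x. poly \<rho> x = 0}"
    proof
      fix x assume "x \<in> Sc c"
      then obtain y where y: "\<bar>x\<bar> \<le> int B" "eval2 g x y = 0" "int p dvd x - x0" "int p dvd y - y0"
        by (auto simp: Sc_def c)
      have "eval2 G x y = 0" by (rule van[OF y(1) y_bound[OF y(2,1)] y(2-4)])
      then have "0 dvd poly \<rho> x" unfolding \<rho>_def
        using y(2) g(4) by (intro resultant_dvd_at[of g 0 x y G]) auto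
      then show "x \<in> {x. poly \<rho> x = 0}" by simp
    qed
    then have "card (Sc c) \<le> card {x. poly \<rho> x = 0}"
      using poly_roots_finite[OF \<rho>0] by (intro card_mono) auto
    also have "\<dots> \<le> degree \<rho>" by (rule card_poly_roots_bound[OF \<rho>0])
    finally show ?thesis using deg by linarith
  qed
  have "card (root_xs g B) \<le> card ((\<Union>x0\<in>Z. Sb x0) \<union> (\<Union>c\<in>Cl. Sc c))"
    by (rule card_mono[OF _ sub]) (use Z Cl fin_S in auto)
  also have "\<dots> \<le> card (\<Union>x0\<in>Z. Sb x0) + card (\<Union>c\<in>Cl. Sc c)" by (rule card_Un_le)
  also have "\<dots> \<le> (\<Sum>x0\<in>Z. card (Sb x0)) + (\<Sum>c\<in>Cl. card (Sc c))"
    by (intro add_mono card_UN_le Z Cl)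
  finally have "real (card (root_xs g B))
    \<le> (\<Sum>x0\<in>Z. real (card (Sb x0))) + (\<Sum>c\<in>Cl. real (card (Sc c)))"
    by (simp flip: of_nat_sum of_nat_add)
  also have "\<dots> \<le> (\<Sum>x0\<in>Z. 2 * real B / real p + 2) + (\<Sum>c\<in>Cl. real (2 * m * (d + k)))"
    using Sb Sc by (intro add_mono sum_mono) (auto simp only: of_nat_le_iff)
  also have "\<dots> = real (card Z) * (2 * real B / real p + 2) + real (card Cl) * real (2 * m * (d +
    k))"
    by simp
  also have "\<dots> \<le> real (2 * m * d) * (2 * real B / real p + 2) + real (p * m) * real (2 * m * (d +
    k))"
    using Z Cl by (intro add_mono mult_right_mono) (auto simp only: of_nat_le_iff, auto)
  finally show ?thesis by simp
qed

text \<open>A prime that avoids one nonzero value of the discriminant polynomial suffices. At a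
  non-root z between 0 and 2 m d the factor g specialises to a divisor of a univariate polynomial of
  controlled height, so Mignotte's bound applies; it contributes the factor 2^m (m + 1) of K, and
  differentiation contributes the leading factor m.\<close>

lemma discriminant_value:
  fixes f g :: "int poly poly" and m d :: nat and M :: real
  assumes f: "bounded_monic m d M f" and M: "1 \<le> M" and g: "g dvd f" "irreducible g" "lead_coeff g
    = 1" "degree g \<ge> 1"
  defines "K \<equiv> int m * (2 ^ m * int (m + 1) * (int (d + 1) * \<lfloor>M\<rfloor> * (2 * int m * int d + 1) ^ d))"
  shows "\<exists>z. poly (resultant g (pderiv g)) z \<noteq> 0 \<and> \<bar>poly (resultant g (pderiv g)) z\<bar> \<le>
    fact (2 * m) * K ^ (2 * m)"
proof -
  define r where "r = resultant g (pderiv g)"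
  have f0: "f \<noteq> 0" using f by (auto simp: bounded_monic_def)
  have gm: "degree g \<le> m" using dvd_imp_degree_le[OF g(1) f0] f by (simp add: bounded_monic_def)
  have m: "m \<ge> 1" using gm g by simp
  have gd: "degree (coeff g j) \<le> d" for j
    by (rule degree_coeff_factor_le[OF g(1) f0]) (use f in \<open>auto simp: bounded_monic_def\<close>)
  have g'd: "degree (coeff (pderiv g) j) \<le> d" for j
    using gd[of "Suc j"] by (simp add: coeff_pderiv of_nat_poly degree_mult_le order.trans[OF
      degree_mult_le])
  have g'deg: "degree (pderiv g) < degree g" using g by (simp add: degree_pderiv)
  have "degree r \<le> (degree g + degree (pderiv g)) * d"
    unfolding r_def by (rule degree_resultant_le[OF gd g'd])
  also have "\<dots> \<le> (2 * m) * d" using g'deg gm by (intro mult_right_mono) auto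
  finally have deg_r: "degree r \<le> 2 * m * d" .
  have "pderiv g \<noteq> 0" using g(4) by (simp add: pderiv_eq_0_iff)
  then have "r \<noteq> 0" unfolding r_def by (intro resultant_nonzero g'deg g)
  from exists_small_nonroot[OF this deg_r] obtain z where z: "0 \<le> z" "z \<le> int (2 * m * d)" "poly r
    z \<noteq> 0"
    by auto
  define K1 where "K1 = 2 ^ m * int (m + 1) * (int (d + 1) * \<lfloor>M\<rfloor> * (2 * int m * int d + 1) ^ d)"
  have cf: "\<bar>coeff (fix_x z f) j\<bar> \<le> int (d + 1) * \<lfloor>M\<rfloor> * (2 * int m * int d + 1) ^ d" for j
    unfolding coeff_fix_x using z by (intro bounded_monic_abs_coeff_le[OF f]) auto
  have "lead_coeff f = 1" "degree f = m" using f unfolding bounded_monic_def by blast+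
  then have degf: "degree (fix_x z f) = m" using degree_fix_x by metis
  have "coeff (fix_x z f) m = 1"
    using \<open>lead_coeff f = 1\<close> unfolding \<open>degree f = m\<close> by (simp add: coeff_fix_x)
  then have "fix_x z f \<noteq> 0" by (metis coeff_0 zero_neq_one)
  from abs_coeff_factor_le[OF this fix_x_dvd[OF g(1)] cf]
  have cg: "\<bar>poly (coeff g j) z\<bar> \<le> K1" for j by (simp add: coeff_fix_x degf K1_def)
  have K10: "0 \<le> K1" using cg[of 0] by (rule order.trans[rotated]) simp
  have K: "K = int m * K1" by (simp add: K_def K1_def)
  have K0: "K1 \<le> K" using mult_right_mono[of 1 "int m" K1] K10 m unfolding K by simp
  have "K1 \<ge> 1"
  proof -
    have "1 \<le> \<lfloor>M\<rfloor>" using M by (simp add: le_floor_iff)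
    then have "0 < K1" unfolding K1_def by (intro mult_pos_pos zero_less_power) auto
    then show ?thesis by simp
  qed
  then have K1: "K \<ge> 1" using K0 by linarith
  have "\<bar>poly r z\<bar> \<le> fact (degree g + degree (pderiv g)) * K ^ (degree g + degree (pderiv g))"
    unfolding r_def
  proof (rule abs_poly_resultant_le)
    show "\<bar>poly (coeff g j) z\<bar> \<le> K" for j using cg K0 by (rule order.trans)
    show "\<bar>poly (coeff (pderiv g) j) z\<bar> \<le> K" for j unfolding K
      by (rule abs_coeff_pderiv_le[OF gm cg])
  qed
  also have "\<dots> \<le> fact (2 * m) * K ^ (2 * m)"
    using gm g'deg K1 by (intro mult_mono fact_mono power_increasing) auto
  finally show ?thesis using z(3) unfolding r_def by blast
qed

lemma one_le_ln:
  fixes M :: real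
  assumes "3 \<le> M"
  shows "1 \<le> ln M"
proof -
  have "1 = ln (exp 1 :: real)" by simp
  also have "\<dots> \<le> ln M" using assms exp_le by (subst ln_le_cancel_iff) auto
  finally show ?thesis .
qed

lemma le_two_power:
  fixes M :: real
  assumes "M \<ge> 1"
  shows "M \<le> 2 ^ nat \<lceil>2 * ln M\<rceil>"
proof -
  have le: "ln M \<le> 2 * ln M * ln 2"
    using mult_left_mono[OF ln_2_ge_half, of "2 * ln M"] assms by simp
  have "M = exp (ln M)" using assms by (subst exp_ln) auto
  also have "\<dots> \<le> exp (2 * ln M * ln 2)" using le by (simp only: exp_le_cancel_iff)
  also have "\<dots> = 2 powr (2 * ln M)" by (simp add: powr_def)
  also have "\<dots> \<le> 2 powr (real (nat \<lceil>2 * ln M\<rceil>))" by (intro powr_mono) linarith+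
  also have "\<dots> = 2 ^ nat \<lceil>2 * ln M\<rceil>" by (simp add: powr_realpow)
  finally show ?thesis .
qed

text \<open>With b = sqrt B and L = ln M, the prime satisfies 8 b <= p <= c3 b L^2, and k is at most
  of order L. The zeros of the discriminant contribute O(b) and the other classes O(p k), hence O(b
  L^3).\<close>

lemma irreducible_factor_count_bound:
  fixes m d :: nat
  shows "\<exists>C\<ge>0. \<forall>f g M B. bounded_monic m d M f \<and> 3 \<le> M \<and> real B \<le> M \<and> 1 \<le> B \<and>
    g dvd f \<and> irreducible g \<and> lead_coeff g = 1 \<and> degree g \<ge> 2 \<longrightarrow>
    real (card (root_xs g B)) \<le> C * sqrt (real B) * ln M ^ 3"
proof (cases "m = 0")
  case True
  show ?thesis
  proof (intro exI[of _ 0] conjI allI impI)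
    fix f g :: "int poly poly" and M B
    assume *: "bounded_monic m d M f \<and> 3 \<le> M \<and> real B \<le> M \<and> 1 \<le> B \<and>
      g dvd f \<and> irreducible g \<and> lead_coeff g = 1 \<and> degree g \<ge> 2"
    then have "f \<noteq> 0" by (auto simp: bounded_monic_def)
    with * True dvd_imp_degree_le[of g f] have False by (simp add: bounded_monic_def)
    then show "real (card (root_xs g B)) \<le> 0 * sqrt (real B) * ln M ^ 3" ..
  qed simp
next
  case False
  \<comment> \<open>K1 M bounds the K of the discriminant estimate, c2 L bounds log_2 |R|, c5 L
    bounds ln Q, c3 b L^2 bounds p and c4 L bounds d + k.\<close>
  define K1 where "K1 = real m * (2 ^ m * real (m + 1) * (real (d + 1) * (2 * real m * real d +
    1) ^ d))"
  define c2 where "c2 = 2 * (ln (fact (2 * m)) + 2 * real m * ln K1 + 2 * real m)"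
  define c5 where "c5 = ln (9 + c2) + 2"
  define c3 where "c3 = 40 * (9 + c2) * c5"
  define c4 where "c4 = real d + real (d + 1) * (3 + real m)"
  define C where "C = 6 * real m * real d + 2 * real m ^ 2 * c3 * c4"
  have K1: "K1 \<ge> 1"
    using False unfolding K1_def by (intro mult_ge1_I one_le_power) auto
  have c: "c2 \<ge> 0" "c5 \<ge> 0" "c3 \<ge> 0" "c4 \<ge> 0"
    using K1 by (auto simp: c2_def c5_def c3_def c4_def fact_ge_1 ln_ge_zero)
  have C0: "C \<ge> 0" using c by (simp add: C_def)
  show ?thesis
  proof (intro exI[of _ C] conjI allI impI C0)
    fix f g :: "int poly poly" and M B
    assume *: "bounded_monic m d M f \<and> 3 \<le> M \<and> real B \<le> M \<and> 1 \<le> B \<and>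
      g dvd f \<and> irreducible g \<and> lead_coeff g = 1 \<and> degree g \<ge> 2"
    define L where "L = ln M"
    define b where "b = sqrt (real B)"
    have M: "3 \<le> M" "real B \<le> M" "1 \<le> B" using * by auto
    have L: "L \<ge> 1" unfolding L_def by (rule one_le_ln[OF M(1)])
    have b: "b \<ge> 1" "b * b = real B" using M by (simp_all add: b_def)
    \<comment> \<open>The two summands make 2^k exceed the bound on |y|: one absorbs M * M^d, the
      other the factor m (d + 1).\<close>
    define k where "k = (d + 1) * nat \<lceil>2 * L\<rceil> + m * (d + 1)"
    have k1: "k \<ge> 1" using False by (simp add: k_def)
    have k2: "m * (d + 1) * nat \<lfloor>M\<rfloor> * B ^ d < 2 ^ k"
    proof -
      have "real (m * (d + 1)) < 2 ^ (m * (d + 1))" by (rule of_nat_less_two_power)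
      moreover have "real (nat \<lfloor>M\<rfloor>) * real B ^ d \<le> 2 ^ ((d + 1) * nat \<lceil>2 * L\<rceil>)"
      proof -
        have "real (nat \<lfloor>M\<rfloor>) * real B ^ d \<le> M * M ^ d"
          using M by (intro mult_mono power_mono) auto
        also have "\<dots> = M ^ (d + 1)" by simp
        also have "\<dots> \<le> (2 ^ nat \<lceil>2 * L\<rceil>) ^ (d + 1)"
          unfolding L_def using M by (intro power_mono le_two_power) auto
        also have "\<dots> = 2 ^ ((d + 1) * nat \<lceil>2 * L\<rceil>)"
          by (simp only: power_mult[symmetric] mult.commute)
        finally show ?thesis .
      qed
      ultimately have "real (m * (d + 1)) * (real (nat \<lfloor>M\<rfloor>) * real B ^ d) < 2 ^ (m * (d +
        1)) * 2 ^ ((d + 1) * nat \<lceil>2 * L\<rceil>)"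
        using M by (intro mult_less_le_imp_less) auto
      also have "\<dots> = 2 ^ k" by (simp add: k_def power_add mult.commute)
      finally have "real (m * (d + 1) * nat \<lfloor>M\<rfloor> * B ^ d) < real (2 ^ k)"
        by (simp add: mult.assoc)
      then show ?thesis by (simp only: of_nat_less_iff)
    qed
    have k3: "real (d + k) \<le> c4 * L"
    proof -
      have "real (nat \<lceil>2 * L\<rceil>) \<le> 3 * L" using L by linarith
      then have "real (d + 1) * real (nat \<lceil>2 * L\<rceil>) \<le> real (d + 1) * (3 * L)"
        by (intro mult_left_mono) auto
      moreover have "real d \<le> real d * L" "real (d + 1) * real m \<le> (real (d + 1) * real m) * L"
        using L mult_left_mono[of 1 L "real d"] mult_left_mono[of 1 L "real (d + 1) * real m"]
          by auto
      ultimately show ?thesis unfolding k_def c4_def by (simp add: algebra_simps)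
    qed
    define K where "K = int m * (2 ^ m * int (m + 1) * (int (d + 1) * \<lfloor>M\<rfloor> * (2 * int m * int d +
      1) ^ d))"
    obtain z where z: "poly (resultant g (pderiv g)) z \<noteq> 0"
      "\<bar>poly (resultant g (pderiv g)) z\<bar> \<le> fact (2 * m) * K ^ (2 * m)"
      using discriminant_value[of m d M f g] * M unfolding K_def by auto
    define R where "R = poly (resultant g (pderiv g)) z"
    have KM: "real_of_int K \<le> K1 * M" "real_of_int K \<ge> 0"
    proof -
      have "real_of_int K = K1 * real_of_int \<lfloor>M\<rfloor>" by (simp add: K_def K1_def)
      moreover have "0 \<le> real_of_int \<lfloor>M\<rfloor>" "real_of_int \<lfloor>M\<rfloor> \<le> M" using M by auto
      ultimately show "real_of_int K \<le> K1 * M" "real_of_int K \<ge> 0"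
        using K1 by (auto intro!: mult_left_mono mult_nonneg_nonneg)
    qed
    have R1: "real_of_int \<bar>R\<bar> \<ge> 1" using z(1) by (simp add: R_def flip: of_int_abs)
    have "real_of_int \<bar>R\<bar> \<le> real_of_int (fact (2 * m) * K ^ (2 * m))"
      using z(2) unfolding R_def by (simp only: of_int_le_iff)
    also have "\<dots> \<le> fact (2 * m) * (K1 * M) ^ (2 * m)"
      using KM by (auto intro!: mult_left_mono power_mono)
    finally have "ln (real_of_int \<bar>R\<bar>) \<le> ln (fact (2 * m) * (K1 * M) ^ (2 * m))"
      using R1 by (subst ln_le_cancel_iff) auto
    also have "\<dots> = ln (fact (2 * m)) + 2 * real m * (ln K1 + L)"
      using K1 M by (simp add: ln_mult ln_realpow L_def)
    also have "\<dots> \<le> (ln (fact (2 * m)) + 2 * real m * ln K1) * L + 2 * real m * L"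
    proof -
      have "0 \<le> ln (fact (2 * m) :: real) + 2 * real m * ln K1"
        using K1 by (simp add: fact_ge_1 ln_ge_zero)
      from mult_left_mono[OF L this] show ?thesis by (simp add: algebra_simps)
    qed
    also have "\<dots> = c2 / 2 * L" by (simp add: c2_def algebra_simps)
    finally have lnR: "ln (real_of_int \<bar>R\<bar>) \<le> c2 / 2 * L" .
    have logR: "log 2 (real_of_int \<bar>R\<bar>) \<le> c2 * L"
    proof -
      have "log 2 (real_of_int \<bar>R\<bar>) = ln (real_of_int \<bar>R\<bar>) / ln 2" by (simp add: log_def)
      also have "\<dots> \<le> ln (real_of_int \<bar>R\<bar>) / (1/2)"
        using R1 ln_2_ge_half by (intro divide_left_mono) auto
      finally show ?thesis using lnR by simp
    qed
    \<comment> \<open>Exceeding P means p >= 8 sqrt B, that is, 64 B <= p^2.\<close>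
    define P where "P = nat \<lceil>8 * b\<rceil>"
    have P: "8 * b \<le> real P" "real P \<le> 9 * b" using b unfolding P_def by linarith+
    have bL: "b \<le> b * L" "L \<le> b * L" "1 \<le> b * L"
      using b L mult_left_mono[of 1 L b] mult_right_mono[of 1 b L] mult_mono[of 1 b 1 L] by auto
    \<comment> \<open>Since b and L are both at least 1, b L dominates P <= 9 b as well as log_2 |R|
      <= c2 L.\<close>
    define Q where "Q = (9 + c2) * (b * L)"
    have "Q \<ge> 9 * 1" unfolding Q_def using c bL by (intro mult_mono) auto
    then have Q2: "Q \<ge> 2" by simp
    have "real P + log 2 (real_of_int \<bar>R\<bar>) \<le> Q"
      using P logR bL(1) mult_left_mono[OF bL(2) c(1)] unfolding Q_def by (simp add: algebra_simps)
    from exists_prime_not_dvd[OF _ Q2 this] z(1) obtain p where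
      p: "prime p" "P < p" "real p \<le> 40 * Q * ln Q" "\<not> int p dvd R" unfolding R_def by blast
    have pb: "8 * b \<le> real p" using P p by linarith
    have p64: "64 * B \<le> p\<^sup>2"
    proof -
      have "(8 * b)\<^sup>2 \<le> (real p)\<^sup>2" using pb b by (intro power_mono) auto
      then have "real (64 * B) \<le> real (p\<^sup>2)" using b by (simp add: power2_eq_square)
      then show ?thesis by (simp only: of_nat_le_iff)
    qed
    have lnQ: "ln Q \<le> c5 * L"
    proof -
      have "ln Q = ln (9 + c2) + (ln b + ln L)"
        unfolding Q_def using c b L by (simp add: ln_mult)
      moreover have "ln b \<le> L"
      proof -
        have "b * 1 \<le> b * b" using b by (intro mult_left_mono) auto
        then have "b \<le> M" using b M by simp
        then show ?thesis unfolding L_def using b M by simp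
      qed
      moreover have "ln L \<le> L" using ln_le_minus_one[of L] L by simp
      moreover have "ln (9 + c2) \<le> ln (9 + c2) * L" using c L mult_left_mono[of 1 L "ln (9 + c2)"]
        by simp
      ultimately show ?thesis by (simp add: c5_def algebra_simps)
    qed
    have pL: "real p \<le> c3 * b * L ^ 2"
    proof -
      have "40 * Q * ln Q \<le> 40 * Q * (c5 * L)" using lnQ Q2 by (intro mult_left_mono) auto
      also have "\<dots> = c3 * b * L ^ 2" by (simp add: Q_def c3_def power2_eq_square)
      finally show ?thesis using p by linarith
    qed
    have "2 * real B / real p \<le> b"
    proof -
      have "2 * real B = 2 * (b * b)" using b by simp
      also have "\<dots> \<le> b * (8 * b)" using b by (simp add: mult_ac)
      also have "\<dots> \<le> b * real p" using pb b by (intro mult_left_mono) auto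
      finally show ?thesis using pb b by (simp add: divide_le_eq)
    qed
    then have Bp: "2 * real B / real p + 2 \<le> 3 * b" using b by simp
    have "real (card (root_xs g B))
      \<le> 2 * m * d * (2 * real B / real p + 2) + real p * m * (2 * m * (d + k))"
      by (rule irreducible_factor_count[of m d M f B g p z k])
        (use * p p64 k1 k2 in \<open>auto simp: R_def\<close>)
    also have "\<dots> \<le> 2 * real m * real d * (3 * b) + (c3 * b * L ^ 2) * real m * (2 * real m * (c4 *
      L))"
    proof (rule add_mono)
      show "real (2 * m * d) * (2 * real B / real p + 2) \<le> 2 * real m * real d * (3 * b)"
        using Bp mult_left_mono[OF Bp, of "2 * real m * real d"] by simp
      have "real (2 * m * (d + k)) \<le> 2 * real m * (c4 * L)"
        using k3 mult_left_mono[OF k3, of "2 * real m"] by simp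
      then show "real p * real m * real (2 * m * (d + k)) \<le> (c3 * b * L ^ 2) * real m * (2 *
        real m * (c4 * L))"
        using pL c b L by (intro mult_mono) auto
    qed
    also have "\<dots> = 6 * real m * real d * b + (2 * real m ^ 2 * c3 * c4) * b * L ^ 3"
      by (simp add: power2_eq_square power3_eq_cube)
    also have "6 * real m * real d * b \<le> 6 * real m * real d * b * L ^ 3"
      using L b mult_left_mono[of 1 "L ^ 3" "6 * real m * real d * b"] by simp
    finally show "real (card (root_xs g B)) \<le> C * sqrt (real B) * ln M ^ 3"
      by (simp add: C_def L_def b_def algebra_simps)
  qed
qed

text \<open>A monic g has at most \<open>degree g\<close> monic irreducible factors. A linear one Y
  - q divides f, so q is among the excluded roots and it contributes nothing; every other one
  contributes at most K.\<close>

lemma monic_root_count_induct: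
  fixes f g :: "int poly poly" and K :: real
  assumes irr: "\<And>h. h dvd f \<Longrightarrow> irreducible h \<Longrightarrow> lead_coeff h = 1 \<Longrightarrow> degree h \<ge> 2 \<Longrightarrow>
      real (card (root_xs h B)) \<le> K"
    and K: "K \<ge> 0"
    and "g dvd f" "lead_coeff g = 1"
  shows "real (card {x \<in> {- int B..int B}. \<exists>y. eval2 g x y = 0 \<and> (\<forall>q. poly f q = 0 \<longrightarrow> y \<noteq> poly q x)})
    \<le> real (degree g) * K"
  using assms(3,4)
proof (induction "degree g" arbitrary: g rule: less_induct)
  case less
  let ?S = "\<lambda>g. {x \<in> {- int B..int B}. \<exists>y. eval2 g x y = 0 \<and> (\<forall>q. poly f q = 0 \<longrightarrow> y \<noteq> poly q x)}"
  have fin: "finite (?S h)" for h by (rule finite_subset[of _ "{- int B..int B}"]) auto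
  consider "degree g = 0" | "degree g = 1" | "degree g \<ge> 2" "irreducible g" | "degree g \<ge> 2" "\<not>
    irreducible g"
    by linarith
  then show ?case
  proof cases
    case 1
    then obtain c where c: "g = [:c:]" using degree_eq_zeroE by blast
    then have "c = 1" using less.prems(2) by simp
    then have "eval2 g x y \<noteq> 0" for x y by (simp add: c)
    then have S: "?S g = {}" by simp
    show ?thesis unfolding S using K by simp
  next
    case 2
    then have "coeff g 1 = 1" using less.prems by simp
    with 2 have g: "g = [:coeff g 0, 1:]"
      by (intro poly_eqI) (auto simp: coeff_pCons coeff_eq_0 split: nat.splits)
    define q where "q = - coeff g 0"
    have "poly g q = 0" by (subst g) (simp add: q_def)
    then have "poly f q = 0" using less.prems(1) by (elim dvdE) simp
    moreover have "y = poly q x" if "eval2 g x y = 0" for x y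
      using that by (subst (asm) g) (simp add: eval2_def q_def)
    ultimately have S: "?S g = {}" by blast
    show ?thesis unfolding S using K by simp
  next
    case 3
    have "card (?S g) \<le> card (root_xs g B)"
      by (intro card_mono) (auto intro: finite_subset[of _ "{- int B..int B}"])
    also have "real \<dots> \<le> 1 * K" using irr[OF less.prems(1) 3(2) less.prems(2) 3(1)] by simp
    also have "\<dots> \<le> real (degree g) * K" using 3 K by (intro mult_right_mono) auto
    finally show ?thesis by simp
  next
    case 4
    have "g \<noteq> 0" "\<not> g dvd 1" using 4 poly_dvd_1[of g] by auto
    with 4(2) obtain a b where ab: "g = a * b" "\<not> a dvd 1" "\<not> b dvd 1"
      unfolding irreducible_def by auto
    have lc: "lead_coeff a * lead_coeff b = 1" using less.prems(2) unfolding ab(1)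
      by (simp add: lead_coeff_mult)
    \<comment> \<open>The two leading coefficients are inverse to each other, so scaling each factor
      by the leading coefficient of the other makes both monic without changing the product.\<close>
    define a' where "a' = smult (lead_coeff b) a"
    define b' where "b' = smult (lead_coeff a) b"
    have nz: "lead_coeff a \<noteq> 0" "lead_coeff b \<noteq> 0" using lc by auto
    have ab': "g = a' * b'" using lc by (simp add: ab a'_def b'_def mult.commute)
    have lc': "lead_coeff a' = 1" "lead_coeff b' = 1" using lc nz
      by (simp_all add: a'_def b'_def mult.commute)
    have deg': "degree a' = degree a" "degree b' = degree b" using nz
      by (simp_all add: a'_def b'_def)
    have unit: "c dvd 1" if "degree c = 0" "lead_coeff c dvd 1" for c :: "int poly poly"
    proof -
      from degree_eq_zeroE[OF that(1)] obtain e where "c = [:e:]" by blast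
      with that(2) show ?thesis by (simp add: is_unit_const_poly_iff)
    qed
    have "lead_coeff a dvd 1" "lead_coeff b dvd 1"
      by (rule dvdI[of _ _ "lead_coeff b"], use lc in simp, rule dvdI[of _ _ "lead_coeff a"], use
        lc in \<open>simp add: mult.commute\<close>)
    with unit ab have pos: "degree a > 0" "degree b > 0" by blast+
    have "a \<noteq> 0" "b \<noteq> 0" using nz by auto
    then have dg: "degree g = degree a' + degree b'" unfolding deg' by (simp add: ab degree_mult_eq)
    have dvd: "a' dvd f" "b' dvd f" using less.prems(1) unfolding ab'
      by (auto dest: dvd_mult_left dvd_mult_right)
    have "?S g \<subseteq> ?S a' \<union> ?S b'" unfolding ab' by auto
    then have "card (?S g) \<le> card (?S a' \<union> ?S b')" using fin by (intro card_mono) auto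
    also have "\<dots> \<le> card (?S a') + card (?S b')" by (rule card_Un_le)
    finally have "real (card (?S g)) \<le> real (card (?S a')) + real (card (?S b'))" by linarith
    also have "\<dots> \<le> real (degree a') * K + real (degree b') * K"
      using dg pos deg' by (intro add_mono less.hyps dvd lc') auto
    finally show ?thesis by (simp add: dg algebra_simps)
  qed
qed

theorem curve_count:
  fixes m d :: nat
  shows "\<exists>C\<ge>0. \<forall>f M B. bounded_monic m d M f \<and> 3 \<le> M \<and> real B \<le> M \<and> 1 \<le> B \<longrightarrow>
    real (card (proper_root_xs d f B))
      \<le> C * sqrt (real B) * ln M ^ 3"
proof -
  from irreducible_factor_count_bound[of m d] obtain C where C: "C \<ge> 0"
    "\<And>f g M B. bounded_monic m d M f \<and> 3 \<le> M \<and> real B \<le> M \<and> 1 \<le> B \<and>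
    g dvd f \<and> irreducible g \<and> lead_coeff g = 1 \<and> degree g \<ge> 2 \<Longrightarrow>
    real (card (root_xs g B)) \<le> C * sqrt (real B) * ln M ^ 3"
    by blast
  show ?thesis
  proof (intro exI[of _ "real m * C"] conjI allI impI)
    fix f M B assume *: "bounded_monic m d M f \<and> 3 \<le> M \<and> real B \<le> M \<and> 1 \<le> B"
    have f0: "f \<noteq> 0" using * by (auto simp: bounded_monic_def)
    \<comment> \<open>A root q is a monic linear factor Y - q, and its constant coefficient inherits
      the bound on the X-degree of f.\<close>
    have deg: "degree q \<le> d" if "poly f q = 0" for q
    proof -
      have "[:- q, 1:] dvd f" using that by (simp add: poly_eq_0_iff_dvd)
      from degree_coeff_factor_le[OF this f0, of d 0] * show ?thesis
        by (simp add: bounded_monic_def)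
    qed
    have "(proper_root_xs d f B)
      = {x \<in> {- int B..int B}. \<exists>y. eval2 f x y = 0 \<and> (\<forall>q. poly f q = 0 \<longrightarrow> y \<noteq> poly q x)}"
      using deg by blast
    moreover have "real (card {x \<in> {- int B..int B}. \<exists>y. eval2 f x y = 0 \<and> (\<forall>q. poly f q = 0 \<longrightarrow>
      y \<noteq> poly q x)})
      \<le> real (degree f) * (C * sqrt (real B) * ln M ^ 3)"
    proof (rule monic_root_count_induct)
      show "0 \<le> C * sqrt (real B) * ln M ^ 3" using C * by auto
      show "lead_coeff f = 1" using * unfolding bounded_monic_def by blast
    qed (use C(2) * in auto)
    ultimately show "real (card (proper_root_xs d f B))
      \<le> real m * C * sqrt (real B) * ln M ^ 3"
      using * by (simp add: bounded_monic_def mult_ac)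
  qed (use C in simp)
qed

section \<open>Polynomial functions in several variables\<close>

text \<open>The predicate P constrains every coefficient, and the degree bound d holds in each
  variable separately, which suits tensor-product interpolation. The recursion peels off the last
  variable, the one that slices fix and that varies along lines.\<close>

fun polyfun :: "('a::comm_ring_1 \<Rightarrow> bool) \<Rightarrow> nat \<Rightarrow> nat \<Rightarrow> ((nat \<Rightarrow> int) \<Rightarrow> 'a) \<Rightarrow> bool" where
  "polyfun P 0 d g \<longleftrightarrow> (\<exists>c. P c \<and> g = (\<lambda>_. c))"
| "polyfun P (Suc n) d g \<longleftrightarrow> (\<exists>c. (\<forall>i\<le>d. polyfun P n d (c i)) \<and>
     g = (\<lambda>x. \<Sum>i\<le>d. c i x * of_int (x (Suc n)) ^ i))"

abbreviation int_polyfun :: "real \<Rightarrow> nat \<Rightarrow> nat \<Rightarrow> ((nat \<Rightarrow> int) \<Rightarrow> int) \<Rightarrow> bool" where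
  "int_polyfun A \<equiv> polyfun (\<lambda>c. \<bar>real_of_int c\<bar> \<le> A)"

abbreviation rat_polyfun :: "nat \<Rightarrow> nat \<Rightarrow> ((nat \<Rightarrow> int) \<Rightarrow> rat) \<Rightarrow> bool" where
  "rat_polyfun \<equiv> polyfun (\<lambda>_. True)"

lemma polyfun_cong:
  assumes "polyfun P n d g" "\<And>i. i \<in> {1..n} \<Longrightarrow> x i = y i"
  shows "g x = g y"
  using assms
proof (induction n arbitrary: g)
  case (Suc n)
  from Suc.prems(1) obtain c where c: "\<forall>i\<le>d. polyfun P n d (c i)"
    "g = (\<lambda>x. \<Sum>i\<le>d. c i x * of_int (x (Suc n)) ^ i)" by auto
  have "c i x = c i y" if "i \<le> d" for i using Suc.IH[of "c i"] c(1) that Suc.prems(2) by auto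
  moreover have "x (Suc n) = y (Suc n)" using Suc.prems(2) by auto
  ultimately show ?case unfolding c(2) by (intro sum.cong) auto
qed auto

lemma polyfun_add:
  assumes "polyfun P n d g" "polyfun Q n d h" "\<And>a b. P a \<Longrightarrow> Q b \<Longrightarrow> R (a + b)"
  shows "polyfun R n d (\<lambda>x. g x + h x)"
  using assms(1,2)
proof (induction n arbitrary: g h)
  case 0
  then show ?case using assms(3) by (auto intro: exI[of _ "\<lambda>_. _"])
next
  case (Suc n)
  from Suc.prems obtain c e where c: "\<forall>i\<le>d. polyfun P n d (c i)"
    "g = (\<lambda>x. \<Sum>i\<le>d. c i x * of_int (x (Suc n)) ^ i)" and
    e: "\<forall>i\<le>d. polyfun Q n d (e i)"
    "h = (\<lambda>x. \<Sum>i\<le>d. e i x * of_int (x (Suc n)) ^ i)" by auto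
  show ?case
    unfolding polyfun.simps
    by (rule exI[of _ "\<lambda>i x. c i x + e i x"])
      (use Suc.IH c e in \<open>auto simp: sum.distrib distrib_right\<close>)
qed

lemma polyfun_scale:
  assumes "polyfun P n d g" "\<And>a. P a \<Longrightarrow> Q (k * a)"
  shows "polyfun Q n d (\<lambda>x. k * g x)"
  using assms(1)
proof (induction n arbitrary: g)
  case 0
  then show ?case using assms(2) by auto
next
  case (Suc n)
  then obtain c where c: "\<forall>i\<le>d. polyfun P n d (c i)"
    "g = (\<lambda>x. \<Sum>i\<le>d. c i x * of_int (x (Suc n)) ^ i)" by auto
  show ?case
    unfolding polyfun.simps
    by (rule exI[of _ "\<lambda>i x. k * c i x"]) (use Suc.IH c in \<open>auto simp: sum_distrib_left mult_ac\<close>)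
qed

lemma polyfun_const: "P 0 \<Longrightarrow> P c \<Longrightarrow> polyfun P n d (\<lambda>_. c)"
proof (induction n arbitrary: c)
  case (Suc n)
  show ?case
    unfolding polyfun.simps
  proof (intro exI[of _ "\<lambda>i _. if i = 0 then c else 0"] conjI allI impI)
    show "polyfun P n d (\<lambda>_. if i = 0 then c else 0)" for i using Suc by auto
    show "(\<lambda>_. c) = (\<lambda>x. \<Sum>i\<le>d. (if i = 0 then c else 0) * of_int (x (Suc n)) ^ i)"
    proof
      fix x :: "nat \<Rightarrow> int"
      have "(\<Sum>i\<le>d. (if i = 0 then c else 0) * of_int (x (Suc n)) ^ i) =
        (\<Sum>i\<in>{0}. c * of_int (x (Suc n)) ^ i)"
        by (rule sum.mono_neutral_cong_right) auto
      then show "c = (\<Sum>i\<le>d. (if i = 0 then c else 0) * of_int (x (Suc n)) ^ i)" by simp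
    qed
  qed
qed auto

lemma int_polyfun_sum:
  assumes "\<And>i. i \<in> I \<Longrightarrow> int_polyfun (A i) n d (g i)" "finite I"
  shows "int_polyfun (\<Sum>i\<in>I. A i) n d (\<lambda>x. \<Sum>i\<in>I. g i x)"
  using assms(2,1)
proof (induction I)
  case empty
  then show ?case by (simp add: polyfun_const)
next
  case (insert i I)
  have "int_polyfun (A i + (\<Sum>i\<in>I. A i)) n d (\<lambda>x. g i x + (\<Sum>i\<in>I. g i x))"
    by (rule polyfun_add[of "\<lambda>c. \<bar>real_of_int c\<bar> \<le> A i" n d "g i" "\<lambda>c. \<bar>real_of_int c\<bar> \<le>
      (\<Sum>i\<in>I. A i)"])
      (use insert in auto)
  with insert show ?case by simp
qed

lemma rat_polyfun_sum:
  assumes "\<And>i. i \<in> I \<Longrightarrow> rat_polyfun n d (g i)" "finite I"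
  shows "rat_polyfun n d (\<lambda>x. \<Sum>i\<in>I. g i x)"
  using assms(2,1)
proof (induction I)
  case empty
  then show ?case by (simp add: polyfun_const)
next
  case (insert i I)
  have "rat_polyfun n d (\<lambda>x. g i x + (\<Sum>i\<in>I. g i x))"
    by (rule polyfun_add[of "\<lambda>_. True" _ _ _ "\<lambda>_. True"]) (use insert in auto)
  with insert show ?case by simp
qed

lemma int_polyfun_bound:
  assumes "int_polyfun A n d h" "A \<ge> 0" "X \<ge> 1" "\<And>i. i \<in> {1..n} \<Longrightarrow> \<bar>real_of_int (x i)\<bar> \<le> X"
  shows "\<bar>real_of_int (h x)\<bar> \<le> A * (real (d + 1) * X ^ d) ^ n"
  using assms(1,4)
proof (induction n arbitrary: h)
  case (Suc n)
  from Suc.prems(1) obtain c where c: "\<forall>i\<le>d. int_polyfun A n d (c i)"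
    "h = (\<lambda>x. \<Sum>i\<le>d. c i x * of_int (x (Suc n)) ^ i)" by auto
  let ?E = "A * (real (d + 1) * X ^ d) ^ n"
  have "\<bar>real_of_int (h x)\<bar> = \<bar>\<Sum>i\<le>d. real_of_int (c i x) * real_of_int (x (Suc n)) ^ i\<bar>"
    unfolding c(2) by simp
  also have "\<dots> \<le> (\<Sum>i\<le>d. \<bar>real_of_int (c i x) * real_of_int (x (Suc n)) ^ i\<bar>)" by (rule sum_abs)
  also have "\<dots> \<le> (\<Sum>i\<le>d. ?E * X ^ d)"
  proof (rule sum_mono)
    fix i assume i: "i \<in> {..d}"
    have "\<bar>real_of_int (c i x)\<bar> \<le> ?E" using Suc.IH[of "c i"] c(1) i Suc.prems(2) by auto
    moreover have "\<bar>real_of_int (x (Suc n))\<bar> ^ i \<le> X ^ d"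
    proof -
      have "\<bar>real_of_int (x (Suc n))\<bar> ^ i \<le> X ^ i" using Suc.prems(2)[of "Suc n"]
        by (intro power_mono) auto
      also have "\<dots> \<le> X ^ d" using i assms(3) by (intro power_increasing) auto
      finally show ?thesis .
    qed
    ultimately show "\<bar>real_of_int (c i x) * real_of_int (x (Suc n)) ^ i\<bar> \<le> ?E * X ^ d"
      unfolding abs_mult power_abs using assms(2,3) by (intro mult_mono) auto
  qed
  also have "\<dots> = A * (real (d + 1) * X ^ d) ^ Suc n" by simp
  finally show ?case .
qed auto

section \<open>Interpolation on a grid\<close>

definition grid :: "nat \<Rightarrow> nat \<Rightarrow> (nat \<Rightarrow> int) set" where
  "grid n d = (\<Pi>\<^sub>E i\<in>{1..n}. {0..int d})"

lemma grid_upd: "a \<in> grid n d \<Longrightarrow> v \<in> {0..int d} \<Longrightarrow> a(Suc n := v) \<in> grid (Suc n) d"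
  unfolding grid_def by (auto simp: PiE_def Pi_def extensional_def)

lemma poly_eq_0_if_many_roots:
  fixes p :: "'a::idom poly"
  assumes "degree p \<le> d" "finite S" "card S > d" "\<And>x. x \<in> S \<Longrightarrow> poly p x = 0"
  shows "p = 0"
proof (rule ccontr)
  assume p: "p \<noteq> 0"
  have "card S \<le> card {x. poly p x = 0}"
    using assms(4) poly_roots_finite[OF p] by (intro card_mono) auto
  also have "\<dots> \<le> degree p" by (rule card_poly_roots_bound[OF p])
  finally show False using assms by linarith
qed

text \<open>Over a fixed node of the first n coordinates the difference is a polynomial of degree at
  most d in the last variable with d + 1 zeros.\<close>

lemma rat_polyfun_unique:
  assumes "rat_polyfun n d g" "rat_polyfun n d h" "\<And>a. a \<in> grid n d \<Longrightarrow> g a = h a"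
  shows "g x = h x"
  using assms
proof (induction n arbitrary: g h x)
  case 0
  then show ?case by (auto simp: grid_def)
next
  case (Suc n)
  from Suc.prems obtain c e where c: "\<forall>i\<le>d. rat_polyfun n d (c i)"
    "g = (\<lambda>x. \<Sum>i\<le>d. c i x * of_int (x (Suc n)) ^ i)" and
    e: "\<forall>i\<le>d. rat_polyfun n d (e i)"
    "h = (\<lambda>x. \<Sum>i\<le>d. e i x * of_int (x (Suc n)) ^ i)" by auto
  have eq: "c i a = e i a" if a: "a \<in> grid n d" and i: "i \<le> d" for a i
  proof -
    define p where "p = (\<Sum>i\<le>d. monom (c i a - e i a) i)"
    have "p = 0"
    proof (rule poly_eq_0_if_many_roots[where d = d and S = "of_int ` {0..int d}"])
      show "degree p \<le> d" unfolding p_def by (intro degree_sum_le) (auto intro: order.trans[OF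
        degree_monom_le])
      show "card (of_int ` {0..int d} :: rat set) > d" by (subst card_image) (auto simp: inj_on_def)
      fix z :: rat assume "z \<in> of_int ` {0..int d}"
      then obtain v where v: "v \<in> {0..int d}" "z = of_int v" by auto
      have c': "c i (a(Suc n := v)) = c i a" if "i \<le> d" for i
        by (rule polyfun_cong[of "\<lambda>_. True" n d "c i"]) (use c(1) that in auto)
      have e': "e i (a(Suc n := v)) = e i a" if "i \<le> d" for i
        by (rule polyfun_cong[of "\<lambda>_. True" n d "e i"]) (use e(1) that in auto)
      have "g (a(Suc n := v)) = h (a(Suc n := v))" by (rule Suc.prems(3)[OF grid_upd[OF a v(1)]])
      moreover have "g (a(Suc n := v)) = (\<Sum>i\<le>d. c i a * of_int v ^ i)"
        unfolding c(2) by (intro sum.cong) (simp_all add: c')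
      moreover have "h (a(Suc n := v)) = (\<Sum>i\<le>d. e i a * of_int v ^ i)"
        unfolding e(2) by (intro sum.cong) (simp_all add: e')
      ultimately have "(\<Sum>i\<le>d. c i a * of_int v ^ i) = (\<Sum>i\<le>d. e i a * of_int v ^ i)" by simp
      then show "poly p z = 0"
        by (simp add: p_def poly_sum poly_monom v left_diff_distrib sum_subtractf)
    qed auto
    moreover have "coeff p i = c i a - e i a"
      using i unfolding p_def Polynomial.coeff_sum coeff_monom by simp
    ultimately show ?thesis by simp
  qed
  have "c i x = e i x" if "i \<le> d" for i
    by (rule Suc.IH) (use c(1) e(1) that eq in auto)
  then show ?case unfolding c(2) e(2) by simp
qed

lemma lagrange_basis:
  assumes "u \<le> d"
  shows "\<exists>l :: rat poly. degree l \<le> d \<and> (\<forall>v\<le>d. poly l (of_nat v) = (if v = u then 1 else 0))"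
proof -
  define l :: "rat poly" where "l = (\<Prod>w\<in>{..d} - {u}. smult (1 / (of_nat u - of_nat w)) [:- of_nat
    w, 1:])"
  have "degree l \<le> (\<Sum>w\<in>{..d} - {u}. degree (smult (1 / (of_nat u - of_nat w)) [:- of_nat w :: rat,
    1:]))"
    unfolding l_def by (rule order.trans[OF degree_prod_sum_le]) auto
  also have "\<dots> \<le> (\<Sum>w\<in>{..d} - {u}. 1)" by (intro sum_mono) (auto simp: degree_smult_eq)
  also have "\<dots> = d" using assms by simp
  finally have "degree l \<le> d" .
  moreover have "poly l (of_nat v) = (if v = u then 1 else 0)" if "v \<le> d" for v
  proof (cases "v = u")
    case True
    have "poly (smult (1 / (of_nat u - of_nat w)) [:- of_nat w, 1:]) (of_nat u) = (1::rat)"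
      if "w \<noteq> u" for w
      using that by (simp flip: diff_divide_distrib)
    then show ?thesis unfolding l_def poly_prod using True by (auto intro!: prod.neutral)
  next
    case False
    with that show ?thesis by (auto simp: l_def poly_prod)
  qed
  ultimately show ?thesis by blast
qed

text \<open>Tensor-product Lagrange interpolation: interpolants for the levels u = 0, ..., d of the
  last variable are combined with the Lagrange basis in that variable.\<close>

lemma rat_polyfun_interpolate: "\<exists>g. rat_polyfun n d g \<and> (\<forall>a\<in>grid n d. g a = w a)"
proof (induction n arbitrary: w)
  case 0
  show ?case by (auto simp: grid_def)
next
  case (Suc n)
  have "\<forall>u. \<exists>g. rat_polyfun n d g \<and> (\<forall>a\<in>grid n d. g a = w (a(Suc n := int u)))"
    by (intro allI Suc.IH)
  then obtain g where g: "\<And>u. rat_polyfun n d (g u)"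
    "\<And>u a. a \<in> grid n d \<Longrightarrow> g u a = w (a(Suc n := int u))" by metis
  have "\<forall>u\<in>{..d}. \<exists>l :: rat poly. degree l \<le> d \<and> (\<forall>v\<le>d. poly l (of_nat v) = (if v =
    u then 1 else 0))"
    using lagrange_basis by auto
  then obtain l :: "nat \<Rightarrow> rat poly" where l: "\<And>u. u \<le> d \<Longrightarrow> degree (l u) \<le> d"
    "\<And>u v. u \<le> d \<Longrightarrow> v \<le> d \<Longrightarrow> poly (l u) (of_nat v) = (if v = u then 1 else 0)"
    by (metis atMost_iff)
  define c where "c i x = (\<Sum>u\<le>d. coeff (l u) i * g u x)" for i x
  define G where "G x = (\<Sum>i\<le>d. c i x * of_int (x (Suc n)) ^ i)" for x :: "nat \<Rightarrow> int"
  have c: "rat_polyfun n d (c i)" for i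
    unfolding c_def[abs_def] using g(1) by (intro rat_polyfun_sum polyfun_scale[where P =
      "\<lambda>_. True"]) auto
  have "rat_polyfun (Suc n) d G" using c unfolding polyfun.simps G_def[abs_def]
    by (intro exI[of _ c]) simp
  moreover have "G a = w a" if a: "a \<in> grid (Suc n) d" for a
  proof -
    define a' where "a' = restrict a {1..n}"
    have a': "a' \<in> grid n d" using a by (auto simp: grid_def a'_def)
    have "0 \<le> a (Suc n)" "a (Suc n) \<le> int d" using a by (auto simp: grid_def PiE_iff)
    then obtain v where v: "a (Suc n) = int v" "v \<le> d" by (auto elim: nonneg_int_cases)
    have upd: "a'(Suc n := int v) = a"
      using a v by (auto simp: a'_def grid_def fun_eq_iff PiE_iff extensional_def)
    have ga: "g u a = g u a'" for u
      by (rule polyfun_cong[OF g(1)]) (auto simp: a'_def)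
    have "G a = (\<Sum>u\<le>d. g u a * (\<Sum>i\<le>d. coeff (l u) i * of_nat v ^ i))"
      unfolding G_def c_def v sum_distrib_right sum_distrib_left
      by (subst sum.swap) (simp add: mult_ac)
    also have "\<dots> = (\<Sum>u\<le>d. g u a * (if v = u then 1 else 0))"
    proof (intro sum.cong refl)
      fix u assume u: "u \<in> {..d}"
      then have "(\<Sum>i\<le>d. coeff (l u) i * of_nat v ^ i) = poly (l u) (of_nat v)"
        using l(1) by (intro poly_altdef_le[symmetric]) auto
      with l(2) u v show "g u a * (\<Sum>i\<le>d. coeff (l u) i * of_nat v ^ i) = g u a * (if v =
        u then 1 else 0)"
        by simp
    qed
    also have "\<dots> = g v a" using v by (simp add: if_distrib[of "(*) _"] cong: if_cong)
    also have "\<dots> = w a" by (simp add: ga g(2)[OF a'] upd)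
    finally show ?thesis .
  qed
  ultimately show ?case by blast
qed

section \<open>Monic families, their polynomial roots and their restrictions to lines\<close>

definition monic_eval :: "nat \<Rightarrow> (nat \<Rightarrow> 'a::comm_ring_1) \<Rightarrow> 'a \<Rightarrow> 'a" where
  "monic_eval m a y = y ^ m + (\<Sum>j<m. a j * y ^ j)"

lemma monic_eval_cong: "(\<And>j. j < m \<Longrightarrow> a j = b j) \<Longrightarrow> monic_eval m a y = monic_eval m b y"
  by (simp add: monic_eval_def)

text \<open>Rational coefficients are allowed because roots are produced by interpolation; at
  integer points their values are nevertheless integers, by
  \<open>rational_root_integer\<close>.\<close>

definition has_polyfun_root :: "nat \<Rightarrow> nat \<Rightarrow> nat \<Rightarrow> (nat \<Rightarrow> (nat \<Rightarrow> int) \<Rightarrow> int) \<Rightarrow> bool" where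
  "has_polyfun_root n d m c \<longleftrightarrow>
     (\<exists>g. rat_polyfun n d g \<and> (\<forall>x. monic_eval m (\<lambda>j. of_int (c j x)) (g x) = 0))"

text \<open>The restriction of a monic family to a line parallel to the last axis, where
  \<open>b j i\<close> is the coefficient of X^i Y^j.\<close>

definition line_poly :: "nat \<Rightarrow> nat \<Rightarrow> (nat \<Rightarrow> nat \<Rightarrow> int) \<Rightarrow> int poly poly" where
  "line_poly m d b = monom 1 m + (\<Sum>j<m. monom (\<Sum>i\<le>d. monom (b j i) i) j)"

lemma coeff_line_poly:
  "coeff (line_poly m d b) j = (if j = m then 1 else if j < m then (\<Sum>i\<le>d. monom (b j i) i) else 0)"
  unfolding line_poly_def Polynomial.coeff_add Polynomial.coeff_sum coeff_monom by auto

lemma bounded_monic_line_poly: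
  assumes "\<And>j i. j < m \<Longrightarrow> i \<le> d \<Longrightarrow> \<bar>real_of_int (b j i)\<bar> \<le> M" "1 \<le> M"
  shows "bounded_monic m d M (line_poly m d b)"
proof -
  have deg: "degree (line_poly m d b) = m"
  proof (rule antisym)
    show "degree (line_poly m d b) \<le> m" by (rule degree_le) (auto simp: coeff_line_poly)
    show "m \<le> degree (line_poly m d b)" by (rule le_degree) (simp add: coeff_line_poly)
  qed
  have cc: "coeff (coeff (line_poly m d b) j) i =
      (if j = m then (if i = 0 then 1 else 0) else if j < m \<and> i \<le> d then b j i else 0)" for i j
    by (auto simp: coeff_line_poly Polynomial.coeff_sum coeff_monom)
  have "degree (coeff (line_poly m d b) j) \<le> d" for j
    by (rule degree_le) (auto simp: cc)
  moreover have "real_of_int \<bar>coeff (coeff (line_poly m d b) j) i\<bar> \<le> M" for i j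
    using assms by (auto simp: cc)
  ultimately show ?thesis by (simp add: bounded_monic_def deg) (simp add: coeff_line_poly)
qed

lemma poly_poly_line_poly:
  "poly (poly (line_poly m d b) q) v = monic_eval m (\<lambda>j. \<Sum>i\<le>d. b j i * v ^ i) (poly q v)"
  by (simp add: line_poly_def monic_eval_def poly_monom poly_sum)

lemma eval2_line_poly:
  "eval2 (line_poly m d b) v y = monic_eval m (\<lambda>j. \<Sum>i\<le>d. b j i * v ^ i) y"
  unfolding eval2_def poly_poly_line_poly by simp

lemma rational_root_integer:
  fixes z :: rat
  assumes "monic_eval m (\<lambda>j. of_int (a j)) z = 0"
  shows "\<exists>y::int. z = of_int y \<and> monic_eval m a y = 0"
proof -
  define p :: "rat poly" where "p = monom 1 m + (\<Sum>j<m. monom (of_int (a j)) j)"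
  have cf: "coeff p j = (if j = m then 1 else if j < m then of_int (a j) else 0)" for j
    unfolding p_def Polynomial.coeff_add Polynomial.coeff_sum coeff_monom by auto
  have deg: "degree p = m"
  proof (rule antisym)
    show "degree p \<le> m" by (rule degree_le) (auto simp: cf)
    show "m \<le> degree p" by (rule le_degree) (simp add: cf)
  qed
  have "algebraic_int z"
  proof (rule algebraic_int.intros[of p])
    show "lead_coeff p = 1" using cf deg by simp
    show "\<forall>i. coeff p i \<in> \<int>" by (simp add: cf)
    show "poly p z = 0" using assms by (simp add: p_def poly_sum poly_monom monic_eval_def)
  qed
  moreover have "z \<in> \<rat>" by (metis Rats_divide Rats_of_int quotient_of_div surj_pair)
  ultimately have "z \<in> \<int>" by (rule rational_algebraic_int_is_int)
  then obtain y where y: "z = of_int y" by (auto elim: Ints_cases)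
  have "of_int (monic_eval m a y) = (0::rat)" using assms unfolding y by (simp add: monic_eval_def)
  then show ?thesis using y by (metis of_int_eq_0_iff)
qed

section \<open>Slices without polynomial roots\<close>

text \<open>If H has order K L^6, then sqrt H * L^3 also grows like L^6, but K enters it only
  through its square root and logarithms, so H wins once K is large.\<close>

lemma slice_parameter_exists:
  fixes a b c :: real
  assumes "a \<ge> 0" "b \<ge> 0" "c \<ge> 0"
  shows "\<exists>K\<ge>0. \<forall>L\<ge>1. \<exists>H::nat. H \<ge> 1 \<and> real H \<le> K * L ^ 6 \<and>
    a * sqrt (real H) * (b + L + ln (real H)) ^ 3 + c < real H"
proof -
  \<comment> \<open>With H <= 2 K L^6 and 6 ln L <= 6 L, the bracket b + L + ln H is at most (b + 7
    + ln (2K)) L. The factor L^6 then drops out and leaves this inequality in K alone.\<close>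
  have "eventually (\<lambda>K::real. (a + 1) * sqrt (2 * K) * (b + 7 + ln (2 * K)) ^ 3 + (c +
    1) < K) at_top"
    using assms by real_asymp
  then have "eventually (\<lambda>K::real. (a + 1) * sqrt (2 * K) * (b + 7 + ln (2 * K)) ^ 3 + (c +
    1) < K \<and> K \<ge> 1) at_top"
    using eventually_ge_at_top[of 1] by eventually_elim auto
  then obtain K :: real where K: "(a + 1) * sqrt (2 * K) * (b + 7 + ln (2 * K)) ^ 3 + (c +
    1) < K" "K \<ge> 1"
    by (metis (mono_tags, lifting) eventually_at_top_linorder order_refl)
  show ?thesis
  proof (intro exI[of _ "2 * K"] conjI allI impI)
    fix L :: real assume L: "L \<ge> 1"
    define H where "H = nat \<lceil>K * L ^ 6\<rceil>"
    have L6: "L ^ 6 \<ge> 1" using L by simp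
    have KL: "K * L ^ 6 \<ge> 1" using mult_mono[of 1 K 1 "L ^ 6"] K L6 by simp
    have H: "K * L ^ 6 \<le> real H" "real H \<le> 2 * K * L ^ 6" using KL unfolding H_def by linarith+
    have H1: "real H \<ge> 1" using KL H by linarith
    have s: "sqrt (real H) \<le> sqrt (2 * K) * L ^ 3"
    proof -
      have "sqrt (L ^ 6) = L ^ 3"
        using L by (intro real_sqrt_unique) (simp_all flip: power_mult)
      moreover have "sqrt (real H) \<le> sqrt (2 * K * L ^ 6)" using H(2) by simp
      ultimately show ?thesis by (simp add: real_sqrt_mult)
    qed
    have "ln (real H) \<le> ln (2 * K * L ^ 6)" using H H1 by (subst ln_le_cancel_iff) auto
    also have "\<dots> = ln (2 * K) + 6 * ln L" using K L by (simp add: ln_mult ln_realpow)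
    also have "\<dots> \<le> ln (2 * K) * L + 6 * L"
    proof -
      have "0 \<le> ln (2 * K)" using K by simp
      from mult_left_mono[OF L this] ln_le_minus_one[of L] L show ?thesis by linarith
    qed
    finally have "b + L + ln (real H) \<le> (b + 7 + ln (2 * K)) * L"
      using mult_left_mono[OF L assms(2)] by (simp add: algebra_simps)
    moreover have "0 \<le> b + L + ln (real H)" using assms L H1 by simp
    ultimately have "(b + L + ln (real H)) ^ 3 \<le> ((b + 7 + ln (2 * K)) * L) ^ 3"
      by (intro power_mono)
    then have "a * sqrt (real H) * (b + L + ln (real H)) ^ 3
        \<le> a * (sqrt (2 * K) * L ^ 3) * ((b + 7 + ln (2 * K)) * L) ^ 3"
      using s assms L H1 \<open>0 \<le> b + L + ln (real H)\<close> K by (intro mult_mono mult_left_mono) auto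
    also have "\<dots> = a * sqrt (2 * K) * (b + 7 + ln (2 * K)) ^ 3 * L ^ 6"
      by (simp add: power_mult_distrib power3_eq_cube eval_nat_numeral)
    also have "\<dots> \<le> (a + 1) * sqrt (2 * K) * (b + 7 + ln (2 * K)) ^ 3 * L ^ 6"
      using assms K L by (intro mult_right_mono) auto
    finally have "a * sqrt (real H) * (b + L + ln (real H)) ^ 3 + c
      \<le> (a + 1) * sqrt (2 * K) * (b + 7 + ln (2 * K)) ^ 3 * L ^ 6 + c" by simp
    also have "\<dots> < (a + 1) * sqrt (2 * K) * (b + 7 + ln (2 * K)) ^ 3 * L ^ 6 + (c + 1) * L ^ 6"
    proof -
      have "(c + 1) * 1 \<le> (c + 1) * L ^ 6" using L6 assms by (intro mult_left_mono) auto
      moreover have "c < (c + 1) * 1" by simp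
      ultimately have "c < (c + 1) * L ^ 6" by (rule less_le_trans[rotated])
      then show ?thesis by (rule add_strict_left_mono)
    qed
    also have "\<dots> = ((a + 1) * sqrt (2 * K) * (b + 7 + ln (2 * K)) ^ 3 + (c + 1)) * L ^ 6"
      by (simp add: algebra_simps)
    also have "\<dots> \<le> K * L ^ 6" using K L by (intro mult_right_mono) auto
    also have "\<dots> \<le> real H" by (rule H)
    finally have "a * sqrt (real H) * (b + L + ln (real H)) ^ 3 + c < real H" .
    with H H1 show "\<exists>H::nat. H \<ge> 1 \<and> real H \<le> 2 * K * L ^ 6 \<and>
      a * sqrt (real H) * (b + L + ln (real H)) ^ 3 + c < real H" by (intro exI[of _ H]) auto
  qed (use K in auto)
qed

lemma pigeonhole_fibre:
  assumes "finite A" "finite B" "f ` A \<subseteq> B" "card A > card B * k"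
  shows "\<exists>b\<in>B. card {a \<in> A. f a = b} > k"
proof (rule ccontr)
  assume "\<not> ?thesis"
  then have le: "card {a \<in> A. f a = b} \<le> k" if "b \<in> B" for b using that by auto
  have "A = (\<Union>b\<in>B. {a \<in> A. f a = b})" using assms(3) by auto
  then have "card A = card (\<Union>b\<in>B. {a \<in> A. f a = b})" by simp
  also have "\<dots> \<le> (\<Sum>b\<in>B. card {a \<in> A. f a = b})" by (rule card_UN_le[OF assms(2)])
  also have "\<dots> \<le> (\<Sum>b\<in>B. k)" by (intro sum_mono le)
  finally show False using assms(4) by simp
qed

text \<open>\<open>cc j i\<close> is the coefficient of Y^j times the i-th power of the last
  variable; a slice freezes that variable at v.\<close>

abbreviation pencil :: "nat \<Rightarrow> nat \<Rightarrow> (nat \<Rightarrow> nat \<Rightarrow> (nat \<Rightarrow> int) \<Rightarrow> int) \<Rightarrow> nat \<Rightarrow> (nat \<Rightarrow> int) \<Rightarrow> int" where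
  "pencil n d cc \<equiv> \<lambda>j x. \<Sum>i\<le>d. cc j i x * x (Suc n) ^ i"

abbreviation slice :: "nat \<Rightarrow> (nat \<Rightarrow> nat \<Rightarrow> (nat \<Rightarrow> int) \<Rightarrow> int) \<Rightarrow> int \<Rightarrow> nat \<Rightarrow> (nat \<Rightarrow> int) \<Rightarrow> int" where
  "slice d cc v \<equiv> \<lambda>j x. \<Sum>i\<le>d. cc j i x * v ^ i"

text \<open>At each node a the slice roots follow one polynomial \<open>q a\<close> in v.
  Interpolating the coefficients of \<open>q a\<close> over the grid gives G, which agrees with
  \<open>g v\<close> on the slice at v because both are determined by their grid values. For fixed
  x, substituting G yields a polynomial in the last variable of degree at most (m + 1) d with more
  than (m + 1) d zeros.\<close>

lemma root_of_many_slices: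
  fixes cc :: "nat \<Rightarrow> nat \<Rightarrow> (nat \<Rightarrow> int) \<Rightarrow> int"
  assumes "finite V" "card V > (m + 1) * d"
    and g: "\<And>v. v \<in> V \<Longrightarrow> rat_polyfun n d (g v)"
      "\<And>v x. v \<in> V \<Longrightarrow> monic_eval m (\<lambda>j. of_int (\<Sum>i\<le>d. cc j i x * v ^ i)) (g v x) = 0"
    and q: "\<And>a. a \<in> grid n d \<Longrightarrow> degree (q a) \<le> d"
      "\<And>a v. a \<in> grid n d \<Longrightarrow> v \<in> V \<Longrightarrow> g v a = of_int (poly (q a) v)"
  shows "has_polyfun_root (Suc n) d m (pencil n d cc)"
proof -
  have "\<exists>h. rat_polyfun n d h \<and> (\<forall>a\<in>grid n d. h a = of_int (coeff (q a) i))" for i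
    by (rule rat_polyfun_interpolate)
  then obtain h where h: "\<And>i. rat_polyfun n d (h i)"
    "\<And>i a. a \<in> grid n d \<Longrightarrow> h i a = of_int (coeff (q a) i)" by metis
  define G where "G x = (\<Sum>i\<le>d. h i x * of_int (x (Suc n)) ^ i)" for x :: "nat \<Rightarrow> int"
  have "rat_polyfun (Suc n) d G" using h(1) unfolding polyfun.simps G_def[abs_def]
    by (intro exI[of _ h]) simp
  moreover have "monic_eval m (\<lambda>j. of_int (\<Sum>i\<le>d. cc j i x * x (Suc n) ^ i)) (G x) = 0" for x
  proof -
    define P where "P = (\<Sum>i\<le>d. monom (h i x) i)"
    define R where "R j = (\<Sum>i\<le>d. monom (of_int (cc j i x) :: rat) i)" for j
    define W where "W = P ^ m + (\<Sum>j<m. R j * P ^ j)"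
    have degP: "degree P \<le> d" unfolding P_def
      by (intro degree_sum_le) (auto intro: order.trans[OF degree_monom_le])
    have degR: "degree (R j) \<le> d" for j unfolding R_def
      by (intro degree_sum_le) (auto intro: order.trans[OF degree_monom_le])
    have degPj: "degree (P ^ j) \<le> d * j" for j
      using degree_power_le[of P j] mult_right_mono[OF degP, of j] by linarith
    have "degree W \<le> (m + 1) * d" unfolding W_def
    proof (intro degree_add_le degree_sum_le)
      show "degree (P ^ m) \<le> (m + 1) * d" using degPj[of m] by (simp add: algebra_simps)
      fix j assume "j \<in> {..<m}"
      then have "d * j \<le> d * m" by simp
      then have "degree (R j * P ^ j) \<le> d + d * m"
        using degree_mult_le[of "R j" "P ^ j"] degR[of j] degPj[of j] by linarith
      then show "degree (R j * P ^ j) \<le> (m + 1) * d" by (simp add: algebra_simps)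
    qed auto
    have evW: "poly W (of_int v) = monic_eval m (\<lambda>j. of_int (\<Sum>i\<le>d. cc j i x * v ^ i)) (\<Sum>i\<le>d. h i x
      * of_int v ^ i)" for v
      by (simp add: W_def P_def R_def monic_eval_def poly_sum poly_monom)
    have "W = 0"
    proof (rule poly_eq_0_if_many_roots[OF \<open>degree W \<le> (m + 1) * d\<close>, of "of_int ` V"])
      show "(m + 1) * d < card (of_int ` V :: rat set)" using assms(2)
        by (subst card_image) (auto simp: inj_on_def)
      fix z :: rat assume "z \<in> of_int ` V"
      then obtain v where v: "v \<in> V" "z = of_int v" by auto
      have "g v x = (\<Sum>i\<le>d. of_int v ^ i * h i x)"
      proof (rule rat_polyfun_unique[OF g(1)[OF v(1)]])
        show "rat_polyfun n d (\<lambda>x. \<Sum>i\<le>d. of_int v ^ i * h i x)"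
          using h(1) by (intro rat_polyfun_sum polyfun_scale[where P = "\<lambda>_. True"]) auto
        fix a assume a: "a \<in> grid n d"
        have "g v a = of_int (\<Sum>i\<le>d. coeff (q a) i * v ^ i)"
          using q(2)[OF a v(1)] poly_altdef_le[OF q(1)[OF a]] by simp
        then show "g v a = (\<Sum>i\<le>d. of_int v ^ i * h i a)" by (simp add: h(2)[OF a] mult.commute)
      qed
      then have "(\<Sum>i\<le>d. h i x * of_int v ^ i) = g v x" by (simp add: mult.commute)
      with g(2)[OF v(1), of x] show "poly W z = 0" unfolding v(2) evW by simp
    qed (use assms(1) in auto)
    then show ?thesis using evW[of "x (Suc n)"] by (simp add: G_def)
  qed
  ultimately show ?thesis unfolding has_polyfun_root_def by blast
qed

text \<open>Suppose every slice up to H has a root \<open>g v\<close>. At a node a,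
  \<open>g v a\<close> is an integral solution on the line over a, so for all but O(sqrt H (ln
  M')^3) values v it is the value of one of at most m polynomial roots on that line. The remaining v
  select one such root at each of the N nodes, in at most J = m^N ways; as they number more than J
  (m + 1) d, more than (m + 1) d of them select alike.\<close>

lemma rootless_slice:
  fixes n m d :: nat
  shows "\<exists>K\<ge>0. \<forall>cc M. (\<forall>j<m. \<forall>i\<le>d. int_polyfun M n d (cc j i)) \<and> 3 \<le> M \<and>
      \<not> has_polyfun_root (Suc n) d m (pencil n d cc) \<longrightarrow>
    (\<exists>v::int. 1 \<le> v \<and> of_int v \<le> K * ln M ^ 6 \<and> \<not> has_polyfun_root n d m (slice d cc v))"
proof -
  from curve_count[of m d] obtain C1 where C1: "C1 \<ge> 0" and curve:
    "\<And>f M B. bounded_monic m d M f \<and> 3 \<le> M \<and> real B \<le> M \<and> 1 \<le> B \<Longrightarrow>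
    real (card (proper_root_xs d f B))
      \<le> C1 * sqrt (real B) * ln M ^ 3" by blast
  \<comment> \<open>The factor by which values on the grid can exceed the coefficient bound M, as
    grid coordinates stay below d + 1.\<close>
  define K0 where "K0 = (real (d + 1) * (real (d + 1)) ^ d) ^ n"
  define N where "N = card (grid n d)"
  define J where "J = m ^ N"
  have fin: "finite (grid n d)" by (simp add: grid_def finite_PiE)
  have K0: "K0 \<ge> 1" unfolding K0_def by (intro one_le_power mult_ge1_I) auto
  from slice_parameter_exists[of "real N * C1" "ln K0" "real (J * ((m + 1) * d))"] C1 K0
  obtain K where K: "K \<ge> 0" "\<And>L. L \<ge> 1 \<Longrightarrow> \<exists>H::nat. H \<ge> 1 \<and> real H \<le> K * L ^ 6 \<and>
    real N * C1 * sqrt (real H) * (ln K0 + L + ln (real H)) ^ 3 + real (J * ((m + 1) * d)) < real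
      H" by auto
  show ?thesis
  proof (intro exI[of _ K] conjI allI impI K(1))
    fix cc :: "nat \<Rightarrow> nat \<Rightarrow> (nat \<Rightarrow> int) \<Rightarrow> int" and M :: real
    assume *: "(\<forall>j<m. \<forall>i\<le>d. int_polyfun M n d (cc j i)) \<and> 3 \<le> M \<and>
      \<not> has_polyfun_root (Suc n) d m (pencil n d cc)"
    have L: "1 \<le> ln M" using * by (intro one_le_ln) blast
    from K(2)[OF L] obtain H :: nat where H: "H \<ge> 1" "real H \<le> K * ln M ^ 6"
      "real N * C1 * sqrt (real H) * (ln K0 + ln M + ln (real H)) ^ 3 + real (J * ((m +
        1) * d)) < real H" by auto
    show "\<exists>v::int. 1 \<le> v \<and> of_int v \<le> K * ln M ^ 6 \<and> \<not> has_polyfun_root n d m (slice d cc v)"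
    proof (rule ccontr)
      assume no: "\<not> ?thesis"
      have root: "has_polyfun_root n d m (slice d cc v)" if "v \<in> {1..int H}" for v
      proof -
        have "real_of_int v \<le> real H" using that by simp
        then have "real_of_int v \<le> K * ln M ^ 6" using H(2) by linarith
        then show ?thesis using no that by auto
      qed
      then have "\<forall>v\<in>{1..int H}. \<exists>g. rat_polyfun n d g \<and>
        (\<forall>x. monic_eval m (\<lambda>j. of_int (\<Sum>i\<le>d. cc j i x * v ^ i)) (g x) = 0)"
        unfolding has_polyfun_root_def by blast
      then obtain g where g: "\<And>v. v \<in> {1..int H} \<Longrightarrow> rat_polyfun n d (g v)"
        "\<And>v x. v \<in> {1..int H} \<Longrightarrow> monic_eval m (\<lambda>j. of_int (\<Sum>i\<le>d. cc j i x * v ^ i)) (g v x) = 0"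
        unfolding bchoice_iff by blast
      define F where "F a = line_poly m d (\<lambda>j i. cc j i a)" for a
      \<comment> \<open>M' bounds the line coefficients over the grid and also the range H, and its
        logarithm is the bracket in the inequality satisfied by H.\<close>
      define M' where "M' = M * K0 * real H"
      have M': "M \<le> M * K0" "M * K0 \<le> M'" "real H \<le> M'"
      proof -
        have M3: "3 \<le> M" using * by blast
        then have "M * 1 \<le> M * K0" by (intro mult_left_mono K0) auto
        then show 1: "M \<le> M * K0" by simp
        have "M * K0 * 1 \<le> M * K0 * real H" using 1 M3 H(1) by (intro mult_left_mono) auto
        then show "M * K0 \<le> M'" by (simp add: M'_def)
        have "1 * real H \<le> M * K0 * real H" using 1 M3 by (intro mult_right_mono) linarith+
        then show "real H \<le> M'" by (simp add: M'_def)
      qed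
      have M'3: "3 \<le> M'" using M' * by linarith
      have bm: "bounded_monic m d M' (F a)" if a: "a \<in> grid n d" for a
        unfolding F_def
      proof (rule bounded_monic_line_poly)
        fix j i assume ji: "j < m" "i \<le> d"
        have "\<bar>real_of_int (cc j i a)\<bar> \<le> M * (real (d + 1) * real (d + 1) ^ d) ^ n"
        proof (rule int_polyfun_bound[of M n d "cc j i" "real (d + 1)" a])
          show "int_polyfun M n d (cc j i)" using * ji by blast
          fix k assume "k \<in> {1..n}"
          then have "a k \<in> {0..int d}" using a by (auto simp: grid_def PiE_iff)
          then have "\<bar>a k\<bar> \<le> int (d + 1)" by simp
          then show "\<bar>real_of_int (a k)\<bar> \<le> real (d + 1)" by linarith
        qed (use * in auto)
        then show "\<bar>real_of_int (cc j i a)\<bar> \<le> M'" using M'(2) by (simp add: K0_def)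
      qed (use M'3 in linarith)
      have F_nz: "F a \<noteq> 0" if "a \<in> grid n d" for a using bm[OF that]
        by (auto simp: bounded_monic_def)
      define R where "R a = {q. degree q \<le> d \<and> poly (F a) q = 0}" for a
      have R: "finite (R a)" "card (R a) \<le> m" if "a \<in> grid n d" for a
      proof -
        have sub: "R a \<subseteq> {q. poly (F a) q = 0}" by (auto simp: R_def)
        note fin_roots = poly_roots_finite[OF F_nz[OF that]]
        show "finite (R a)" by (rule finite_subset[OF sub fin_roots])
        have "card (R a) \<le> card {q. poly (F a) q = 0}" by (rule card_mono[OF fin_roots sub])
        also have "\<dots> \<le> degree (F a)" by (rule card_poly_roots_bound[OF F_nz[OF that]])
        finally show "card (R a) \<le> m" using bm[OF that] by (simp add: bounded_monic_def)
      qed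
      \<comment> \<open>The v at which the slice root over a lies on none of the polynomial roots of
        that line; these are the solutions that the curve bound counts.\<close>
      define Bad where "Bad a = {v \<in> {1..int H}. \<forall>q\<in>R a. g v a \<noteq> of_int (poly q v)}" for a
      have lnM': "ln M' = ln K0 + ln M + ln (real H)"
        using * K0 H(1) by (simp add: M'_def ln_mult)
      have Bad: "real (card (Bad a)) \<le> C1 * sqrt (real H) * ln M' ^ 3" if a: "a \<in> grid n d" for a
      proof -
        have "Bad a \<subseteq> (proper_root_xs d (F a) H)"
        proof
          fix v assume v: "v \<in> Bad a"
          then have v': "v \<in> {1..int H}" by (simp add: Bad_def)
          from rational_root_integer[OF g(2)[OF v', of a]] obtain y where
            y: "g v a = of_int y" "monic_eval m (\<lambda>j. \<Sum>i\<le>d. cc j i a * v ^ i) y = 0" by auto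
          have "eval2 (F a) v y = 0" using y(2) by (simp add: F_def eval2_line_poly)
          moreover have "y \<noteq> poly q v" if "degree q \<le> d" "poly (F a) q = 0" for q
            using v that y(1) by (auto simp: Bad_def R_def)
          ultimately show "v \<in> (proper_root_xs d (F a) H)"
            using v' by auto
        qed
        then have "card (Bad a) \<le> card (proper_root_xs d (F a) H)"
          by (intro card_mono) (auto intro: finite_subset[of _ "{- int H..int H}"])
        also have "real \<dots> \<le> C1 * sqrt (real H) * ln M' ^ 3"
          by (rule curve) (use bm[OF a] M' M'3 H in auto)
        finally show ?thesis by simp
      qed
      define Good where "Good = {1..int H} - (\<Union>a\<in>grid n d. Bad a)"
      have finBad: "finite (Bad a)" for a unfolding Bad_def
        by (rule finite_subset[of _ "{1..int H}"]) auto
      have "real (card (\<Union>a\<in>grid n d. Bad a)) \<le> (\<Sum>a\<in>grid n d. real (card (Bad a)))"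
        using card_UN_le[OF fin, of Bad] by (simp flip: of_nat_sum)
      also have "\<dots> \<le> (\<Sum>a\<in>grid n d. C1 * sqrt (real H) * ln M' ^ 3)" by (intro sum_mono Bad)
      also have "\<dots> = real N * C1 * sqrt (real H) * (ln K0 + ln M + ln (real H)) ^ 3"
        by (simp add: N_def lnM')
      finally have "real (card (\<Union>a\<in>grid n d. Bad a)) + real (J * ((m + 1) * d)) < real H"
        using H(3) by linarith
      then have lt: "card (\<Union>a\<in>grid n d. Bad a) + J * ((m + 1) * d) < H"
        by (simp only: of_nat_add[symmetric] of_nat_less_iff)
      have "card {1..int H} - card (\<Union>a\<in>grid n d. Bad a) \<le> card Good"
        unfolding Good_def by (rule diff_card_le_card_Diff) (use fin finBad in auto)
      with lt have cardGood: "J * ((m + 1) * d) < card Good" by simp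
      have "\<forall>v\<in>Good. \<forall>a\<in>grid n d. \<exists>q\<in>R a. g v a = of_int (poly q v)"
        by (auto simp: Good_def Bad_def)
      then obtain \<rho> where \<rho>: "\<And>v a. v \<in> Good \<Longrightarrow> a \<in> grid n d \<Longrightarrow>
        \<rho> v a \<in> R a \<and> g v a = of_int (poly (\<rho> v a) v)"
        by metis
      let ?E = "\<Pi>\<^sub>E a\<in>grid n d. R a"
      have finE: "finite ?E" using fin R by (intro finite_PiE) auto
      have "card ?E = (\<Prod>a\<in>grid n d. card (R a))" by (rule card_PiE[OF fin])
      also have "\<dots> \<le> (\<Prod>a\<in>grid n d. m)" by (intro prod_mono) (use R in auto)
      finally have "card ?E \<le> J" by (simp add: J_def N_def)
      then have "card ?E * ((m + 1) * d) \<le> J * ((m + 1) * d)" by (intro mult_right_mono) auto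
      then have cardE: "card ?E * ((m + 1) * d) < card Good" using cardGood by linarith
      have finGood: "finite Good" by (simp add: Good_def)
      have maps: "(\<lambda>v. restrict (\<rho> v) (grid n d)) ` Good \<subseteq> ?E" using \<rho> by auto
      from pigeonhole_fibre[OF finGood finE maps cardE]
      obtain q where q: "q \<in> ?E" "(m + 1) * d < card {v \<in> Good. restrict (\<rho> v) (grid n d) = q}"
        by auto
      define V where "V = {v \<in> Good. restrict (\<rho> v) (grid n d) = q}"
      have VH: "v \<in> {1..int H}" if "v \<in> V" for v using that by (auto simp: V_def Good_def)
      have "has_polyfun_root (Suc n) d m (pencil n d cc)"
      proof (rule root_of_many_slices[of V m d n g cc q])
        show "finite V" using finGood by (simp add: V_def)
        show "(m + 1) * d < card V" using q(2) by (simp add: V_def)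
        show "degree (q a) \<le> d" if "a \<in> grid n d" for a using q(1) that by (auto simp: R_def)
        fix a v assume a: "a \<in> grid n d" and v: "v \<in> V"
        have "q a = \<rho> v a" using v a by (auto simp: V_def)
        then show "g v a = of_int (poly (q a) v)" using \<rho>[of v a] v a by (simp add: V_def)
      qed (use g VH in auto)
      with * show False by blast
    qed
  qed
qed

section \<open>Induction on the number of variables\<close>

definition box :: "nat \<Rightarrow> nat \<Rightarrow> (nat \<Rightarrow> int) set" where
  "box n B = (\<Pi>\<^sub>E i\<in>{1..n}. {- int B..int B})"

abbreviation root_points :: "nat \<Rightarrow> nat \<Rightarrow> (nat \<Rightarrow> (nat \<Rightarrow> int) \<Rightarrow> int) \<Rightarrow> nat \<Rightarrow> (nat \<Rightarrow> int) set" where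
  "root_points n m c B \<equiv> {x \<in> box n B. \<exists>y. monic_eval m (\<lambda>j. c j x) y = 0}"

lemma card_box: "card (box n B) = (2 * B + 1) ^ n"
proof -
  have "nat (2 * int B + 1) = 2 * B + 1" by linarith
  then show ?thesis by (simp add: box_def card_PiE)
qed

lemma finite_box [simp]: "finite (box n B)"
  unfolding box_def by (intro finite_PiE) auto

text \<open>Replacing M by a constant times a fixed power of M multiplies ln M by a constant only;
  this keeps the exponent 3 through the induction.\<close>

lemma ln_affine_bound:
  assumes "1 \<le> c" "3 \<le> M"
  shows "ln (c * M ^ k) \<le> (ln c + real k) * ln M"
proof -
  have L: "1 \<le> ln M" by (rule one_le_ln[OF assms(2)])
  have "ln (c * M ^ k) = ln c + real k * ln M" using assms by (simp add: ln_mult ln_realpow)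
  also have "\<dots> \<le> ln c * ln M + real k * ln M"
    using mult_left_mono[OF L, of "ln c"] assms by simp
  finally show "ln (c * M ^ k) \<le> (ln c + real k) * ln M" by (simp add: algebra_simps)
qed

text \<open>Since B <= M, the coefficients on a line over the box are at most a constant times a
  power of M, and without a polynomial root every solution on the line is counted by the curve
  bound.\<close>

lemma rootless_line_count:
  fixes n m d :: nat
  shows "\<exists>C\<ge>0. \<forall>cc M B a. (\<forall>j<m. \<forall>i\<le>d. int_polyfun M n d (cc j i)) \<and> 3 \<le> M \<and> real B \<le> M \<and> 1 \<le> B \<and>
    a \<in> box n B \<and> \<not> (\<exists>q. degree q \<le> d \<and> poly (line_poly m d (\<lambda>j i. cc j i a)) q = 0) \<longrightarrow>
    real (card {t \<in> {- int B..int B}. \<exists>y. monic_eval m (\<lambda>j. \<Sum>i\<le>d. cc j i a * t ^ i) y = 0})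
      \<le> C * ln M ^ 3 * sqrt (real B)"
proof -
  from curve_count[of m d] obtain C where C: "C \<ge> 0" and curve:
    "\<And>f M B. bounded_monic m d M f \<and> 3 \<le> M \<and> real B \<le> M \<and> 1 \<le> B \<Longrightarrow>
    real (card (proper_root_xs d f B))
      \<le> C * sqrt (real B) * ln M ^ 3" by blast
  define \<kappa> where "\<kappa> = ln (real (d + 1) ^ n) + real (d * n + 1)"
  have \<kappa>: "\<kappa> \<ge> 0" unfolding \<kappa>_def by (simp add: ln_realpow)
  show ?thesis
  proof (intro exI[of _ "C * \<kappa> ^ 3"] conjI allI impI)
    fix cc M B a
    assume *: "(\<forall>j<m. \<forall>i\<le>d. int_polyfun M n d (cc j i)) \<and> 3 \<le> M \<and> real B \<le> M \<and> 1 \<le> B \<and>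
      a \<in> box n B \<and> \<not> (\<exists>q. degree q \<le> d \<and> poly (line_poly m d (\<lambda>j i. cc j i a)) q = 0)"
    define M3 where "M3 = real (d + 1) ^ n * M ^ (d * n + 1)"
    have M3: "M * (real (d + 1) * M ^ d) ^ n = M3"
      unfolding M3_def by (simp add: power_mult_distrib mult_ac flip: power_mult)
    have "M * 1 \<le> M * (real (d + 1) * M ^ d) ^ n"
      using * by (intro mult_left_mono one_le_power mult_ge1_I) auto
    then have MM3: "M \<le> M3" unfolding M3 by simp
    let ?S = "(proper_root_xs d (line_poly m d (\<lambda>j i. cc j i a)) B)"
    have "{t \<in> {- int B..int B}. \<exists>y. monic_eval m (\<lambda>j. \<Sum>i\<le>d. cc j i a * t ^ i) y = 0} = ?S"
      using * unfolding eval2_line_poly by blast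
    moreover have "real (card ?S) \<le> C * sqrt (real B) * ln M3 ^ 3"
    proof (rule curve)
      have "bounded_monic m d M3 (line_poly m d (\<lambda>j i. cc j i a))"
      proof (rule bounded_monic_line_poly)
        fix j i assume ji: "j < m" "i \<le> d"
        have "\<bar>real_of_int (cc j i a)\<bar> \<le> M * (real (d + 1) * M ^ d) ^ n"
        proof (rule int_polyfun_bound[of M n d "cc j i" M a])
          show "int_polyfun M n d (cc j i)" using * ji by blast
          fix k assume "k \<in> {1..n}"
          then have "a k \<in> {- int B..int B}" using * by (auto simp: box_def PiE_iff)
          then have "\<bar>real_of_int (a k)\<bar> \<le> real B" by auto
          then show "\<bar>real_of_int (a k)\<bar> \<le> M" using * by linarith
        qed (use * in auto)
        then show "\<bar>real_of_int (cc j i a)\<bar> \<le> M3" unfolding M3 .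
      qed (use * MM3 in linarith)
      then show "bounded_monic m d M3 (line_poly m d (\<lambda>j i. cc j i a)) \<and> 3 \<le> M3 \<and> real B \<le> M3 \<and>
        1 \<le> B"
        using * MM3 by auto
    qed
    moreover have "C * sqrt (real B) * ln M3 ^ 3 \<le> C * sqrt (real B) * (\<kappa> * ln M) ^ 3"
    proof (intro mult_left_mono power_mono)
      show "ln M3 \<le> \<kappa> * ln M"
        unfolding M3_def \<kappa>_def using * by (intro ln_affine_bound) auto
      show "0 \<le> ln M3" using * MM3 by simp
    qed (use C in auto)
    ultimately show "real (card {t \<in> {- int B..int B}. \<exists>y. monic_eval m (\<lambda>j. \<Sum>i\<le>d. cc j i a *
      t ^ i) y = 0})
      \<le> C * \<kappa> ^ 3 * ln M ^ 3 * sqrt (real B)"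
      by (simp add: power_mult_distrib mult_ac)
  qed (use C \<kappa> in auto)
qed

lemma int_polyfun_slice:
  fixes v :: int
  assumes "\<And>i. i \<le> d \<Longrightarrow> int_polyfun M n d (h i)" "M \<ge> 0" "\<bar>real_of_int v\<bar> \<le> U" "1 \<le> U"
  shows "int_polyfun (real (d + 1) * (M * U ^ d)) n d (\<lambda>x. \<Sum>i\<le>d. h i x * v ^ i)"
proof -
  have "int_polyfun (\<Sum>i\<in>{..d}. M * U ^ d) n d (\<lambda>x. \<Sum>i\<in>{..d}. v ^ i * h i x)"
  proof (rule int_polyfun_sum)
    fix i assume i: "i \<in> {..d}"
    have "\<bar>real_of_int v\<bar> ^ i \<le> U ^ i" using assms(3) by (intro power_mono) auto
    also have "\<dots> \<le> U ^ d" using i assms(4) by (intro power_increasing) auto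
    finally have v: "\<bar>real_of_int v\<bar> ^ i \<le> U ^ d" .
    show "int_polyfun (M * U ^ d) n d (\<lambda>x. v ^ i * h i x)"
    proof (rule polyfun_scale[OF assms(1)])
      fix c assume "\<bar>real_of_int c\<bar> \<le> M"
      then have "\<bar>real_of_int v\<bar> ^ i * \<bar>real_of_int c\<bar> \<le> U ^ d * M"
        using v assms(4) by (intro mult_mono) auto
      then show "\<bar>real_of_int (v ^ i * c)\<bar> \<le> M * U ^ d"
        by (simp add: abs_mult power_abs mult.commute)
    qed (use i in auto)
  qed simp
  then show ?thesis by (simp add: mult.commute)
qed

text \<open>For n + 1 variables there are at most (3 B)^n lines without polynomial root, each with
  O(sqrt B) points up to logarithms. The base points of the other lines solve a rootless slice, so
  up to logarithms there are O(B^(n-1/2)) of them, each line with at most 3 B points. Both products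
  have order B^(n+1/2).\<close>

theorem rootless_count:
  fixes n m d :: nat
  shows "\<exists>C\<ge>0. \<forall>c M B. (\<forall>j<m. int_polyfun M n d (c j)) \<and> 3 \<le> M \<and> real B \<le> M \<and> 1 \<le> B \<and>
      \<not> has_polyfun_root n d m c \<longrightarrow>
    real (card (root_points n m c B)) \<le> C * ln M ^ 3 * (real B ^ n / sqrt (real B))"
proof (induction n)
  case 0
  show ?case
  proof (intro exI[of _ 0] conjI allI impI)
    fix c M B
    assume *: "(\<forall>j<m. int_polyfun M 0 d (c j)) \<and> 3 \<le> M \<and> real B \<le> M \<and> 1 \<le> B \<and>
      \<not> has_polyfun_root 0 d m c"
    \<comment> \<open>Without variables an integer root is itself a constant polynomial root, so the
      count is zero.\<close>
    have "monic_eval m (\<lambda>j. c j x) y \<noteq> 0" for x y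
    proof
      assume root: "monic_eval m (\<lambda>j. c j x) y = 0"
      have "monic_eval m (\<lambda>j. of_int (c j z)) (of_int y :: rat) = 0" for z
      proof -
        have "c j z = c j x" if "j < m" for j
          using polyfun_cong[of _ 0 d "c j" z x] * that by auto
        then have "monic_eval m (\<lambda>j. of_int (c j z)) (of_int y :: rat) =
          of_int (monic_eval m (\<lambda>j. c j x) y)"
          by (simp add: monic_eval_def)
        then show ?thesis using root by simp
      qed
      then have "has_polyfun_root 0 d m c"
        unfolding has_polyfun_root_def by (intro exI[of _ "\<lambda>_. of_int y"]) auto
      with * show False by blast
    qed
    then show "real (card (root_points 0 m c B))
      \<le> 0 * ln M ^ 3 * (real B ^ 0 / sqrt (real B))" by simp
  qed simp
next
  case (Suc n)
  then obtain Cn where Cn: "Cn \<ge> 0" and IH: "\<And>c M B. (\<forall>j<m. int_polyfun M n d (c j)) \<and> 3 \<le> M \<and>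
      real B \<le> M \<and> 1 \<le> B \<and> \<not> has_polyfun_root n d m c \<Longrightarrow>
    real (card (root_points n m c B)) \<le> Cn * ln M ^ 3 * (real B ^ n / sqrt (real B))"
    by blast
  from rootless_slice[where n = n and m = m and d = d] obtain K where K: "K \<ge> 0" and pick: "\<And>cc M.
      (\<forall>j<m. \<forall>i\<le>d. int_polyfun M n d (cc j i)) \<and> 3 \<le> M \<and>
      \<not> has_polyfun_root (Suc n) d m (pencil n d cc) \<Longrightarrow>
    \<exists>v::int. 1 \<le> v \<and> of_int v \<le> K * ln M ^ 6 \<and> \<not> has_polyfun_root n d m (slice d cc v)"
    by blast
  from rootless_line_count[where n = n and m = m and d = d] obtain C1 where C1: "C1 \<ge> 0" and line:
    "\<And>cc M B a.
    (\<forall>j<m. \<forall>i\<le>d. int_polyfun M n d (cc j i)) \<and> 3 \<le> M \<and> real B \<le> M \<and> 1 \<le> B \<and>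
    a \<in> box n B \<and> \<not> (\<exists>q. degree q \<le> d \<and> poly (line_poly m d (\<lambda>j i. cc j i a)) q = 0) \<Longrightarrow>
    real (card {t \<in> {- int B..int B}. \<exists>y. monic_eval m (\<lambda>j. \<Sum>i\<le>d. cc j i a * t ^ i) y = 0})
      \<le> C1 * ln M ^ 3 * sqrt (real B)" by blast
  define \<kappa> where "\<kappa> = ln (real (d + 1) * (K + 1) ^ d) + real (6 * d + 1)"
  have \<kappa>: "\<kappa> \<ge> 0" unfolding \<kappa>_def using K by (intro add_nonneg_nonneg ln_ge_zero mult_ge1_I
    one_le_power) auto
  define C where "C = 3 ^ n * C1 + 3 * Cn * \<kappa> ^ 3"
  show ?case
  proof (intro exI[of _ C] conjI allI impI)
    fix c M B
    assume *: "(\<forall>j<m. int_polyfun M (Suc n) d (c j)) \<and> 3 \<le> M \<and> real B \<le> M \<and> 1 \<le> B \<and>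
      \<not> has_polyfun_root (Suc n) d m c"
    then have "\<forall>j\<in>{..<m}. \<exists>e. (\<forall>i\<le>d. int_polyfun M n d (e i)) \<and>
      c j = (\<lambda>x. \<Sum>i\<le>d. e i x * x (Suc n) ^ i)"
      by simp
    then obtain cc where cc: "\<And>j i. j < m \<Longrightarrow> i \<le> d \<Longrightarrow> int_polyfun M n d (cc j i)"
      "\<And>j. j < m \<Longrightarrow> c j = (\<lambda>x. \<Sum>i\<le>d. cc j i x * x (Suc n) ^ i)"
      unfolding bchoice_iff by auto
    have lnM: "1 \<le> ln M" using * by (intro one_le_ln) blast
    have "has_polyfun_root (Suc n) d m (pencil n d cc) \<longleftrightarrow> has_polyfun_root (Suc n) d m c"
      unfolding has_polyfun_root_def monic_eval_def using cc(2) by simp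
    then obtain v :: int where v: "1 \<le> v" "of_int v \<le> K * ln M ^ 6"
      "\<not> has_polyfun_root n d m (slice d cc v)"
      using pick[of M cc] * cc(1) by auto
    \<comment> \<open>If q is a polynomial root on the line over a, then q(v) solves the slice at v;
      thus the induction hypothesis counts W.\<close>
    define W where "W = {a \<in> box n B. \<exists>q. degree q \<le> d \<and> poly (line_poly m d (\<lambda>j i. cc j i a)) q =
      0}"
    \<comment> \<open>The bound K (ln M)^6 on v is weakened to a power of M, so that the height
      bound M4 of the slice is again a constant times a power of M.\<close>
    define U where "U = (K + 1) * M ^ 6"
    have "ln M ^ 6 \<le> M ^ 6" using lnM ln_le_minus_one[of M] * by (intro power_mono) auto
    then have "K * ln M ^ 6 \<le> (K + 1) * M ^ 6" using K lnM by (intro mult_mono) auto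
    then have vU: "\<bar>real_of_int v\<bar> \<le> U" using v unfolding U_def by linarith
    have U1: "1 \<le> U" unfolding U_def using K * by (intro mult_ge1_I one_le_power) auto
    define M4 where "M4 = real (d + 1) * (M * U ^ d)"
    have M4: "M4 = (real (d + 1) * (K + 1) ^ d) * M ^ (6 * d + 1)"
      unfolding M4_def U_def by (simp add: power_mult_distrib mult_ac flip: power_mult)
    have MM4: "M \<le> M4"
    proof -
      have "1 * (M * 1) \<le> real (d + 1) * (M * U ^ d)"
        using * U1 by (intro mult_mono one_le_power) auto
      then show ?thesis by (simp add: M4_def)
    qed
    have "W \<subseteq> {x \<in> box n B. \<exists>y. monic_eval m (\<lambda>j. \<Sum>i\<le>d. cc j i x * v ^ i) y = 0}"
    proof
      fix a assume "a \<in> W"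
      then obtain q where q: "a \<in> box n B" "poly (line_poly m d (\<lambda>j i. cc j i a)) q = 0"
        by (auto simp: W_def)
      have "monic_eval m (\<lambda>j. \<Sum>i\<le>d. cc j i a * v ^ i) (poly q v) = 0"
        unfolding poly_poly_line_poly[symmetric] q(2) by simp
      with q(1) show "a \<in> {x \<in> box n B. \<exists>y. monic_eval m (\<lambda>j. \<Sum>i\<le>d. cc j i x * v ^ i) y = 0}"
        by blast
    qed
    then have "card W \<le> card {x \<in> box n B. \<exists>y. monic_eval m (\<lambda>j. \<Sum>i\<le>d. cc j i x * v ^ i) y = 0}"
      by (intro card_mono) auto
    also have "real \<dots> \<le> Cn * ln M4 ^ 3 * (real B ^ n / sqrt (real B))"
    proof (rule IH, intro conjI allI impI)
      show "int_polyfun M4 n d (\<lambda>x. \<Sum>i\<le>d. cc j i x * v ^ i)" if "j < m" for j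
        unfolding M4_def using cc(1)[OF that] vU U1 * by (intro int_polyfun_slice) auto
    qed (use * MM4 v in auto)
    also have "\<dots> \<le> Cn * (\<kappa> * ln M) ^ 3 * (real B ^ n / sqrt (real B))"
    proof (intro mult_right_mono mult_left_mono power_mono)
      show "ln M4 \<le> \<kappa> * ln M"
        unfolding M4 \<kappa>_def using * K by (intro ln_affine_bound mult_ge1_I one_le_power) auto
      show "0 \<le> ln M4" using * MM4 by simp
    qed (use Cn in auto)
    finally have cardW: "real (card W) \<le> Cn * (\<kappa> * ln M) ^ 3 * (real B ^ n / sqrt (real B))" by simp
    define St where "St a = {t \<in> {- int B..int B}. \<exists>y. monic_eval m (\<lambda>j. \<Sum>i\<le>d. cc j i a * t ^ i) y
      = 0}" for a
    have finSt: "finite (St a)" for a unfolding St_def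
      by (rule finite_subset[of _ "{- int B..int B}"]) auto
    have St_le: "real (card (St a)) \<le> 3 * real B" for a
    proof -
      have "card (St a) \<le> card {- int B..int B}" unfolding St_def by (intro card_mono) auto
      also have "real \<dots> = 2 * real B + 1" by simp
      finally show ?thesis using * by simp
    qed
    have sub: "(root_points (Suc n) m c B) \<subseteq> (\<Union>a\<in>box n B. (\<lambda>t. a(Suc n := t)) ` St a)"
    proof
      fix x assume "x \<in> (root_points (Suc n) m c B)"
      then obtain y where x: "x \<in> box (Suc n) B" "monic_eval m (\<lambda>j. c j x) y = 0" by auto
      define a where "a = restrict x {1..n}"
      have a: "a \<in> box n B" using x(1) by (auto simp: a_def box_def)
      have upd: "a(Suc n := x (Suc n)) = x"
        using x(1) by (auto simp: a_def box_def fun_eq_iff PiE_iff extensional_def)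
      have "cc j i x = cc j i a" if "j < m" "i \<le> d" for i j
        by (rule polyfun_cong[OF cc(1)[OF that]]) (auto simp: a_def)
      then have "monic_eval m (\<lambda>j. \<Sum>i\<le>d. cc j i a * x (Suc n) ^ i) y = monic_eval m (\<lambda>j. c j x) y"
        by (intro monic_eval_cong) (auto simp: cc(2))
      then have "x (Suc n) \<in> St a" using x by (auto simp: St_def box_def PiE_iff)
      with a upd show "x \<in> (\<Union>a\<in>box n B. (\<lambda>t. a(Suc n := t)) ` St a)"
        by (intro UN_I[of a]) (auto intro: image_eqI[of _ _ "x (Suc n)"])
    qed
    have "card (root_points (Suc n) m c B) \<le> card (\<Union>a\<in>box n B. (\<lambda>t. a(Suc n := t)) ` St a)"
      by (rule card_mono[OF _ sub]) (use finSt in auto)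
    also have "\<dots> \<le> (\<Sum>a\<in>box n B. card ((\<lambda>t. a(Suc n := t)) ` St a))" by (rule card_UN_le) simp
    also have "\<dots> \<le> (\<Sum>a\<in>box n B. card (St a))" by (intro sum_mono card_image_le finSt)
    finally have "real (card (root_points (Suc n) m c B))
      \<le> real (\<Sum>a\<in>box n B. card (St a))" by (simp only: of_nat_le_iff)
    also have "\<dots> = (\<Sum>a\<in>box n B. real (card (St a)))" by simp
    also have "\<dots> \<le> (\<Sum>a\<in>box n B. C1 * ln M ^ 3 * sqrt (real B) + (if a \<in> W then 3 * real B else 0))"
    proof (rule sum_mono)
      fix a assume a: "a \<in> box n B"
      have "0 \<le> C1 * ln M ^ 3 * sqrt (real B)" using C1 lnM by simp
      moreover have "real (card (St a)) \<le> C1 * ln M ^ 3 * sqrt (real B)" if "a \<notin> W"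
        unfolding St_def by (rule line) (use * cc(1) a that in \<open>auto simp: W_def\<close>)
      ultimately show "real (card (St a)) \<le> C1 * ln M ^ 3 * sqrt (real B) + (if a \<in> W then 3 *
        real B else 0)"
        using St_le[of a] by auto
    qed
    also have "\<dots> = real (card (box n B)) * (C1 * ln M ^ 3 * sqrt (real B)) + real (card W) * (3 *
      real B)"
    proof -
      have "box n B \<inter> {a. a \<in> W} = W" by (auto simp: W_def)
      then show ?thesis by (simp add: sum.distrib sum.If_cases)
    qed
    also have "\<dots> \<le> (3 * real B) ^ n * (C1 * ln M ^ 3 * sqrt (real B))
        + Cn * (\<kappa> * ln M) ^ 3 * (real B ^ n / sqrt (real B)) * (3 * real B)"
    proof (intro add_mono mult_right_mono cardW)
      have "real (card (box n B)) = (2 * real B + 1) ^ n" by (simp add: card_box add.commute)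
      also have "\<dots> \<le> (3 * real B) ^ n" using * by (intro power_mono) auto
      finally show "real (card (box n B)) \<le> (3 * real B) ^ n" .
    qed (use C1 lnM in auto)
    also have "\<dots> = C * ln M ^ 3 * (real B ^ Suc n / sqrt (real B))"
    proof -
      have B: "real B / sqrt (real B) = sqrt (real B)" by (simp add: real_div_sqrt)
      have "real B ^ Suc n / sqrt (real B) = real B ^ n * (real B / sqrt (real B))"
        by (simp add: mult.commute)
      then have 1: "real B ^ Suc n / sqrt (real B) = real B ^ n * sqrt (real B)" by (simp only: B)
      have "z * (real B ^ n / sqrt (real B)) * (3 * real B) = 3 * z * (real B ^ n * (real B / sqrt
        (real B)))" for z
        by (simp add: mult_ac)
      then have 2: "z * (real B ^ n / sqrt (real B)) * (3 * real B) = 3 * z * (real B ^ n *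
        sqrt (real B))" for z
        by (simp only: B)
      show ?thesis unfolding C_def 1 2 by (simp add: power_mult_distrib algebra_simps)
    qed
    finally show "real (card (root_points (Suc n) m c B))
      \<le> C * ln M ^ 3 * (real B ^ Suc n / sqrt (real B))" .
  qed (use C1 Cn \<kappa> in \<open>simp add: C_def\<close>)
qed

section \<open>Evaluation of multivariate polynomials\<close>

text \<open>For fixed other coordinates the sum is a polynomial in the last variable with infinitely
  many zeros, so the terms sharing an exponent of that variable already sum to zero. The abstract
  index set S makes such a subfamily a sum of the same kind in one variable less.\<close>

lemma vanishing_sum_coeffs:
  fixes e :: "'s \<Rightarrow> nat \<Rightarrow> nat" and w :: "'s \<Rightarrow> rat"
  assumes "finite S" "\<And>s t. s \<in> S \<Longrightarrow> t \<in> S \<Longrightarrow> s \<noteq> t \<Longrightarrow> \<exists>v\<in>{1..n}. e s v \<noteq> e t v"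
    "\<And>x :: nat \<Rightarrow> int. (\<Sum>s\<in>S. w s * (\<Prod>v\<in>{1..n}. of_int (x v) ^ e s v)) = 0"
    and "s \<in> S"
  shows "w s = 0"
  using assms
proof (induction n arbitrary: S)
  case 0
  then have "S = {s}" by fastforce
  with 0(3) show ?case by simp
next
  case (Suc n)
  define S' where "S' = {t \<in> S. e t (Suc n) = e s (Suc n)}"
  show ?case
  proof (rule Suc.IH[of S'])
    show "finite S'" "s \<in> S'" using Suc.prems by (auto simp: S'_def)
    show "\<exists>v\<in>{1..n}. e s v \<noteq> e t v" if "s \<in> S'" "t \<in> S'" "s \<noteq> t" for s t
    proof -
      from Suc.prems(2)[of s t] that obtain v where v: "v \<in> {1..Suc n}" "e s v \<noteq> e t v"
        by (auto simp: S'_def)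
      with that have "v \<noteq> Suc n" by (auto simp: S'_def)
      with v have "v \<in> {1..n}" by simp
      with v(2) show ?thesis by blast
    qed
    fix x :: "nat \<Rightarrow> int"
    define \<mu> where "\<mu> t = w t * (\<Prod>v\<in>{1..n}. of_int (x v) ^ e t v)" for t
    define p where "p = (\<Sum>t\<in>S. monom (\<mu> t) (e t (Suc n)))"
    have root: "poly p (of_int z) = 0" for z
    proof -
      have "poly p (of_int z) = (\<Sum>t\<in>S. w t * (\<Prod>v\<in>{1..Suc n}. of_int ((x(Suc n := z)) v) ^ e t v))"
        unfolding p_def poly_sum
      proof (intro sum.cong refl)
        fix t
        have "(\<Prod>v\<in>{1..n}. of_int ((x(Suc n := z)) v) ^ e t v) = (\<Prod>v\<in>{1..n}. rat_of_int (x v) ^ e t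
          v)"
          by (intro prod.cong) auto
        moreover have "{1..Suc n} = insert (Suc n) {1..n}" by auto
        ultimately show "poly (monom (\<mu> t) (e t (Suc n))) (of_int z)
            = w t * (\<Prod>v\<in>{1..Suc n}. of_int ((x(Suc n := z)) v) ^ e t v)"
          by (simp add: poly_monom \<mu>_def)
      qed
      then show ?thesis using Suc.prems(3)[of "x(Suc n := z)"] by (simp only:)
    qed
    have "p = 0"
    proof (rule poly_eq_0_if_many_roots[of p "degree p" "of_int ` {0..int (degree p)}"])
      show "degree p < card (of_int ` {0..int (degree p)} :: rat set)"
        by (subst card_image) (auto simp: inj_on_def)
    qed (use root in auto)
    then have "coeff p (e s (Suc n)) = 0" by simp
    then have "(\<Sum>t\<in>S. if e t (Suc n) = e s (Suc n) then \<mu> t else 0) = 0"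
      by (simp add: p_def Polynomial.coeff_sum coeff_monom)
    then have "(\<Sum>t\<in>S'. \<mu> t) = 0"
      using Suc.prems(1) by (simp add: S'_def sum.inter_filter)
    then show "(\<Sum>t\<in>S'. w t * (\<Prod>v\<in>{1..n}. of_int (x v) ^ e t v)) = 0"
      by (simp add: \<mu>_def)
  qed
qed

text \<open>Distinct exponent vectors leave at most one term when no variables remain, so the bound
  A on single coefficients survives without summation.\<close>

lemma int_polyfun_monomial_sum:
  fixes e :: "'s \<Rightarrow> nat \<Rightarrow> nat" and w :: "'s \<Rightarrow> int"
  assumes "finite S" "\<And>s t. s \<in> S \<Longrightarrow> t \<in> S \<Longrightarrow> s \<noteq> t \<Longrightarrow> \<exists>v\<in>{1..n}. e s v \<noteq> e t v"
    "\<And>s v. s \<in> S \<Longrightarrow> e s v \<le> d" "\<And>s. s \<in> S \<Longrightarrow> \<bar>real_of_int (w s)\<bar> \<le> A" "0 \<le> A"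
  shows "int_polyfun A n d (\<lambda>x. \<Sum>s\<in>S. w s * (\<Prod>v\<in>{1..n}. x v ^ e s v))"
  using assms
proof (induction n arbitrary: S)
  case 0
  show ?case
  proof (cases "S = {}")
    case True
    then show ?thesis using 0(5) by (simp add: polyfun_const del: polyfun.simps)
  next
    case False
    then obtain s where "s \<in> S" by blast
    with 0(2) have "S = {s}" by fastforce
    with 0(4) show ?thesis by auto
  qed
next
  case (Suc n)
  define c where "c i x = (\<Sum>s\<in>{s \<in> S. e s (Suc n) = i}. w s * (\<Prod>v\<in>{1..n}. x v ^ e s v))" for i x
  have "int_polyfun A n d (c i)" for i
    unfolding c_def[abs_def]
  proof (rule Suc.IH)
    show "\<exists>v\<in>{1..n}. e s v \<noteq> e t v"
      if "s \<in> {s \<in> S. e s (Suc n) = i}" "t \<in> {s \<in> S. e s (Suc n) = i}" "s \<noteq> t" for s t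
    proof -
      from Suc.prems(2)[of s t] that obtain v where v: "v \<in> {1..Suc n}" "e s v \<noteq> e t v" by auto
      with that have "v \<noteq> Suc n" by auto
      with v have "v \<in> {1..n}" by simp
      with v(2) show ?thesis by blast
    qed
  qed (use Suc.prems in auto)
  moreover have "(\<Sum>s\<in>S. w s * (\<Prod>v\<in>{1..Suc n}. x v ^ e s v)) = (\<Sum>i\<le>d. c i x * x (Suc n) ^ i)" for x
  proof -
    have "(\<Sum>i\<le>d. c i x * x (Suc n) ^ i) =
        (\<Sum>i\<le>d. \<Sum>s\<in>{s \<in> S. e s (Suc n) = i}. w s * (\<Prod>v\<in>{1..Suc n}. x v ^ e s v))"
      unfolding c_def sum_distrib_right
    proof (intro sum.cong refl)
      fix i s assume "s \<in> {s \<in> S. e s (Suc n) = i}"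
      moreover have "{1..Suc n} = insert (Suc n) {1..n}" by auto
      ultimately show "w s * (\<Prod>v\<in>{1..n}. x v ^ e s v) * x (Suc n) ^ i =
        w s * (\<Prod>v\<in>{1..Suc n}. x v ^ e s v)"
        by (simp add: mult_ac)
    qed
    also have "\<dots> = (\<Sum>s\<in>S. w s * (\<Prod>v\<in>{1..Suc n}. x v ^ e s v))"
      by (rule sum.group) (use Suc.prems in auto)
    finally show ?thesis ..
  qed
  ultimately show ?case by (auto intro!: exI[of _ c])
qed

alias keys = Poly_Mapping.keys
alias lookup = Poly_Mapping.lookup
alias single = Poly_Mapping.single

section \<open>Subrings given by sets of variables, and specialisation of the X-variables\<close>

lemma mpoly_vars_add: "mpoly_vars (p + q) \<subseteq> mpoly_vars p \<union> mpoly_vars q"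
  unfolding mpoly_vars_def using keys_add[of p q] by blast

lemma mpoly_vars_mult: "mpoly_vars (p * q) \<subseteq> mpoly_vars p \<union> mpoly_vars q"
  for p q :: "'a::comm_ring_1 mpoly"
proof
  fix v assume "v \<in> mpoly_vars (p * q)"
  then obtain k where k: "k \<in> keys (p * q)" "v \<in> keys k"
    by (auto simp: mpoly_vars_def)
  from k(1) keys_mult[of p q] obtain a b where
    "k = a + b" "a \<in> keys p" "b \<in> keys q" by blast
  with k(2) keys_add[of a b] show "v \<in> mpoly_vars p \<union> mpoly_vars q"
    unfolding mpoly_vars_def by blast
qed

lemma mpoly_vars_single: "mpoly_vars (single k c) \<subseteq> keys k"
  by (auto simp: mpoly_vars_def)

text \<open>\<open>over {0..n}\<close> is the full ring, and \<open>over {1..n}\<close> is its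
  subring of polynomials free of Y.\<close>

definition over :: "nat set \<Rightarrow> 'a::comm_ring_1 mpoly set" where
  "over V = {p. mpoly_vars p \<subseteq> V}"

lemma over_closed:
  fixes p q :: "'a::comm_ring_1 mpoly"
  shows "p \<in> over V \<Longrightarrow> q \<in> over V \<Longrightarrow> p + q \<in> over V"
    and "p \<in> over V \<Longrightarrow> q \<in> over V \<Longrightarrow> p * q \<in> over V"
    and "p \<in> over V \<Longrightarrow> - p \<in> over V"
    and "keys k \<subseteq> V \<Longrightarrow> single k c \<in> over V"
    and "0 \<in> over V" and "1 \<in> over V"
proof -
  show "p \<in> over V \<Longrightarrow> q \<in> over V \<Longrightarrow> p + q \<in> over V"
    using mpoly_vars_add[of p q] unfolding over_def by blast
  show "p \<in> over V \<Longrightarrow> q \<in> over V \<Longrightarrow> p * q \<in> over V"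
    using mpoly_vars_mult[of p q] unfolding over_def by blast
  show "keys k \<subseteq> V \<Longrightarrow> single k c \<in> over V"
    using mpoly_vars_single[of k c] unfolding over_def by blast
qed (auto simp: over_def mpoly_vars_def)

lemma over_sum: "(\<And>i. i \<in> I \<Longrightarrow> f i \<in> over V) \<Longrightarrow> sum f I \<in> over V"
  by (induction I rule: infinite_finite_induct) (auto intro: over_closed)

lemma over_power: "p \<in> over V \<Longrightarrow> p ^ k \<in> over V"
  by (induction k) (auto intro: over_closed)

lemma over_mono: "p \<in> over V \<Longrightarrow> V \<subseteq> W \<Longrightarrow> p \<in> over W"
  by (auto simp: over_def)

lemma sum_single_lookup: "(\<Sum>k\<in>keys p. single k (lookup p k)) = p"
  by (rule poly_mapping_eqI)
    (auto simp: lookup_sum lookup_single when_def in_keys_iff)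

definition monomial_eval :: "(nat \<Rightarrow> 'b::comm_ring_1) \<Rightarrow> monomial \<Rightarrow> 'b" where
  "monomial_eval f k = (\<Prod>v\<in>keys k. f v ^ lookup k v)"

lemma prod_const_poly: "(\<Prod>i\<in>A. [:f i:]) = [:\<Prod>i\<in>A. f i:]"
  for f :: "_ \<Rightarrow> 'a::comm_ring_1"
  by (induction A rule: infinite_finite_induct) simp_all

lemma sum_const_poly: "(\<Sum>i\<in>A. [:f i:]) = [:\<Sum>i\<in>A. f i:]"
  for f :: "_ \<Rightarrow> 'a::comm_ring_1"
  by (induction A rule: infinite_finite_induct) auto

lemma monomial_eval_superset:
  assumes "finite V" "keys k \<subseteq> V"
  shows "monomial_eval f k = (\<Prod>v\<in>V. f v ^ lookup k v)"
  unfolding monomial_eval_def using assms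
  by (intro prod.mono_neutral_left) (auto simp: in_keys_iff)

lemma monomial_eval_add: "monomial_eval f (k + l) = monomial_eval f k * monomial_eval f l"
proof -
  let ?V = "keys k \<union> keys l"
  have "monomial_eval f (k + l) = (\<Prod>v\<in>?V. f v ^ lookup (k + l) v)"
    by (rule monomial_eval_superset) (auto dest: keys_add[THEN subsetD])
  also have "\<dots> = (\<Prod>v\<in>?V. f v ^ lookup k v) * (\<Prod>v\<in>?V. f v ^ lookup l v)"
    by (simp add: lookup_add power_add prod.distrib)
  also have "\<dots> = monomial_eval f k * monomial_eval f l"
    by (simp add: monomial_eval_superset[of ?V])
  finally show ?thesis .
qed

lemma monomial_eval_single [simp]: "monomial_eval f (single v i) = f v ^ i"
  by (simp add: monomial_eval_def)

text \<open>The homomorphism to Q[Y] that sends the X-variables to integers and keeps Y. It serves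
  to test identities and to recognise non-units by their degree in Y.\<close>

definition eval_Y :: "(nat \<Rightarrow> int) \<Rightarrow> rat mpoly \<Rightarrow> rat poly" where
  "eval_Y x p = (\<Sum>k\<in>keys p. [:lookup p k:] *
     monomial_eval (\<lambda>v. if v = 0 then [:0, 1:] else [:of_int (x v):]) k)"

lemma eval_Y_superset:
  assumes "finite S" "keys p \<subseteq> S"
  shows "eval_Y x p = (\<Sum>k\<in>S. [:lookup p k:] *
     monomial_eval (\<lambda>v. if v = 0 then [:0, 1:] else [:of_int (x v):]) k)"
  unfolding eval_Y_def using assms by (intro sum.mono_neutral_left) (auto simp: in_keys_iff)

lemma eval_Y_0 [simp]: "eval_Y x 0 = 0"
  by (simp add: eval_Y_def)

lemma eval_Y_single: "eval_Y x (single k c) =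
    [:c:] * monomial_eval (\<lambda>v. if v = 0 then [:0, 1:] else [:of_int (x v):]) k"
  by (subst eval_Y_superset[of "{k}"]) auto

lemma eval_Y_1 [simp]: "eval_Y x 1 = 1"
  using eval_Y_single[of x 0 1] by (simp add: monomial_eval_def)

lemma eval_Y_add: "eval_Y x (p + q) = eval_Y x p + eval_Y x q"
proof -
  let ?S = "keys p \<union> keys q"
  let ?M = "monomial_eval (\<lambda>v. if v = 0 then [:0, 1:] else [:of_int (x v):])"
  have "eval_Y x (p + q) = (\<Sum>k\<in>?S. [:lookup (p + q) k:] * ?M k)"
    by (rule eval_Y_superset) (simp_all add: keys_add)
  also have "\<dots> = (\<Sum>k\<in>?S. [:lookup p k:] * ?M k + [:lookup q k:] * ?M k)"
    by (simp only: distrib_right[symmetric] add_pCons lookup_add add_0_left)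
  also have "\<dots> = (\<Sum>k\<in>?S. [:lookup p k:] * ?M k) + (\<Sum>k\<in>?S. [:lookup q k:] * ?M k)"
    by (rule sum.distrib)
  also have "(\<Sum>k\<in>?S. [:lookup p k:] * ?M k) = eval_Y x p"
    by (rule eval_Y_superset[symmetric]) auto
  also have "(\<Sum>k\<in>?S. [:lookup q k:] * ?M k) = eval_Y x q"
    by (rule eval_Y_superset[symmetric]) auto
  finally show ?thesis .
qed

lemma eval_Y_sum: "eval_Y x (sum p I) = (\<Sum>i\<in>I. eval_Y x (p i))"
  by (induction I rule: infinite_finite_induct) (auto simp: eval_Y_add)

lemma eval_Y_mult: "eval_Y x (p * q) = eval_Y x p * eval_Y x q"
proof -
  let ?s = "\<lambda>p k. single k (lookup p k)"
  have "p * q = (\<Sum>k\<in>keys p. ?s p k) * (\<Sum>l\<in>keys q. ?s q l)"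
    by (simp only: sum_single_lookup)
  also have "\<dots> = (\<Sum>k\<in>keys p. \<Sum>l\<in>keys q. ?s p k * ?s q l)"
    by (rule sum_product)
  finally have "eval_Y x (p * q) =
      (\<Sum>k\<in>keys p. \<Sum>l\<in>keys q. eval_Y x (?s p k * ?s q l))"
    by (simp add: eval_Y_sum)
  also have "\<dots> = (\<Sum>k\<in>keys p. \<Sum>l\<in>keys q. eval_Y x (?s p k) * eval_Y x (?s q l))"
    by (simp add: mult_single eval_Y_single monomial_eval_add mult_ac)
  also have "\<dots> = (\<Sum>k\<in>keys p. eval_Y x (?s p k)) * (\<Sum>l\<in>keys q. eval_Y x (?s q l))"
    by (rule sum_product[symmetric])
  also have "\<dots> = eval_Y x p * eval_Y x q"
    by (simp only: eval_Y_sum[symmetric] sum_single_lookup)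
  finally show ?thesis .
qed

lemma eval_Y_power: "eval_Y x (p ^ k) = eval_Y x p ^ k"
  by (induction k) (auto simp: eval_Y_mult)

lemma eval_Y_minus: "eval_Y x (- p) = - eval_Y x p"
  using eval_Y_add[of x p "- p"] by (simp add: eq_neg_iff_add_eq_0 add.commute)

text \<open>Without Y the specialisations are constants, namely the values of p at integer points,
  and these determine p.\<close>

lemma mpoly_eq_0_if_eval_Y:
  assumes p: "p \<in> over {1..n}" and "\<And>x. eval_Y x p = 0"
  shows "p = 0"
proof -
  have "lookup p k = 0" if k: "k \<in> keys p" for k
  proof (rule vanishing_sum_coeffs[of "keys p" n lookup "lookup p"])
    have sub: "keys l \<subseteq> {1..n}" if "l \<in> keys p" for l
      using p that by (auto simp: over_def mpoly_vars_def)
    show "\<exists>v\<in>{1..n}. lookup s v \<noteq> lookup t v"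
      if "s \<in> keys p" "t \<in> keys p" "s \<noteq> t" for s t
    proof (rule ccontr)
      assume no: "\<not> ?thesis"
      have "s = t"
      proof (rule poly_mapping_eqI)
        fix v
        show "lookup s v = lookup t v"
        proof (cases "v \<in> {1..n}")
          case False
          then have "v \<notin> keys s" "v \<notin> keys t"
            using sub[OF that(1)] sub[OF that(2)] by blast+
          then show ?thesis by (simp add: in_keys_iff)
        qed (use no in blast)
      qed
      with that show False by simp
    qed
    fix x :: "nat \<Rightarrow> int"
    have "[:(\<Sum>s\<in>keys p. lookup p s * (\<Prod>v\<in>{1..n}. of_int (x v) ^ lookup s v)):] = eval_Y x p"
    proof -
      have "monomial_eval (\<lambda>v. if v = 0 then [:0, 1:] else [:of_int (x v):]) s =
          [:\<Prod>v\<in>{1..n}. rat_of_int (x v) ^ lookup s v:]" if "s \<in> keys p" for s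
      proof -
        have "monomial_eval (\<lambda>v. if v = 0 then [:0, 1:] else [:of_int (x v):]) s =
          (\<Prod>v\<in>{1..n}. [:rat_of_int (x v) ^ lookup s v:])"
          using sub[OF that] by (subst monomial_eval_superset[of "{1..n}"]) (auto simp:
            poly_const_pow intro!: prod.cong)
        then show ?thesis by (simp add: prod_const_poly)
      qed
      then show ?thesis by (simp add: eval_Y_def sum_const_poly mult.commute)
    qed
    then show "(\<Sum>s\<in>keys p. lookup p s * (\<Prod>v\<in>{1..n}. of_int (x v) ^ lookup s v)) = 0"
      using assms(2)[of x] by simp
  qed (use k in auto)
  then show ?thesis by (metis in_keys_iff keys_eq_empty ex_in_conv)
qed

lemma rat_polyfun_mpoly:
  assumes "rat_polyfun n d g"
  shows "\<exists>q \<in> over {1..n}. \<forall>x. eval_Y x q = [:g x:]"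
  using assms
proof (induction n arbitrary: g)
  case 0
  then obtain c where "g = (\<lambda>_. c)" by auto
  then show ?case
    by (intro bexI[of _ "single 0 c"]) (auto simp: eval_Y_single monomial_eval_def intro:
      over_closed)
next
  case (Suc n)
  from Suc.prems obtain c where c: "\<forall>i\<le>d. rat_polyfun n d (c i)"
    "g = (\<lambda>x. \<Sum>i\<le>d. c i x * of_int (x (Suc n)) ^ i)" by auto
  have "\<forall>i\<in>{..d}. \<exists>q. q \<in> over {1..n} \<and> (\<forall>x. eval_Y x q = [:c i x:])"
    using Suc.IH c(1) unfolding Bex_def by blast
  then obtain q where q: "\<And>i. i \<le> d \<Longrightarrow> q i \<in> over {1..n}" "\<And>i x. i \<le> d \<Longrightarrow> eval_Y x (q i) = [:c i x:]"
    unfolding bchoice_iff by auto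
  define Q where "Q = (\<Sum>i\<le>d. q i * single (single (Suc n) i) 1)"
  have "Q \<in> over {1..Suc n}" unfolding Q_def
  proof (intro over_sum over_closed(2))
    fix i assume "i \<in> {..d}"
    then show "q i \<in> over {1..Suc n}" using over_mono[OF q(1)] by auto
    show "single (single (Suc n) i) 1 \<in> over {1..Suc n}"
      by (rule over_closed(4)) auto
  qed
  moreover have "eval_Y x Q = [:g x:]" for x
  proof -
    have "eval_Y x Q = (\<Sum>i\<le>d. [:c i x:] * [:of_int (x (Suc n)) ^ i:])"
      unfolding Q_def eval_Y_sum eval_Y_mult
      by (intro sum.cong) (auto simp: q(2) eval_Y_single poly_const_pow)
    then show ?thesis by (simp add: c(2) sum_const_poly mult.commute)
  qed
  ultimately show ?case by blast
qed

section \<open>The given polynomial as a polynomial in Y\<close>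

lemma mpoly_ring_eq_over: "mpoly_ring n = over {0..n}"
  by (simp add: mpoly_ring_def over_def)

lemma lookup_rat_mpoly: "lookup (rat_mpoly F) k = of_int (lookup F k)"
  by (simp add: rat_mpoly_def map.rep_eq when_def)

lemma keys_rat_mpoly: "keys (rat_mpoly F) = keys F"
  by (auto simp: in_keys_iff lookup_rat_mpoly)

definition Y_coeff :: "int mpoly \<Rightarrow> nat \<Rightarrow> nat \<Rightarrow> (nat \<Rightarrow> int) \<Rightarrow> int" where
  "Y_coeff F n j x = (\<Sum>k\<in>{k \<in> keys F. lookup k 0 = j}.
     lookup F k * (\<Prod>v\<in>{1..n}. x v ^ lookup k v))"

lemma lookup_le_degree_in: "k \<in> keys F \<Longrightarrow> lookup k v \<le> degree_in v F"
  unfolding degree_in_def by (rule Max_ge) auto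

lemma eval_mpoly_Y_coeff:
  assumes F: "F \<in> mpoly_ring n"
  shows "eval_mpoly F (x(0 := y)) = (\<Sum>j\<le>degree_in 0 F. Y_coeff F n j x * y ^ j)"
proof -
  have "(\<Sum>j\<le>degree_in 0 F. Y_coeff F n j x * y ^ j) =
      (\<Sum>j\<le>degree_in 0 F. \<Sum>k\<in>{k \<in> keys F. lookup k 0 = j}.
        lookup F k * (\<Prod>v\<in>keys k. (x(0 := y)) v ^ lookup k v))"
    unfolding Y_coeff_def sum_distrib_right
  proof (intro sum.cong refl)
    fix j k assume k: "k \<in> {k \<in> keys F. lookup k 0 = j}"
    have "keys k \<subseteq> {0..n}" using F k by (auto simp: mpoly_ring_def mpoly_vars_def)
    then have "monomial_eval (x(0 := y)) k = (\<Prod>v\<in>{0..n}. (x(0 := y)) v ^ lookup k v)"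
      by (intro monomial_eval_superset) auto
    also have "{0..n} = insert 0 {1..n}" by auto
    also have "(\<Prod>v\<in>insert 0 {1..n}. (x(0 := y)) v ^ lookup k v) =
        y ^ j * (\<Prod>v\<in>{1..n}. (x(0 := y)) v ^ lookup k v)" using k by simp
    also have "(\<Prod>v\<in>{1..n}. (x(0 := y)) v ^ lookup k v) = (\<Prod>v\<in>{1..n}. x v ^ lookup k v)"
      by (intro prod.cong) auto
    finally show "lookup F k * (\<Prod>v\<in>{1..n}. x v ^ lookup k v) * y ^ j =
        lookup F k * (\<Prod>v\<in>keys k. (x(0 := y)) v ^ lookup k v)"
      by (simp add: monomial_eval_def)
  qed
  also have "\<dots> = eval_mpoly F (x(0 := y))"
    unfolding eval_mpoly_def by (rule sum.group) (auto simp: lookup_le_degree_in)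
  finally show ?thesis ..
qed

text \<open>Monomials with the top exponent of Y remain distinct after division by Y^m, so their
  coefficients cannot cancel; a constant leading coefficient therefore leaves Y^m alone.\<close>

lemma leading_keys:
  fixes F :: "int mpoly"
  assumes lc: "lead_coeff_in 0 F = const_mpoly c" and c: "c \<noteq> 0"
  defines "m \<equiv> degree_in 0 F"
  shows "{k \<in> keys F. lookup k 0 = m} = {single 0 m}"
    and "lookup F (single 0 m) = c"
proof -
  let ?T = "{k \<in> keys F. lookup k 0 = m}"
  have split: "k = (k - single 0 m) + single 0 m" if "k \<in> ?T" for k :: monomial
    using that by (intro poly_mapping_eqI) (auto simp: lookup_add lookup_minus lookup_single
      when_def)
  have lookup_T: "lookup (coeff_in 0 F m) (k - single 0 m) = lookup F k"
    if k: "k \<in> ?T" for k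
  proof -
    have "lookup (coeff_in 0 F m) (k - single 0 m) =
      (\<Sum>l\<in>?T. if l = k then lookup F l else 0)"
      unfolding coeff_in_def lookup_sum
    proof (intro sum.cong refl)
      fix l assume l: "l \<in> ?T"
      have "l - single 0 m = k - single 0 m \<longleftrightarrow> l = k"
        using split[OF l] split[OF k] by metis
      then show "lookup (single (l - single 0 m) (lookup F l)) (k - single 0 m)
          = (if l = k then lookup F l else 0)"
        by (simp add: lookup_single when_def)
    qed
    then show ?thesis using k by simp
  qed
  have coeff: "coeff_in 0 F m = single 0 c"
    using lc by (simp add: lead_coeff_in_def const_mpoly_def m_def)
  have T: "k = single 0 m \<and> lookup F k = c" if k: "k \<in> ?T" for k
  proof -
    have "lookup F k \<noteq> 0" using k by (simp add: in_keys_iff)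
    then have "lookup (single 0 c) (k - single 0 m) \<noteq> 0"
      using lookup_T[OF k] coeff by simp
    then have "k - single 0 m = 0" by (auto simp: lookup_single when_def split: if_splits)
    then show ?thesis using split[OF k] lookup_T[OF k] coeff by simp
  qed
  have "?T \<noteq> {}"
  proof
    assume "?T = {}"
    then have "coeff_in 0 F m = 0" unfolding coeff_in_def by (simp only: sum.empty)
    with coeff c show False by (metis lookup_single_eq lookup_zero)
  qed
  then obtain k where "k \<in> ?T" by blast
  with T[of k] have "single 0 m \<in> ?T" by metis
  with T show "?T = {single 0 m}" by blast
  from T[OF \<open>single 0 m \<in> ?T\<close>] show "lookup F (single 0 m) = c" ..
qed

lemma Y_coeff_leading:
  assumes "lead_coeff_in 0 F = const_mpoly c" "c \<noteq> 0"
  shows "Y_coeff F n (degree_in 0 F) x = c"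
proof -
  have "(\<Prod>v\<in>{1..n}. x v ^ lookup (single 0 (degree_in 0 F)) v) = 1"
    by (intro prod.neutral) (auto simp: lookup_single when_def)
  then show ?thesis unfolding Y_coeff_def leading_keys(1)[OF assms]
    by (simp add: leading_keys(2)[OF assms])
qed

lemma rat_mpoly_Y_expansion:
  assumes F: "F \<in> mpoly_ring n"
  obtains A where "\<And>j. A j \<in> over {1..n}" "\<And>j x. eval_Y x (A j) = [:of_int (Y_coeff F n j x):]"
    "rat_mpoly F = (\<Sum>j\<le>degree_in 0 F. A j * single (single 0 1) 1 ^ j)"
proof -
  let ?K = "\<lambda>j. {k \<in> keys F. lookup k 0 = j}"
  define f where "f = rat_mpoly F"
  define A where "A j = (\<Sum>k\<in>?K j. single (k - single 0 j) (lookup f k))" for j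
  have sub: "keys (k - single 0 j) \<subseteq> {1..n}" if "k \<in> ?K j" for k j
  proof
    fix v assume v: "v \<in> keys (k - single 0 j)"
    then have "lookup k v - lookup (single 0 j) v \<noteq> 0"
      by (simp add: in_keys_iff lookup_minus)
    then have "v \<noteq> 0" "v \<in> keys k"
      using that by (auto simp: in_keys_iff lookup_single when_def split: if_splits)
    moreover have "keys k \<subseteq> {0..n}" using F that by (auto simp: mpoly_ring_def mpoly_vars_def)
    ultimately show "v \<in> {1..n}" by auto
  qed
  have 1: "A j \<in> over {1..n}" for j unfolding A_def by (intro over_sum over_closed(4)) (rule sub)
  have 2: "eval_Y x (A j) = [:of_int (Y_coeff F n j x):]" for j x
  proof -
    have "eval_Y x (A j) = (\<Sum>k\<in>?K j. [:of_int (lookup F k * (\<Prod>v\<in>{1..n}. x v ^ lookup k v)):])"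
      unfolding A_def eval_Y_sum eval_Y_single
    proof (intro sum.cong refl)
      fix k assume k: "k \<in> ?K j"
      have "monomial_eval (\<lambda>v. if v = 0 then [:0, 1:] else [:rat_of_int (x v):]) (k - single 0 j)
        = (\<Prod>v\<in>{1..n}. (if v = 0 then [:0, 1:] else [:rat_of_int (x v):]) ^ lookup (k - single 0 j)
          v)"
        using sub[OF k] by (intro monomial_eval_superset) auto
      also have "\<dots> = (\<Prod>v\<in>{1..n}. [:of_int (x v ^ lookup k v):])"
        by (intro prod.cong) (auto simp: lookup_minus lookup_single when_def poly_const_pow)
      finally show "[:lookup f k:] * monomial_eval (\<lambda>v.
        if v = 0 then [:0, 1:] else [:rat_of_int (x v):]) (k - single 0 j)
        = [:of_int (lookup F k * (\<Prod>v\<in>{1..n}. x v ^ lookup k v)):]"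
        by (simp add: prod_const_poly f_def lookup_rat_mpoly)
    qed
    then show ?thesis by (simp add: sum_const_poly Y_coeff_def)
  qed
  have Y: "single (single 0 1) 1 ^ j = (single (single 0 j) 1 :: rat mpoly)" for j
  proof (induction j)
    case (Suc j)
    then show ?case by (simp add: mult_single flip: single_add)
  qed simp
  have "(\<Sum>j\<le>degree_in 0 F. A j * single (single 0 1) 1 ^ j) =
    (\<Sum>j\<le>degree_in 0 F. \<Sum>k\<in>?K j. single k (lookup f k))"
    unfolding Y A_def sum_distrib_right
  proof (intro sum.cong refl)
    fix j k assume k: "k \<in> ?K j"
    have "k - single 0 j + single 0 j = k"
      using k by (intro poly_mapping_eqI) (auto simp: lookup_add lookup_minus lookup_single
        when_def)
    then show "single (k - single 0 j) (lookup f k) * single (single 0 j) 1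
        = single k (lookup f k)" by (simp add: mult_single)
  qed
  also have "\<dots> = (\<Sum>k\<in>keys F. single k (lookup f k))"
    by (rule sum.group) (auto simp: lookup_le_degree_in)
  also have "\<dots> = f" unfolding f_def by (simp only: keys_rat_mpoly[symmetric] sum_single_lookup)
  finally show ?thesis using that[OF 1 2] by (simp add: f_def)
qed

text \<open>A root h comes from a polynomial q in X, and F = F(Y) - F(q) is divisible by Y - q. At
  an integer point Y - q has degree 1 in Y, so it is not a unit; were the cofactor a unit, F would
  specialise to degree at most 1, against its leading term c Y^m with m >= 2.\<close>

lemma irreducible_no_polyfun_root:
  assumes F: "F \<in> mpoly_ring n" and irr: "irreducible_in (mpoly_ring n) (rat_mpoly F)"
    and deg: "degree_in 0 F \<ge> 2" and lc: "lead_coeff_in 0 F = const_mpoly c" "c \<noteq> 0"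
    and h: "rat_polyfun n d h"
  shows "\<exists>x. (\<Sum>j\<le>degree_in 0 F. of_int (Y_coeff F n j x) * h x ^ j) \<noteq> 0"
proof (rule ccontr)
  assume "\<not> ?thesis"
  then have zero: "(\<Sum>j\<le>degree_in 0 F. of_int (Y_coeff F n j x) * h x ^ j) = 0" for x by blast
  define m where "m = degree_in 0 F"
  define Y :: "rat mpoly" where "Y = single (single 0 1) 1"
  from rat_mpoly_Y_expansion[OF F] obtain A where A: "\<And>j. A j \<in> over {1..n}"
    "\<And>j x. eval_Y x (A j) = [:of_int (Y_coeff F n j x):]" "rat_mpoly F = (\<Sum>j\<le>m. A j * Y ^ j)"
    unfolding m_def Y_def by blast
  from rat_polyfun_mpoly[OF h] obtain q where q: "q \<in> over {1..n}" "\<And>x. eval_Y x q = [:h x:]"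
    by blast
  have over0: "p \<in> over {0..n}" if "p \<in> over {1..n}" for p :: "rat mpoly" using that
    by (rule over_mono) auto
  have Y: "Y \<in> over {0..n}" unfolding Y_def by (rule over_closed(4)) auto
  have eY: "eval_Y x Y = [:0, 1:]" for x by (simp add: Y_def eval_Y_single)
  \<comment> \<open>Q collects the quotients of Y^j - q^j by Y - q.\<close>
  define Q where "Q = (\<Sum>j\<le>m. A j * (\<Sum>i<j. q ^ (j - Suc i) * Y ^ i))"
  have Q: "Q \<in> over {0..n}"
    unfolding Q_def by (intro over_sum over_closed(2) over_power over0 A q Y)
  have "(\<Sum>j\<le>m. A j * q ^ j) = 0"
  proof (rule mpoly_eq_0_if_eval_Y)
    show "(\<Sum>j\<le>m. A j * q ^ j) \<in> over {1..n}" by (intro over_sum over_closed(2) over_power A q)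
    show "eval_Y x (\<Sum>j\<le>m. A j * q ^ j) = 0" for x
      using zero[of x] by (simp add: eval_Y_sum eval_Y_mult eval_Y_power A q poly_const_pow
        sum_const_poly m_def mult.commute)
  qed
  then have "rat_mpoly F = (\<Sum>j\<le>m. A j * (Y ^ j - q ^ j))"
    unfolding A(3) by (simp add: right_diff_distrib sum_subtractf)
  also have "\<dots> = (\<Sum>j\<le>m. (Y - q) * (A j * (\<Sum>i<j. q ^ (j - Suc i) * Y ^ i)))"
    by (intro sum.cong refl) (simp only: power_diff_sumr2 mult.left_commute)
  also have "\<dots> = (Y - q) * Q" unfolding Q_def by (rule sum_distrib_left[symmetric])
  finally have fact: "rat_mpoly F = (Y + - q) * Q" by simp
  have Yq: "Y + - q \<in> over {0..n}" by (intro over_closed Y over0 q)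
  from irr fact Yq Q have "(\<exists>u\<in>over {0..n}. (Y + - q) * u = 1) \<or> (\<exists>u\<in>over {0..n}. Q * u = 1)"
    unfolding irreducible_in_def mpoly_ring_eq_over by blast
  moreover have unit: "degree (eval_Y x p) = 0" if "p * u = 1" for p u x
  proof -
    have "eval_Y x p * eval_Y x u = 1" using that by (simp flip: eval_Y_mult)
    then show ?thesis using poly_dvd_1[of "eval_Y x p"] by (metis dvd_triv_left)
  qed
  moreover have ev: "eval_Y x (Y + - q) = [:- h x, 1:]" for x
    unfolding eval_Y_add eval_Y_minus eY q by simp
  ultimately obtain u where u: "Q * u = 1" by fastforce
  define x0 :: "nat \<Rightarrow> int" where "x0 = (\<lambda>_. 0)"
  have "degree (eval_Y x0 (rat_mpoly F)) \<le> degree [:- h x0, 1:] + degree (eval_Y x0 Q)"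
    unfolding fact eval_Y_mult ev by (rule degree_mult_le)
  then have "degree (eval_Y x0 (rat_mpoly F)) \<le> 1" using unit[OF u] by simp
  moreover have "coeff (eval_Y x0 (rat_mpoly F)) m = of_int c"
  proof -
    have "eval_Y x0 (rat_mpoly F) = (\<Sum>j\<le>m. monom (of_int (Y_coeff F n j x0)) j)"
      unfolding A(3) by (simp add: eval_Y_sum eval_Y_mult eval_Y_power A(2) eY monom_altdef)
    then show ?thesis using Y_coeff_leading[OF lc]
      by (simp add: Polynomial.coeff_sum coeff_monom m_def)
  qed
  then have "m \<le> degree (eval_Y x0 (rat_mpoly F))" using lc(2) by (intro le_degree) simp
  ultimately show False using deg by (simp add: m_def)
qed

text \<open>Monomials with equal exponent of Y differ in an X-exponent, so no two coefficients of F
  are added and the height itself is the bound.\<close>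

lemma int_polyfun_Y_coeff:
  assumes F: "F \<in> mpoly_ring n"
  shows "int_polyfun (real_of_int (mpoly_height F)) n (total_degree F) (Y_coeff F n j)"
proof -
  have fin: "finite (insert 0 ((\<lambda>m. \<bar>lookup F m\<bar>) ` keys F))" by simp
  show ?thesis
    unfolding Y_coeff_def[abs_def]
  proof (rule int_polyfun_monomial_sum)
    show "0 \<le> real_of_int (mpoly_height F)"
      unfolding mpoly_height_def using Max_ge[OF fin, of 0] by simp
    fix k assume k: "k \<in> {k \<in> keys F. lookup k 0 = j}"
    then have "\<bar>lookup F k\<bar> \<le> mpoly_height F"
      unfolding mpoly_height_def by (intro Max_ge) auto
    then show "\<bar>real_of_int (lookup F k)\<bar> \<le> real_of_int (mpoly_height F)" by linarith
    have deg: "monomial_degree k \<le> total_degree F"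
      unfolding total_degree_def using k by (intro Max_ge) auto
    have "lookup k v \<le> monomial_degree k" for v
    proof (cases "v \<in> keys k")
      case True
      then show ?thesis unfolding monomial_degree_def by (intro member_le_sum) auto
    qed (simp add: in_keys_iff)
    then show "lookup k v \<le> total_degree F" for v using deg by (rule order.trans)
  next
    fix s t
    assume st: "s \<in> {k \<in> keys F. lookup k 0 = j}"
      "t \<in> {k \<in> keys F. lookup k 0 = j}" "s \<noteq> t"
    have "\<exists>v. lookup s v \<noteq> lookup t v"
    proof (rule ccontr)
      assume "\<not> ?thesis"
      then have "s = t" by (intro poly_mapping_eqI) simp
      with st(3) show False ..
    qed
    then obtain v where v: "lookup s v \<noteq> lookup t v" ..
    then have "v \<in> keys s \<union> keys t" by (auto simp: in_keys_iff)
    moreover have "keys s \<subseteq> {0..n}" "keys t \<subseteq> {0..n}"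
      using F st by (auto simp: mpoly_ring_def mpoly_vars_def)
    moreover have "v \<noteq> 0" using st v by (intro notI) simp
    ultimately have "v \<in> {1..n}" by auto
    with v show "\<exists>v\<in>{1..n}. lookup s v \<noteq> lookup t v" by blast
  qed simp
qed

theorem theorem2p12:
  fixes n :: nat
  assumes "n \<ge> 1"
  shows "\<exists>e::real. e > 0 \<and> (\<exists>C::nat \<Rightarrow> real. \<forall>(D::nat) (F::int mpoly).
    F \<in> mpoly_ring n \<and>
    irreducible_in (mpoly_ring n) (rat_mpoly F) \<and>
    total_degree F = D \<and>
    degree_in 0 F \<ge> 2 \<and>
    (\<exists>c. c \<noteq> 0 \<and> lead_coeff_in 0 F = const_mpoly c) \<longrightarrow>
    (\<forall>B::real. B \<ge> 1 \<longrightarrow>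
      real (root_count n F B) \<le>
        C D * ln (real_of_int (mpoly_height F) + 2) powr e
            * B powr (real n - 1 / 2) * ln (B + 2) powr e))"
proof -
  have "\<forall>m d. \<exists>C\<ge>0. \<forall>c M B. (\<forall>j<m. int_polyfun M n d (c j)) \<and> 3 \<le> M \<and> real B \<le> M \<and> 1 \<le> B \<and>
      \<not> has_polyfun_root n d m c \<longrightarrow>
    real (card (root_points n m c B)) \<le> C * ln M ^ 3 * (real B ^ n / sqrt (real B))"
    by (intro allI rootless_count)
  then obtain C0 where C0': "\<forall>m d. C0 m d \<ge> 0 \<and> (\<forall>c M B. (\<forall>j<m. int_polyfun M n d (c j)) \<and> 3 \<le> M \<and>
    real B \<le> M \<and> 1 \<le> B \<and>
      \<not> has_polyfun_root n d m c \<longrightarrow>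
    real (card (root_points n m c B)) \<le> C0 m d * ln M ^ 3 * (real B ^ n / sqrt (real B)))"
    unfolding choice_iff by blast
  have C0: "C0 m d \<ge> 0" for m d using C0' by blast
  have count: "real (card (root_points n m c B)) \<le> C0 m d * ln M ^ 3 * (real B ^ n / sqrt (real B))"
    if "(\<forall>j<m. int_polyfun M n d (c j)) \<and> 3 \<le> M \<and> real B \<le> M \<and> 1 \<le> B \<and> \<not> has_polyfun_root n d m c"
    for m d c M B using C0' that by blast
  \<comment> \<open>The constant may depend on D only, while the Y-degree m ranges up to D; the sum
    covers every m, and (m + 1)^3 comes from ln M <= (m + 1) ln (h + 2) ln (B + 2).\<close>
  define C where "C D = (\<Sum>m\<le>D. C0 m D * (real m + 1) ^ 3)" for D
  have main: "real (root_count n F B) \<le> C D * ln (real_of_int (mpoly_height F) + 2) powr 3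
            * B powr (real n - 1 / 2) * ln (B + 2) powr 3"
    if F: "F \<in> mpoly_ring n" "irreducible_in (mpoly_ring n) (rat_mpoly F)" "total_degree F = D"
      "degree_in 0 F \<ge> 2" and c: "c \<noteq> 0" "lead_coeff_in 0 F = const_mpoly c" and B: "B \<ge> 1"
    for D F c and B :: real
  proof -
    define m where "m = degree_in 0 F"
    define h where "h = real_of_int (mpoly_height F)"
    define b where "b = nat \<lfloor>B\<rfloor>"
    define cs where "cs j x = c ^ (m - 1 - j) * Y_coeff F n j x" for j x
    have m: "m \<ge> 2" using F by (simp add: m_def)
    note lead = leading_keys[OF c(2,1)]
    have key: "single 0 m \<in> keys F"
      using lead(2) c(1) unfolding m_def by (simp add: in_keys_iff)
    have "\<bar>lookup F (single 0 m)\<bar> \<le> mpoly_height F"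
      unfolding mpoly_height_def using key by (intro Max_ge) auto
    then have "\<bar>c\<bar> \<le> mpoly_height F" using lead(2) by (simp add: m_def)
    then have ch: "\<bar>real_of_int c\<bar> \<le> h" unfolding h_def by linarith
    have h1: "1 \<le> h" using ch c(1) by linarith
    have mD: "m \<le> D"
    proof -
      have "monomial_degree (single 0 m) \<le> total_degree F"
        unfolding total_degree_def using key by (intro Max_ge) auto
      then show ?thesis using m F(3) by (simp add: monomial_degree_def)
    qed
    have b: "1 \<le> b" "real b \<le> B" using B unfolding b_def by linarith+
    \<comment> \<open>M has to bound B as well as the coefficients of the monic family, which are at
      most h^m. The summands 2 make both logarithms at least 1, so their sum is at most a multiple
      of their product.\<close>
    define M where "M = (h + 2) ^ m * (B + 2)"
    have hm: "1 \<le> (h + 2) ^ m" "h ^ m \<le> (h + 2) ^ m" using h1 by (auto intro: power_mono)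
    have M: "h ^ m \<le> M" "3 \<le> M" "real b \<le> M"
    proof -
      have 1: "(h + 2) ^ m * 1 \<le> M" unfolding M_def using h1 B by (intro mult_left_mono) auto
      have "1 * (B + 2) \<le> M" unfolding M_def using hm B by (intro mult_right_mono) auto
      then have 2: "B + 2 \<le> M" by simp
      show "h ^ m \<le> M" using 1 hm by linarith
      show "3 \<le> M" using 2 B by linarith
      show "real b \<le> M" using 2 b by linarith
    qed
    have poly: "int_polyfun M n D (cs j)" if j: "j < m" for j
      unfolding cs_def
    proof (rule polyfun_scale)
      show "int_polyfun h n D (Y_coeff F n j)" using int_polyfun_Y_coeff[OF F(1), of j]
        by (simp add: h_def F(3))
      fix a assume a: "\<bar>real_of_int a\<bar> \<le> h"
      have "\<bar>real_of_int c\<bar> ^ (m - 1 - j) \<le> h ^ (m - 1 - j)" using ch by (intro power_mono) auto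
      also have "\<dots> \<le> h ^ (m - 1)" using h1 by (intro power_increasing) auto
      finally have "\<bar>real_of_int c\<bar> ^ (m - 1 - j) * \<bar>real_of_int a\<bar> \<le> h ^ (m - 1) * h"
        using a h1 by (intro mult_mono) auto
      also have "\<dots> = h ^ m" using m by (simp flip: power_Suc2)
      finally show "\<bar>real_of_int (c ^ (m - 1 - j) * a)\<bar> \<le> M" using M(1)
        by (simp add: abs_mult power_abs)
    qed
    text \<open>The substitution \<open>Y \<mapsto> Y / c\<close> together with the factor \<open>c\<^sup>m\<^sup>-\<^sup>1\<close> makes \<open>F\<close> monic.\<close>
    have scale: "monic_eval m (\<lambda>j. of_int (cs j x)) (of_int c * y) =
        of_int c ^ (m - 1) * (\<Sum>j\<le>m. of_int (Y_coeff F n j x) * y ^ j)"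
          for y :: "'r::comm_ring_1" and x
    proof -
      have "of_int (cs j x) * (of_int c * y) ^ j = of_int c ^ (m - 1) * (of_int (Y_coeff F n j x)
        * y ^ j)"
        if "j < m" for j
      proof -
        have "(of_int c :: 'r) ^ (m - 1) = of_int c ^ (m - 1 - j) * of_int c ^ j"
          using that by (simp flip: power_add)
        then show ?thesis by (simp add: cs_def power_mult_distrib mult_ac)
      qed
      moreover have "(of_int c * y) ^ m = of_int c ^ (m - 1) * (of_int (Y_coeff F n m x) * y ^ m)"
        using m Y_coeff_leading[OF c(2,1), of n x]
          by (cases m) (simp_all add: m_def power_mult_distrib mult_ac)
      moreover have "{..m} = insert m {..<m}" by auto
      ultimately show ?thesis by (simp add: monic_eval_def sum_distrib_left distrib_left)
    qed
    have no_root: "\<not> has_polyfun_root n D m cs"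
    proof
      assume "has_polyfun_root n D m cs"
      then obtain g where g: "rat_polyfun n D g" "\<And>x. monic_eval m (\<lambda>j. of_int (cs j x)) (g x) = 0"
        unfolding has_polyfun_root_def by blast
      have "rat_polyfun n D (\<lambda>x. (1 / of_int c) * g x)" by (rule polyfun_scale[OF g(1)]) simp
      from irreducible_no_polyfun_root[OF F(1,2,4) c(2,1) this] obtain x where
        x: "(\<Sum>j\<le>m. of_int (Y_coeff F n j x) * ((1 / of_int c) * g x) ^ j) \<noteq> 0" by (auto simp: m_def)
      have "of_int c * ((1 / of_int c) * g x) = g x" using c(1) by simp
      then show False using scale[of x "(1 / of_int c) * g x"] g(2)[of x] x c(1) by simp
    qed
    have "{x \<in> int_box n B. \<exists>y. eval_mpoly F (x(0 := y)) = 0} \<subseteq> (root_points n m cs b)"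
    proof safe
      fix x y assume x: "x \<in> int_box n B" and y: "eval_mpoly F (x(0 := y)) = 0"
      have "z \<in> {- int b..int b}" if "\<bar>real_of_int z\<bar> \<le> B" for z
        using that B unfolding b_def by simp linarith
      then show "x \<in> box n b" using x unfolding int_box_def box_def by (auto simp: PiE_iff)
      have "monic_eval m (\<lambda>j. of_int (cs j x)) (of_int c * y) = 0"
        unfolding scale using y by (simp add: eval_mpoly_Y_coeff[OF F(1)] m_def)
      then show "\<exists>y. monic_eval m (\<lambda>j. cs j x) y = 0" by (simp add: exI[of _ "c * y"])
    qed
    then have "root_count n F B \<le> card (root_points n m cs b)"
      unfolding root_count_def by (intro card_mono) auto
    then have "real (root_count n F B) \<le> real (card (root_points n m cs b))" by simp
    also have "\<dots> \<le> C0 m D * ln M ^ 3 * (real b ^ n / sqrt (real b))"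
      using poly M b no_root by (intro count) auto
    also have "\<dots> \<le> C0 m D * ((real m + 1) * (ln (h + 2) * ln (B + 2))) ^ 3 * B powr (real n - 1 /
      2)"
    proof (rule mult_mono)
      have hB: "1 \<le> ln (h + 2)" "1 \<le> ln (B + 2)" using h1 B by (auto intro: one_le_ln)
      have "ln M = real m * ln (h + 2) + ln (B + 2)" using h1 B
        by (simp add: M_def ln_mult ln_realpow)
      also have "\<dots> \<le> real m * (ln (h + 2) * ln (B + 2)) + ln (h + 2) * ln (B + 2)"
      proof (intro add_mono mult_left_mono)
        show "ln (h + 2) \<le> ln (h + 2) * ln (B + 2)"
          using mult_left_mono[OF hB(2), of "ln (h + 2)"] hB by simp
        show "ln (B + 2) \<le> ln (h + 2) * ln (B + 2)"
          using mult_right_mono[OF hB(1), of "ln (B + 2)"] hB by simp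
      qed simp
      finally have "ln M \<le> (real m + 1) * (ln (h + 2) * ln (B + 2))" by (simp add: algebra_simps)
      then show "C0 m D * ln M ^ 3 \<le> C0 m D * ((real m + 1) * (ln (h + 2) * ln (B + 2))) ^ 3"
        using C0 M by (intro mult_left_mono power_mono) auto
      have "real b ^ n / sqrt (real b) = real b powr (real n - 1 / 2)"
        using b by (simp add: powr_diff powr_realpow powr_half_sqrt)
      also have "\<dots> \<le> B powr (real n - 1 / 2)" using assms b by (intro powr_mono2) auto
      finally show "real b ^ n / sqrt (real b) \<le> B powr (real n - 1 / 2)" .
      show "0 \<le> C0 m D * ((real m + 1) * (ln (h + 2) * ln (B + 2))) ^ 3" using C0 hB by simp
    qed auto
    also have "\<dots> = (C0 m D * (real m + 1) ^ 3) * (ln (h + 2) ^ 3 * B powr (real n - 1 / 2) *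
      ln (B + 2) ^ 3)"
      by (simp add: power_mult_distrib mult_ac)
    also have "\<dots> \<le> C D * (ln (h + 2) ^ 3 * B powr (real n - 1 / 2) * ln (B + 2) ^ 3)"
    proof (rule mult_right_mono)
      show "C0 m D * (real m + 1) ^ 3 \<le> C D"
        unfolding C_def using mD C0 by (intro member_le_sum) auto
    qed (use h1 B in auto)
    also have "\<dots> = C D * ln (h + 2) powr 3 * B powr (real n - 1 / 2) * ln (B + 2) powr 3"
      using h1 B by (simp add: powr_numeral mult_ac)
    finally show ?thesis by (simp add: h_def)
  qed
  show ?thesis by (intro exI[of _ 3] conjI exI[of _ C]) (use main in auto)
qed

end
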